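(* Consider the Schrödinger equation $$\big(\hbar^2\partial_x^2-q(x,\hbar)\big)\psi(x,\hbar)=0$$ with potential $q(x,\hbar)=q_0(x)+q_1(x)\hbar+\cdots+q_n(x)\hbar^n$, a polynomial in $\hbar$ whose coefficients $q_k$ are rational functions on $\mathbb{C}_x$. Assume: (1) Let $D\subset\mathbb{C}_x\cup\{\infty\}$ be the set of poles of $q_0$. Every pole $x_\infty\in D$ of $q_0$ has order $\operatorname{ord}(q_0)\ge2$; every $q_k$ has no poles other than in $D$; and for every $x_\infty\in D$ and every $k$, $\operatorname{ord}(q_k)\le\operatorname{ord}(q_0)$ at $x_\infty$. (2) $x_0\in\mathbb{C}_x$ is a point which is neither a pole nor a zero of $q_0$, and the real one-dimensional curve $$\Gamma(x_0):=\Big\{x\in\mathbb{C}_x : \operatorname{Im}\Big(\int_{x_0}^x\sqrt{q_0(t)}\,dt\Big)=0\Big\}$$ limits at both ends into points of $D$ (not necessarily distinct). Then the Schrödinger equation has a canonical local basis of exact WKB solutions $\psi_\pm$ normalised at $x_0$: that is, there are a neighbourhood $U_0$ of $x_0$, a sectorial domain $S_0 \subset \mathbb{C}_\hbar$ with opening $(-\tfrac{\pi}{2},+\tfrac{\pi}{2})$, and holomorphic functions $\psi_\pm$ on $U_0\times S_0$ which for each $\hbar \in S_0$ form a basis of solutions on $U_0$ and satisfy $$\psi_\pm(x_0,\hbar)=1\qquad\text{and}\qquad\psi_\pm(x,\hbar)\sim\hat\psi_\pm(x,\hbar)\quad\text{as }\hbar\to0\text{ in the right halfplane},$$ where $\hat\psi_\pm$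 are the formal WKB solutions normalised at $x_0$.
   Context: $\operatorname{ord}$ denotes the pole order of a rational function at a point of $\mathbb{C}_x\cup\{\infty\}$ (at $\infty$, computed in the coordinate $1/x$; nonpositive if there is no pole). The curve $\Gamma(x_0)$ means the maximal smooth connected curve through $x_0$ locally determined by the displayed equation (with $\sqrt{q_0}$ continued analytically along the curve from a fixed branch at $x_0$). A sectorial domain with opening $(-\frac{\pi}{2},\frac{\pi}{2})$ is a simply connected domain $S_0\subset\mathbb{C}_\hbar\setminus\{0\}$ whose closure in the real-oriented blowup $[0,\infty)\times(\mathbb{R}/2\pi\mathbb{Z})$ of $\mathbb{C}_\hbar$ at $0$ meets the boundary circle exactly in $[-\frac{\pi}{2},\frac{\pi}{2}]$. Formal WKB solutions. The Riccati equation $\hbar\,\partial_xf=f^2-q$ has near $x_0$ exactly two formal power series solutions $\hat f_\pm=\sum_{k\ge0}f_k^\pm(x)\hbar^k$ with holomorphic coefficients, with leading terms $f_0^\pm=\pm\sqrt{q_0}$. The formal WKB solutions normalised at $x_0$ are the formal expressions $\hat\psi_\pm(x,\hbar):=\exp\big(-\frac{1}{\hbar}\int_{x_0}^x\hat f_\pm(t,\hbar)\,dt\big)$. An exact WKB solution is an analytic solution $\psi(x,\hbar)$ of the Schrödinger equation which is asymptotic to a formal WKB solution as $\hbar\to0$ in the right halfplane. The relation $\psi_\pm\sim\hat\psi_\pm$ means that $\psi_\pm(x,\hbar)\exp\big(\frac{1}{\hbar}\int_{x_0}^xf_0^\pm(t)\,dt\big)$ admits, as $\hbar\to0$ along the arc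 $(-\frac{\pi}{2},\frac{\pi}{2})$, the Poincaré asymptotic expansion given by the formal power series in $\hbar$ obtained by expanding $\exp\big(-\sum_{k\ge0}\hbar^k\int_{x_0}^xf_{k+1}^\pm(t)\,dt\big)$. *)

theory Defs
  imports
    "HOL-Complex_Analysis.Complex_Analysis"
    "HOL-Computational_Algebra.Computational_Algebra"
    "HOL-Computational_Algebra.Field_as_Ring"
    "HOL-Library.Landau_Symbols"
begin

section \<open>Rational functions on the Riemann sphere\<close>

text \<open>A rational function is an element of the fraction field of \<open>\<complex>[x]\<close>. Since it is evaluated in
  lowest terms and \<open>z / 0 = 0\<close>, its value at a finite pole is the junk value \<open>0\<close>.\<close>

definition rat_eval :: "complex poly fract \<Rightarrow> complex \<Rightarrow> complex" where
  "rat_eval r x = poly (fst (quot_of_fract r)) x / poly (snd (quot_of_fract r)) x"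

text \<open>Points of \<open>\<complex> \<union> {\<infinity>}\<close> are elements of \<^typ>\<open>complex option\<close>, with \<open>None\<close> for \<open>\<infinity>\<close>.\<close>

definition riemann_sphere :: "complex option topology" where
  "riemann_sphere = Alexandroff_compactification euclidean"

text \<open>The function in a local coordinate \<open>u\<close> centred at the given point: \<open>u = x - a\<close> at a finite
  point \<open>a\<close>, and \<open>u = 1 / x\<close> at \<open>\<infinity>\<close>.\<close>

fun rat_germ :: "complex poly fract \<Rightarrow> complex option \<Rightarrow> complex \<Rightarrow> complex" where
  "rat_germ r (Some a) = (\<lambda>u. rat_eval r (a + u))"
| "rat_germ r None = (\<lambda>u. rat_eval r (1 / u))"

definition rat_poles :: "complex poly fract \<Rightarrow> complex option set" where
  "rat_poles r = {p. is_pole (rat_germ r p) 0}"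

text \<open>The convention for \<open>r = 0\<close> is only there because \<^const>\<open>zorder\<close> is unspecified for it;
  any nonpositive value would do.\<close>

definition pole_order :: "complex poly fract \<Rightarrow> complex option \<Rightarrow> int" where
  "pole_order r p = (if r = 0 then 0 else - zorder (rat_germ r p) 0)"


section \<open>The Schroedinger equation\<close>

text \<open>A potential is a polynomial in \<open>\<hbar>\<close> with rational functions of \<open>x\<close> as coefficients;
  \<^term>\<open>potential_at q x\<close> is the polynomial in \<open>\<hbar>\<close> obtained by evaluating them at \<open>x\<close>.\<close>

definition potential_at :: "complex poly fract poly \<Rightarrow> complex \<Rightarrow> complex poly" where
  "potential_at q x = map_poly (\<lambda>r. rat_eval r x) q"

definition schroedinger_solutions ::
    "complex poly fract poly \<Rightarrow> complex set \<Rightarrow> complex \<Rightarrow> (complex \<Rightarrow> complex) set" where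
  "schroedinger_solutions q U h = {\<phi>. \<phi> holomorphic_on U \<and>
     (\<forall>x\<in>U. h\<^sup>2 * (deriv ^^ 2) \<phi> x - poly (potential_at q x) h * \<phi> x = 0)}"

text \<open>Elements of the solution set carry junk values outside \<open>U\<close>, so linear combinations
  are compared on \<open>U\<close> only.\<close>

definition is_solution_basis ::
    "complex poly fract poly \<Rightarrow> complex set \<Rightarrow> complex \<Rightarrow> (complex \<Rightarrow> complex) \<Rightarrow> (complex \<Rightarrow> complex) \<Rightarrow> bool"
  where
  "is_solution_basis q U h \<phi>1 \<phi>2 \<longleftrightarrow>
     \<phi>1 \<in> schroedinger_solutions q U h \<and> \<phi>2 \<in> schroedinger_solutions q U h \<and>
     (\<forall>\<phi> \<in> schroedinger_solutions q U h.
        \<exists>!(c1, c2). \<forall>x\<in>U. \<phi> x = c1 * \<phi>1 x + c2 * \<phi>2 x)"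

text \<open>Joint holomorphy in two variables, on an open set: the Frechet derivative exists and is
  complex linear at every point.\<close>

definition holomorphic2_on :: "(complex \<Rightarrow> complex \<Rightarrow> complex) \<Rightarrow> (complex \<times> complex) set \<Rightarrow> bool" where
  "holomorphic2_on f W \<longleftrightarrow>
     (\<forall>w\<in>W. \<exists>a b. ((\<lambda>(x, h). f x h) has_derivative (\<lambda>(u, v). a * u + b * v)) (at w))"


section \<open>The curve through the base point\<close>

text \<open>The equation \<open>Im (\<integral> sqrt q0) = 0\<close> locally determines a smooth curve only away from the zeros and
  poles of \<open>q0\<close>, so these are excluded. The curve is given by a regular parametrisation \<open>\<gamma>\<close> over the
  whole real line (every open interval is diffeomorphic to it); \<open>s\<close> is the continuation along \<open>\<gamma>\<close> of
  the branch of \<open>sqrt q0\<close> that has the value \<open>s0\<close> at \<open>x0\<close>.\<close>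

definition level_curve ::
    "complex poly fract \<Rightarrow> complex \<Rightarrow> complex \<Rightarrow> (real \<Rightarrow> complex) \<Rightarrow> bool" where
  "level_curve q0 x0 s0 \<gamma> \<longleftrightarrow>
     \<gamma> 0 = x0 \<and>
     \<gamma> C1_differentiable_on UNIV \<and>
     (\<forall>t. vector_derivative \<gamma> (at t) \<noteq> 0) \<and>
     (\<forall>t. Some (\<gamma> t) \<notin> rat_poles q0 \<and> rat_eval q0 (\<gamma> t) \<noteq> 0) \<and>
     (\<exists>s. continuous_on UNIV s \<and> s 0 = s0 \<and> (\<forall>t. (s t)\<^sup>2 = rat_eval q0 (\<gamma> t)) \<and>
        (\<forall>t::real. Im (LBINT \<tau>=0..t. s \<tau> * vector_derivative \<gamma> (at \<tau>)) = 0))"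

definition maximal_level_curve ::
    "complex poly fract \<Rightarrow> complex \<Rightarrow> complex \<Rightarrow> (real \<Rightarrow> complex) \<Rightarrow> bool" where
  "maximal_level_curve q0 x0 s0 \<gamma> \<longleftrightarrow>
     level_curve q0 x0 s0 \<gamma> \<and> (\<forall>\<delta>. level_curve q0 x0 s0 \<delta> \<longrightarrow> range \<delta> \<subseteq> range \<gamma>)"


section \<open>Sectorial domains and asymptotic expansions\<close>

text \<open>The real-oriented blowup of \<open>\<complex>\<close> at \<open>0\<close> is the closed subset \<open>[0,\<infinity>) \<times> S\<^sup>1\<close> of \<open>\<real> \<times> \<complex>\<close>, the circle
  \<open>\<real>/2\<pi>\<int>\<close> being identified with the unit circle; a nonzero \<open>h\<close> has coordinates \<open>(\<bar>h\<bar>, h / \<bar>h\<bar>)\<close>.\<close>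

definition sectorial_domain :: "real \<Rightarrow> real \<Rightarrow> complex set \<Rightarrow> bool" where
  "sectorial_domain \<alpha> \<beta> S \<longleftrightarrow>
     open S \<and> simply_connected S \<and> 0 \<notin> S \<and>
     {u. (0, u) \<in> closure ((\<lambda>h. (norm h, sgn h)) ` S)} = cis ` {\<alpha>..\<beta>}"

definition closed_sector :: "real \<Rightarrow> real \<Rightarrow> complex set" where
  "closed_sector \<alpha> \<beta> = {rcis r \<theta> | r \<theta>. 0 < r \<and> \<theta> \<in> {\<alpha>..\<beta>}}"

text \<open>Asymptotics along the open arc \<open>(\<alpha>,\<beta>)\<close> are uniform on compact subarcs.\<close>

definition poincare_expansion ::
    "real \<Rightarrow> real \<Rightarrow> complex set \<Rightarrow> (complex \<Rightarrow> complex) \<Rightarrow> complex fps \<Rightarrow> bool" where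
  "poincare_expansion \<alpha> \<beta> S g A \<longleftrightarrow>
     (\<forall>\<alpha>' \<beta>' N. \<alpha> < \<alpha>' \<and> \<alpha>' \<le> \<beta>' \<and> \<beta>' < \<beta> \<longrightarrow>
        (\<lambda>h. g h - (\<Sum>k<N. fps_nth A k * h ^ k))
          \<in> O[at 0 within (S \<inter> closed_sector \<alpha>' \<beta>')](\<lambda>h. h ^ N))"


section \<open>Formal and exact WKB solutions\<close>

text \<open>\<open>\<hbar> \<partial>\<^sub>x f = f\<^sup>2 - q\<close>, read in \<open>\<complex>[[\<hbar>]]\<close> at every \<open>x \<in> U\<close>, for \<open>f = \<Sum>k. f k \<hbar>^k\<close>. Its order-zero part
  is \<open>(f 0)\<^sup>2 = q0\<close>, so on a connected \<open>U\<close> the condition \<open>f 0 x0 = s\<close> selects the leading branch.\<close>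

definition formal_riccati_solution ::
    "complex poly fract poly \<Rightarrow> complex set \<Rightarrow> complex \<Rightarrow> complex \<Rightarrow> (nat \<Rightarrow> complex \<Rightarrow> complex) \<Rightarrow> bool"
  where
  "formal_riccati_solution q U x0 s f \<longleftrightarrow>
     (\<forall>k. f k holomorphic_on U) \<and> f 0 x0 = s \<and>
     (\<forall>x\<in>U. fps_X * Abs_fps (\<lambda>k. deriv (f k) x)
            = (Abs_fps (\<lambda>k. f k x))\<^sup>2 - fps_of_poly (potential_at q x))"

text \<open>The exponential of an arbitrary formal power series; the constant term is split off because
  \<^const>\<open>fps_compose\<close> is only meaningful for an inner series without constant term.\<close>

definition fps_exponential :: "complex fps \<Rightarrow> complex fps" where
  "fps_exponential G =
     fps_const (exp (fps_nth G 0)) * fps_compose (fps_exp 1) (G - fps_const (fps_nth G 0))"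

text \<open>The series of \<open>exp (- (\<Sum>k. \<hbar>^k \<integral> f (k+1)))\<close>. Integrals from \<open>x0\<close> to \<open>x\<close> are taken along the line
  segment, and are used only on convex domains on which the integrands are holomorphic.\<close>

definition formal_wkb_series ::
    "complex \<Rightarrow> (nat \<Rightarrow> complex \<Rightarrow> complex) \<Rightarrow> complex \<Rightarrow> complex fps" where
  "formal_wkb_series x0 f x =
     fps_exponential (Abs_fps (\<lambda>k. - contour_integral (linepath x0 x) (f (Suc k))))"

definition asymptotic_to_formal_wkb ::
    "complex \<Rightarrow> (nat \<Rightarrow> complex \<Rightarrow> complex) \<Rightarrow> complex set \<Rightarrow> complex set \<Rightarrow>
     (complex \<Rightarrow> complex \<Rightarrow> complex) \<Rightarrow> bool" where
  "asymptotic_to_formal_wkb x0 f U S \<psi> \<longleftrightarrow>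
     (\<forall>x\<in>U. poincare_expansion (- pi / 2) (pi / 2) S
        (\<lambda>h. \<psi> x h * exp (1 / h * contour_integral (linepath x0 x) (f 0)))
        (formal_wkb_series x0 f x))"

end

theory Submission
  imports Defs
begin

text \<open>
  In the coordinate \<open>z = \<integral> sqrt q0 dx\<close> the level curve becomes a horizontal line. The vector field
  \<open>dx/dz = 1 / sqrt q0\<close> is \<open>O(\<bar>u\<bar>)\<close> in a coordinate \<open>u\<close> at a pole of order at least two, so a bounded
  displacement in \<open>z\<close> changes \<open>\<bar>u\<bar>\<close> only by a bounded factor. This has two consequences: the line is
  infinitely long in both directions, and it is surrounded by a strip \<open>\<bar>Im z\<bar> < \<epsilon>\<close> of constant width
  on which the inverse coordinate \<open>X\<close>, with \<open>X' = 1 / \<sigma>\<close> and \<open>\<sigma>\<^sup>2 = q0 (X z)\<close>, is holomorphic. On a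
  slightly smaller strip \<open>p = \<sigma>' / \<sigma>\<close> and all \<open>Q\<^sub>k = q\<^sub>k / q0\<close> are bounded, the latter because the
  poles of \<open>q\<^sub>k\<close> do not exceed those of \<open>q0\<close> (\<open>good_disc\<close>, \<open>wkb_charts_of_level_curve\<close>).

  Writing \<open>f = \<sigma> F\<close>, the Riccati equation reads \<open>h F' + h p F = F\<^sup>2 - (\<Sum>k. Q\<^sub>k h^k)\<close>. Subtracting the
  first two terms of the formal solution, \<open>F = 1 + h G\<^sub>1 + h y\<close>, leaves
  \<open>y' = (2 / h) y + y\<^sup>2 + A y + B\<close> with bounded holomorphic \<open>A\<close> and \<open>B\<close>. A solution that stays bounded
  as \<open>Re z\<close> tends to infinity is a fixed point of the map sending \<open>y\<close> to
  \<open>- \<integral> exp (- 2 u / h) (y\<^sup>2 + A y + B) (z + u) du\<close> over \<open>u \<ge> 0\<close>. The integral costs a factor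
  \<open>1 / (2 Re (1 / h))\<close>, so the map is a contraction as soon as \<open>Re (1 / h)\<close> exceeds a constant. That
  condition describes a disc tangent to the imaginary axis at \<open>0\<close>, which is a sectorial domain with
  opening \<open>(- pi / 2, pi / 2)\<close> (\<open>Riccati_bounded_solution\<close>, \<open>exact_WKB_on_half_strip\<close>).

  The difference between \<open>F\<close> and a partial sum of its formal solution satisfies a linear equation of the
  same kind whose inhomogeneity is a power of \<open>h\<close>, and the same integral bounds it. This gives the
  asymptotic expansion, uniformly on the half-strip (\<open>WKB_asymptotics_on_half_strip\<close>). It survives
  integration along a segment and exponentiation, hence passes to \<open>\<psi> = exp (- (\<integral> f) / h)\<close>
  (\<open>exact_WKB_from_chart\<close>).

  The half-strip to the right of the base point gives \<open>\<psi>\<^sub>p\<close>. Replacing \<open>z\<close> by \<open>- z\<close> and \<open>\<sigma>\<close> by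
  \<open>- \<sigma>\<close> turns the half-strip to the left into another one of this form and gives \<open>\<psi>\<^sub>m\<close>. In both cases
  \<open>Re F\<close> is positive, so the two logarithmic derivatives at the base point differ and the solutions
  form a basis.
\<close>

section \<open>Holomorphic dependence on parameters\<close>

text \<open>Cauchy's inequality asks for continuity up to the boundary; letting smaller radii tend to \<open>r\<close> removes
  this, which suits bounds that are known on open strips only.\<close>

lemma Cauchy_deriv_bound:
  assumes f: "f holomorphic_on ball z r" and r: "0 < r"
    and B: "\<And>w. w \<in> ball z r \<Longrightarrow> norm (f w) \<le> B"
  shows "norm (deriv f z) \<le> B / r"
proof -
  have "t * norm (deriv f z) \<le> B" if t: "0 < t" "t < r" for t
  proof -
    have "norm ((deriv ^^ 1) f z) \<le> fact 1 * B / t ^ 1"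
    proof (rule Cauchy_inequality)
      show "f holomorphic_on ball z t"
        using f t by (auto intro: holomorphic_on_subset)
      show "continuous_on (cball z t) f"
        by (rule holomorphic_on_imp_continuous_on, rule holomorphic_on_subset [OF f]) (use t in auto)
      show "norm (f x) \<le> B" if "norm (z - x) = t" for x
        using B that t by (auto simp: dist_norm)
    qed (use t in auto)
    then show ?thesis using t by (simp add: field_simps)
  qed
  then have "r * norm (deriv f z) \<le> B"
    using r by (intro tendsto_upperbound [where f = "\<lambda>t. t * norm (deriv f z)" and F = "at_left r"])
      (auto intro!: tendsto_intros eventually_at_leftI [of 0])
  then show ?thesis using r by (simp add: field_simps)
qed

text \<open>Cauchy's inequality on a disc of fixed radius turns uniform closeness of \<open>f\<close> at two parameters into
  uniform closeness of the derivatives. The lemma serves both differentiation under the integral sign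
  and joint differentiability in two complex variables.\<close>

lemma continuous_on_deriv_parameter:
  fixes f :: "complex \<Rightarrow> 'b::metric_space \<Rightarrow> complex"
  assumes U: "open U" and cont: "continuous_on (U \<times> T) (\<lambda>(x, t). f x t)"
    and hol: "\<And>t. t \<in> T \<Longrightarrow> (\<lambda>x. f x t) holomorphic_on U"
  shows "continuous_on (U \<times> T) (\<lambda>(x, t). deriv (\<lambda>x. f x t) x)"
proof (clarsimp simp: continuous_on_iff)
  fix x0 t0 and e :: real
  assume x0: "x0 \<in> U" and t0: "t0 \<in> T" and e: "0 < e"
  obtain r where r: "0 < r" "cball x0 (2 * r) \<subseteq> U"
  proof -
    obtain s where "0 < s" "cball x0 s \<subseteq> U" using U x0 open_contains_cball by blast
    then show ?thesis using that [of "s / 2"] by auto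
  qed
  have c: "continuous_on (T \<times> cball x0 (2 * r)) (\<lambda>p. f (snd p) (fst p))"
    using continuous_on_compose2 [OF cont, of "T \<times> cball x0 (2 * r)" "\<lambda>p. (snd p, fst p)"] r
    by (force intro!: continuous_intros)
  have e': "0 < e * r / 4" using e r by simp
  obtain X0 where X0: "t0 \<in> X0" "open X0"
    and X0d: "\<And>t x. t \<in> X0 \<inter> T \<Longrightarrow> x \<in> cball x0 (2 * r) \<Longrightarrow> dist (f x t) (f x t0) \<le> e * r / 4"
    using continuous_on_prod_compactE [OF c compact_cball t0 e'] by (metis fst_conv snd_conv)
  obtain d1 where d1: "0 < d1" "ball t0 d1 \<subseteq> X0" using X0 open_contains_ball by blast
  have "(\<lambda>x. f x t0) holomorphic_on U" using hol t0 by auto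
  then have "continuous_on U (deriv (\<lambda>x. f x t0))"
    using U by (intro holomorphic_on_imp_continuous_on holomorphic_deriv)
  then obtain d2 where d2: "0 < d2"
    and d2d: "\<And>x. x \<in> U \<Longrightarrow> dist x x0 < d2 \<Longrightarrow> dist (deriv (\<lambda>x. f x t0) x) (deriv (\<lambda>x. f x t0) x0) < e / 2"
    unfolding continuous_on_iff using x0 e by (metis half_gt_zero)
  show "\<exists>d>0. \<forall>x\<in>U. \<forall>t\<in>T. dist (x, t) (x0, t0) < d \<longrightarrow>
          dist (deriv (\<lambda>x. f x t) x) (deriv (\<lambda>x. f x t0) x0) < e"
  proof (intro exI [of _ "min r (min d1 d2)"] conjI ballI impI)
    fix x t assume x: "x \<in> U" and t: "t \<in> T" and d: "dist (x, t) (x0, t0) < min r (min d1 d2)"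
    have dx: "dist x x0 < min r (min d1 d2)" and dt: "dist t t0 < min r (min d1 d2)"
      using d dist_fst_le [of "(x, t)" "(x0, t0)"] dist_snd_le [of "(x, t)" "(x0, t0)"] by auto
    have sub: "ball x r \<subseteq> cball x0 (2 * r)"
    proof
      fix w assume "w \<in> ball x r"
      then show "w \<in> cball x0 (2 * r)"
        using dx dist_triangle [of x0 w x] by (auto simp: dist_commute)
    qed
    have hU: "(\<lambda>x. f x t) holomorphic_on ball x r" "(\<lambda>x. f x t0) holomorphic_on ball x r"
      using sub r hol t t0 by (meson holomorphic_on_subset subset_trans)+
    have "norm (deriv (\<lambda>x. f x t - f x t0) x) \<le> (e * r / 4) / r"
    proof (rule Cauchy_deriv_bound)
      show "(\<lambda>x. f x t - f x t0) holomorphic_on ball x r"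
        using hU by (intro holomorphic_intros)
      show "norm (f w t - f w t0) \<le> e * r / 4" if "w \<in> ball x r" for w
        using X0d [of t w] t dt d1 sub that by (auto simp: dist_norm subset_iff dist_commute norm_minus_commute)
    qed (use r in auto)
    moreover have "deriv (\<lambda>x. f x t - f x t0) x = deriv (\<lambda>x. f x t) x - deriv (\<lambda>x. f x t0) x"
      using hU r by (intro deriv_diff) (auto intro: holomorphic_on_imp_differentiable_at)
    ultimately have "dist (deriv (\<lambda>x. f x t) x) (deriv (\<lambda>x. f x t0) x) \<le> e / 4"
      using r by (simp add: dist_norm)
    moreover have "dist (deriv (\<lambda>x. f x t0) x) (deriv (\<lambda>x. f x t0) x0) < e / 2"
      using d2d x dx by auto
    ultimately show "dist (deriv (\<lambda>x. f x t) x) (deriv (\<lambda>x. f x t0) x0) < e"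
      using dist_triangle [of "deriv (\<lambda>x. f x t) x" "deriv (\<lambda>x. f x t0) x0" "deriv (\<lambda>x. f x t0) x"] e
      by linarith
  qed (use r(1) d1(1) d2 in auto)
qed

lemma holomorphic_on_parameter_integral:
  fixes f :: "complex \<Rightarrow> real \<Rightarrow> complex"
  assumes U: "open U" "convex U" and cont: "continuous_on (U \<times> {a..b}) (\<lambda>(x, t). f x t)"
    and hol: "\<And>t. t \<in> {a..b} \<Longrightarrow> (\<lambda>x. f x t) holomorphic_on U"
  shows "(\<lambda>x. integral {a..b} (f x)) holomorphic_on U"
proof -
  have "(\<lambda>x. integral (cbox a b) (f x)) holomorphic_on U"
  proof (rule leibniz_rule_holomorphic [where fx = "\<lambda>x t. deriv (\<lambda>x. f x t) x" and f = f and a = a and b = b and U = U])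
  show "((\<lambda>x. f x t) has_field_derivative deriv (\<lambda>x. f x t) x) (at x within U)"
    if "x \<in> U" "t \<in> cbox a b" for x t
    by (rule has_field_derivative_at_within, rule holomorphic_derivI [OF hol U(1)]) (use that in auto)
  show "f x integrable_on cbox a b" if "x \<in> U" for x
  proof -
    have "continuous_on {a..b} (\<lambda>t. (\<lambda>(x, t). f x t) (x, t))"
      by (rule continuous_on_compose2 [OF cont]) (use that in \<open>auto intro!: continuous_intros\<close>)
    then show ?thesis by (auto intro: integrable_continuous_real)
  qed
  show "continuous_on (U \<times> cbox a b) (\<lambda>(x, t). deriv (\<lambda>x. f x t) x)"
    using continuous_on_deriv_parameter [OF U(1) cont hol] by simp
  qed (fact U)
  then show ?thesis by simp
qed

text \<open>The elementary case of Hartogs' theorem: with a common bound, holomorphy in each variable separately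
  already implies joint continuity and joint holomorphy. Iterations and limits therefore need to
  propagate these three conditions only.\<close>

definition bounded_sep_hol ::
    "(complex \<Rightarrow> complex \<Rightarrow> complex) \<Rightarrow> complex set \<Rightarrow> complex set \<Rightarrow> real \<Rightarrow> bool" where
  "bounded_sep_hol f U V M \<longleftrightarrow>
     (\<forall>h\<in>V. (\<lambda>z. f z h) holomorphic_on U) \<and> (\<forall>z\<in>U. f z holomorphic_on V) \<and>
     (\<forall>z\<in>U. \<forall>h\<in>V. norm (f z h) \<le> M)"

text \<open>The bound makes \<open>f\<close> Lipschitz in the first variable near each point, uniformly in the second one.\<close>

lemma bounded_sep_hol_continuous:
  assumes f: "bounded_sep_hol f U V M" and U: "open U" and V: "open V"
  shows "continuous_on (U \<times> V) (\<lambda>(z, h). f z h)"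
proof (clarsimp simp: continuous_on_iff)
  fix z0 h0 and e :: real
  assume z0: "z0 \<in> U" and h0: "h0 \<in> V" and e: "0 < e"
  have M: "0 \<le> M" using f z0 h0 norm_ge_zero unfolding bounded_sep_hol_def by (meson order_trans)
  obtain r where r: "0 < r" "ball z0 (2 * r) \<subseteq> U"
  proof -
    obtain s where "0 < s" "ball z0 s \<subseteq> U" using U z0 open_contains_ball by blast
    then show ?thesis using that [of "s / 2"] by auto
  qed
  have Lip: "norm (f z h - f z0 h) \<le> (M / r) * norm (z - z0)" if z: "z \<in> ball z0 r" and h: "h \<in> V" for z h
  proof (rule field_differentiable_bound [where S = "ball z0 r" and f' = "deriv (\<lambda>z. f z h)" and f = "\<lambda>z. f z h"])
    have hol: "(\<lambda>z. f z h) holomorphic_on ball z0 (2 * r)"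
      using f h r unfolding bounded_sep_hol_def by (meson holomorphic_on_subset)
    fix w assume w: "w \<in> ball z0 r"
    have sub: "ball w r \<subseteq> ball z0 (2 * r)"
    proof
      fix v assume "v \<in> ball w r"
      then show "v \<in> ball z0 (2 * r)"
        using w dist_triangle [of z0 v w] by (auto simp: dist_commute)
    qed
    have w2: "w \<in> ball z0 (2 * r)" by (rule subsetD [OF sub]) (use r in auto)
    show "((\<lambda>z. f z h) has_field_derivative deriv (\<lambda>z. f z h) w) (at w within ball z0 r)"
      by (rule has_field_derivative_at_within, rule holomorphic_derivI [OF hol]) (use w2 in auto)
    show "norm (deriv (\<lambda>z. f z h) w) \<le> M / r"
    proof (rule Cauchy_deriv_bound)
      show "(\<lambda>z. f z h) holomorphic_on ball w r" using hol sub by (rule holomorphic_on_subset)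
      show "norm (f v h) \<le> M" if "v \<in> ball w r" for v
        using f h that sub r unfolding bounded_sep_hol_def by blast
    qed (fact r)
  qed (use z r in auto)
  have "continuous_on V (f z0)"
    using f z0 unfolding bounded_sep_hol_def by (intro holomorphic_on_imp_continuous_on) auto
  then obtain d where d: "0 < d" and dd: "\<And>h. h \<in> V \<Longrightarrow> dist h h0 < d \<Longrightarrow> dist (f z0 h) (f z0 h0) < e / 2"
    unfolding continuous_on_iff using h0 e by (metis half_gt_zero)
  define c where "c = e * r / (2 * (M + 1))"
  have c: "0 < c" using e r M by (auto simp: c_def)
  show "\<exists>d>0. \<forall>z\<in>U. \<forall>h\<in>V. dist (z, h) (z0, h0) < d \<longrightarrow> dist (f z h) (f z0 h0) < e"
  proof (intro exI [of _ "min r (min d c)"] conjI ballI impI)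
    fix z h assume z: "z \<in> U" and h: "h \<in> V" and di: "dist (z, h) (z0, h0) < min r (min d c)"
    have dx: "dist z z0 < min r (min d c)" and dt: "dist h h0 < min r (min d c)"
      using di dist_fst_le [of "(z, h)" "(z0, h0)"] dist_snd_le [of "(z, h)" "(z0, h0)"] by auto
    have "norm (f z h - f z0 h) \<le> (M / r) * norm (z - z0)"
      using Lip dx h by (auto simp: dist_commute)
    also have "\<dots> \<le> (M / r) * c"
      using dx M r by (intro mult_left_mono) (auto simp: dist_norm)
    also have "\<dots> = e / 2 * (M / (M + 1))" using r by (simp add: c_def)
    also have "\<dots> \<le> e / 2 * 1" using e M by (intro mult_left_mono) auto
    finally have "dist (f z h) (f z0 h) \<le> e / 2" by (simp add: dist_norm)
    then show "dist (f z h) (f z0 h0) < e"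
      using dd [of h] h dt dist_triangle [of "f z h" "f z0 h0" "f z0 h"] by force
  qed (use r(1) d c in auto)
qed

text \<open>A function with two partial derivatives is Frechet differentiable at a point where one of them is
  jointly continuous.\<close>

lemma holomorphic2_onI:
  assumes U: "open U" and V: "open V"
    and cont: "continuous_on (U \<times> V) (\<lambda>(z, h). f z h)"
    and hz: "\<And>h. h \<in> V \<Longrightarrow> (\<lambda>z. f z h) holomorphic_on U"
    and hh: "\<And>z. z \<in> U \<Longrightarrow> f z holomorphic_on V"
  shows "holomorphic2_on f (U \<times> V)"
  unfolding holomorphic2_on_def
proof clarify
  fix z h assume z: "z \<in> U" and h: "h \<in> V"
  obtain r where r: "0 < r" "ball h r \<subseteq> V" using V h open_contains_ball by blast
  obtain s where s: "0 < s" "ball z s \<subseteq> U" using U z open_contains_ball by blast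
  have "continuous_on (V \<times> U) (\<lambda>p. (\<lambda>(z, h). f z h) (snd p, fst p))"
    by (rule continuous_on_compose2 [OF cont]) (auto intro!: continuous_intros)
  then have "continuous_on (V \<times> U) (\<lambda>(h, z). deriv (f z) h)"
    using continuous_on_deriv_parameter [OF V, of U "\<lambda>h z. f z h"] hh by (simp add: case_prod_unfold)
  then have cd: "continuous_on (ball z s \<times> ball h r) (\<lambda>p. (\<lambda>(h, z). deriv (f z) h) (snd p, fst p))"
    by (rule continuous_on_compose2) (use r s in \<open>auto intro!: continuous_intros\<close>)
  then have cd': "continuous_on (ball z s \<times> ball h r) (\<lambda>p. blinfun_mult_right (deriv (f (fst p)) (snd p)))"
    by (intro bounded_linear.continuous_on [OF bounded_linear_blinfun_mult_right]) simp
  have "((\<lambda>(z, h). f z h) has_derivative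
      (\<lambda>(u, v). deriv (\<lambda>z. f z h) z * u + blinfun_apply (blinfun_mult_right (deriv (f z) h)) v))
      (at (z, h) within ball z s \<times> ball h r)"
  proof (rule has_derivative_partialsI [where fy = "\<lambda>z h. blinfun_mult_right (deriv (f z) h)"])
    show "((\<lambda>z. f z h) has_derivative (\<lambda>u. deriv (\<lambda>z. f z h) z * u)) (at z within ball z s)"
      using holomorphic_derivI [OF hz [OF h] U z]
      by (simp add: has_field_derivative_def has_derivative_at_withinI)
    show "(f x has_derivative blinfun_apply (blinfun_mult_right (deriv (f x) y))) (at y within ball h r)"
      if "x \<in> ball z s" "y \<in> ball h r" for x y
    proof -
      have "f x holomorphic_on V" "y \<in> V" using hh that r s by auto
      then have "(f x has_field_derivative deriv (f x) y) (at y)" using V by (metis holomorphic_derivI)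
      then show ?thesis
        by (simp add: has_field_derivative_def has_derivative_at_withinI blinfun_mult_right.rep_eq)
    qed
    show "continuous (at (z, h) within ball z s \<times> ball h r) (\<lambda>(x, y). blinfun_mult_right (deriv (f x) y))"
      using cd' r s by (simp add: continuous_on_eq_continuous_within case_prod_unfold)
  qed (use r in auto)
  moreover have "at (z, h) within ball z s \<times> ball h r = at (z, h)"
    by (rule at_within_open) (use r s in \<open>auto intro: open_Times\<close>)
  ultimately show "\<exists>a b. ((\<lambda>(z, h). f z h) has_derivative (\<lambda>(u, v). a * u + b * v)) (at (z, h))"
    by (intro exI [of _ "deriv (\<lambda>z. f z h) z"] exI [of _ "deriv (f z) h"])
      (simp add: blinfun_mult_right.rep_eq)
qed

section \<open>Linear equations on a half-strip\<close>

text \<open>Invariant under \<open>z \<mapsto> z + u\<close> for \<open>u \<ge> 0\<close>, the direction of integration, and a neighbourhood of \<open>0\<close>.\<close>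

definition half_strip :: "real \<Rightarrow> complex set" where
  "half_strip d = {z. - d < Re z \<and> \<bar>Im z\<bar> < d}"

lemma open_half_strip: "open (half_strip d)"
  unfolding half_strip_def by (intro open_Collect_conj open_Collect_less continuous_intros)

lemma convex_half_strip: "convex (half_strip d)"
proof -
  have "half_strip d = {z. Re z > - d} \<inter> {z. Im z < d} \<inter> {z. Im z > - d}"
    by (auto simp: half_strip_def)
  then show ?thesis
    by (metis convex_Int convex_halfspace_Im_gt convex_halfspace_Im_lt convex_halfspace_Re_gt)
qed

lemma half_strip_shift: "z \<in> half_strip d \<Longrightarrow> 0 \<le> u \<Longrightarrow> z + of_real u \<in> half_strip d"
  by (auto simp: half_strip_def)

lemma half_strip_mono: "d' \<le> d \<Longrightarrow> half_strip d' \<subseteq> half_strip d"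
  by (auto simp: half_strip_def)

lemma ball_subset_half_strip:
  assumes "z \<in> half_strip d'"
  shows "ball z (d - d') \<subseteq> half_strip d"
proof
  fix w assume "w \<in> ball z (d - d')"
  then have "norm (w - z) < d - d'" by (simp add: dist_norm norm_minus_commute)
  then have "\<bar>Re w - Re z\<bar> < d - d'" "\<bar>Im w - Im z\<bar> < d - d'"
    using abs_Re_le_cmod [of "w - z"] abs_Im_le_cmod [of "w - z"] by auto
  then show "w \<in> half_strip d" using assms by (auto simp: half_strip_def)
qed

lemma has_field_derivative_shift:
  "(f has_field_derivative D) (at (a + x)) \<Longrightarrow> ((\<lambda>t. f (a + t)) has_field_derivative D) (at x)"
  using DERIV_shift [of f D x a] by (simp only: add.commute [of a])

text \<open>The factor \<open>exp (- 2 u / h)\<close> integrates the homogeneous equation along the ray \<open>z + u\<close>. Boundedness of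
  \<open>w\<close> kills the contribution from infinity, so that \<open>w\<close> is the integral of the inhomogeneity and no
  initial value enters. Convergence of the iteration and the
  asymptotic expansion both rest on this estimate.\<close>

lemma bounded_linear_ode:
  fixes w \<phi> :: "complex \<Rightarrow> complex"
  assumes ode: "\<And>z. z \<in> half_strip d \<Longrightarrow> (w has_field_derivative (2 / h * w z + \<phi> z)) (at z)"
    and B: "\<And>z. z \<in> half_strip d \<Longrightarrow> norm (w z) \<le> B"
    and M: "\<And>z. z \<in> half_strip d \<Longrightarrow> norm (\<phi> z) \<le> M"
    and K: "0 < K" "K \<le> Re (1 / h)" and z: "z \<in> half_strip d"
  shows "norm (w z) \<le> M / (2 * K)"
proof -
  define v where "v = (\<lambda>u. exp (- (2 * of_real u / h)) * w (z + of_real u))"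
  have M0: "0 \<le> M" using M [OF z] norm_ge_zero order_trans by blast
  have h0: "h \<noteq> 0" using K by auto
  have nexp: "norm (exp (- (2 * of_real u / h))) \<le> exp (- (2 * K * u))" if "0 \<le> u" for u :: real
  proof -
    have "2 * u * K \<le> 2 * u * Re (1 / h)" using K that by (intro mult_left_mono) auto
    moreover have "Re (2 * of_real u / h) = 2 * u * Re (1 / h)"
      using Re_divide_of_real by (simp add: complex_div_cnj [of _ h] complex_div_cnj [of 1 h])
    ultimately show ?thesis by (simp add: mult_ac)
  qed
  have dv: "(v has_vector_derivative (exp (- (2 * of_real u / h)) * \<phi> (z + of_real u))) (at u)"
    if "0 \<le> u" for u
  proof -
    have "((\<lambda>\<zeta>. w (z + \<zeta>)) has_field_derivative
        (2 / h * w (z + of_real u) + \<phi> (z + of_real u))) (at (of_real u))"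
      by (rule has_field_derivative_shift [OF ode [OF half_strip_shift [OF z that]]])
    then have "((\<lambda>\<zeta>. exp (- (2 * \<zeta> / h)) * w (z + \<zeta>)) has_field_derivative
        (exp (- (2 * of_real u / h)) * \<phi> (z + of_real u))) (at (of_real u))"
      using h0 by (auto intro!: derivative_eq_intros simp: algebra_simps)
    then show ?thesis unfolding v_def by (rule has_vector_derivative_real_field)
  qed
  have bound: "norm (w z) \<le> M / (2 * K) + B * exp (- (2 * K * n))" if n: "0 < n" for n :: real
  proof -
    have "norm (v n - v 0) \<le> - M / (2 * K) * exp (- (2 * K * n)) - - M / (2 * K) * exp (- (2 * K * 0))"
    proof (rule differentiable_bound_general [OF n, where \<phi> = "\<lambda>u. - M / (2 * K) * exp (- (2 * K * u))"])
      show "continuous_on {0..n} v"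
        using dv by (intro continuous_at_imp_continuous_on) (auto intro!: has_vector_derivative_continuous)
      show "continuous_on {0..n} (\<lambda>u. - M / (2 * K) * exp (- (2 * K * u)))"
        by (intro continuous_intros)
      fix u assume u: "0 < u" "u < n"
      show "(v has_vector_derivative (exp (- (2 * of_real u / h)) * \<phi> (z + of_real u))) (at u)"
        using dv u by auto
      show "((\<lambda>u. - M / (2 * K) * exp (- (2 * K * u))) has_vector_derivative (M * exp (- (2 * K * u)))) (at u)"
        using K by (auto intro!: derivative_eq_intros simp flip: has_real_derivative_iff_has_vector_derivative)
      have "norm (exp (- (2 * of_real u / h))) * norm (\<phi> (z + of_real u)) \<le> exp (- (2 * K * u)) * M"
        using nexp [of u] M [OF half_strip_shift [OF z]] u by (intro mult_mono) auto
      then show "norm (exp (- (2 * of_real u / h)) * \<phi> (z + of_real u)) \<le> M * exp (- (2 * K * u))"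
        by (simp add: norm_mult mult_ac)
    qed
    then have "norm (v n - v 0) \<le> M / (2 * K) - M / (2 * K) * exp (- (2 * K * n))" by simp
    moreover have "0 \<le> M / (2 * K) * exp (- (2 * K * n))" using M0 K by simp
    ultimately have "norm (v 0) \<le> M / (2 * K) + norm (v n)"
      using norm_triangle_ineq2 [of "v 0" "v n"] by (simp add: norm_minus_commute)
    moreover have "norm (v n) \<le> exp (- (2 * K * n)) * B"
      unfolding v_def norm_mult using nexp [of n] B [OF half_strip_shift [OF z]] n by (intro mult_mono) auto
    ultimately show ?thesis by (simp add: v_def mult_ac)
  qed
  have "((\<lambda>n. M / (2 * K) + B * exp (- (2 * K * n))) \<longlongrightarrow> M / (2 * K) + B * 0) at_top"
    using K by (intro tendsto_intros filterlim_compose [OF exp_at_bot]) real_asymp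
  then show ?thesis
    using bound by (intro tendsto_lowerbound [of _ "M / (2 * K)" at_top])
      (auto intro: eventually_mono [OF eventually_gt_at_top [of 0]])
qed

text \<open>The integral over a finite range is manifestly holomorphic in \<open>h\<close>. With a primitive \<open>P\<close> of
  \<open>exp (- 2 z / h) \<phi>\<close> it equals \<open>- exp (2 z / h) (P (z + n) - P z)\<close>, which gives holomorphy in \<open>z\<close> and the
  differential equation up to an error that decays exponentially in \<open>n\<close>.\<close>

lemma truncated_Laplace:
  fixes \<phi> :: "complex \<Rightarrow> complex \<Rightarrow> complex" and n :: real
  assumes \<phi>: "bounded_sep_hol \<phi> (half_strip d) V M"
    and V: "open V" "convex V" and VK: "\<And>h. h \<in> V \<Longrightarrow> h \<noteq> 0 \<and> K \<le> Re (1 / h)" and K: "0 < K"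
    and n: "0 \<le> n"
  defines "T \<equiv> \<lambda>z h. - integral {0..n} (\<lambda>u. exp (- (2 * of_real u / h)) * \<phi> (z + of_real u) h)"
  shows "bounded_sep_hol T (half_strip d) V (M / (2 * K))"
    and "\<And>z h. z \<in> half_strip d \<Longrightarrow> h \<in> V \<Longrightarrow> ((\<lambda>z. T z h) has_field_derivative
      (2 / h * T z h + (\<phi> z h - exp (- (2 * of_real n / h)) * \<phi> (z + of_real n) h))) (at z)"
proof -
  have cont: "continuous_on (half_strip d \<times> V) (\<lambda>(z, h). \<phi> z h)"
    by (rule bounded_sep_hol_continuous [OF \<phi> open_half_strip V(1)])
  have nexp: "norm (exp (- (2 * of_real u / h))) \<le> exp (- (2 * K * u))" if "0 \<le> u" "h \<in> V" for u :: real and h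
  proof -
    have "2 * u * K \<le> 2 * u * Re (1 / h)" using VK that by (intro mult_left_mono) auto
    moreover have "Re (2 * of_real u / h) = 2 * u * Re (1 / h)"
      using Re_divide_of_real by (simp add: complex_div_cnj [of _ h] complex_div_cnj [of 1 h])
    ultimately show ?thesis by (simp add: mult_ac)
  qed
  have contu: "continuous_on {0..n} (\<lambda>u. exp (- (2 * of_real u / h)) * \<phi> (z + of_real u) h)"
    if z: "z \<in> half_strip d" and h: "h \<in> V" for z h
  proof -
    have "continuous_on {0..n} (\<lambda>u. (\<lambda>(z, h). \<phi> z h) (z + of_real u, h))"
      by (rule continuous_on_compose2 [OF cont]) (use z h half_strip_shift in \<open>auto intro!: continuous_intros\<close>)
    then show ?thesis using VK [OF h] by (auto intro!: continuous_intros)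
  qed
  show deriv: "((\<lambda>z. T z h) has_field_derivative
      (2 / h * T z h + (\<phi> z h - exp (- (2 * of_real n / h)) * \<phi> (z + of_real n) h))) (at z)"
    if z: "z \<in> half_strip d" and h: "h \<in> V" for z h
  proof -
    have h0: "h \<noteq> 0" using VK h by auto
    have "(\<lambda>z. \<phi> z h) holomorphic_on half_strip d" using \<phi> h by (auto simp: bounded_sep_hol_def)
    then have "(\<lambda>z. exp (- (2 * z / h)) * \<phi> z h) holomorphic_on half_strip d"
      using h0 by (intro holomorphic_intros) auto
    then obtain P where P: "\<And>z. z \<in> half_strip d \<Longrightarrow>
        (P has_field_derivative exp (- (2 * z / h)) * \<phi> z h) (at z within half_strip d)"
      by (rule holomorphic_convex_primitive' [OF convex_half_strip open_half_strip]) blast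
    then have P: "(P has_field_derivative exp (- (2 * z / h)) * \<phi> z h) (at z)" if "z \<in> half_strip d" for z
      using P [OF that] by (simp add: at_within_open [OF that open_half_strip])
    have e1: "exp (2 * z / h) * exp (- (2 * (z + of_real u) / h)) = exp (- (2 * of_real u / h))" for z u
      by (simp add: mult_exp_exp add_divide_distrib distrib_left)
    have eq: "T z h = - (exp (2 * z / h) * (P (z + of_real n) - P z))" if z: "z \<in> half_strip d" for z
    proof -
      have "((\<lambda>u. exp (- (2 * (z + of_real u) / h)) * \<phi> (z + of_real u) h) has_integral
          (P (z + of_real n) - P (z + of_real 0))) {0..n}"
      proof (rule fundamental_theorem_of_calculus [OF n])
        fix u assume u: "u \<in> {0..n}"
        have "((\<lambda>\<zeta>. P (z + \<zeta>)) has_field_derivative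
            exp (- (2 * (z + of_real u) / h)) * \<phi> (z + of_real u) h) (at (of_real u))"
          by (rule has_field_derivative_shift) (use P [OF half_strip_shift [OF z, of u]] u in auto)
        then show "((\<lambda>u. P (z + of_real u)) has_vector_derivative
            exp (- (2 * (z + of_real u) / h)) * \<phi> (z + of_real u) h) (at u within {0..n})"
          by (rule has_vector_derivative_at_within [OF has_vector_derivative_real_field])
      qed
      then have "((\<lambda>u. exp (2 * z / h) * (exp (- (2 * (z + of_real u) / h)) * \<phi> (z + of_real u) h)) has_integral
          exp (2 * z / h) * (P (z + of_real n) - P z)) {0..n}"
        by (intro has_integral_mult_right) simp
      also have "(\<lambda>u. exp (2 * z / h) * (exp (- (2 * (z + of_real u) / h)) * \<phi> (z + of_real u) h))
          = (\<lambda>u. exp (- (2 * of_real u / h)) * \<phi> (z + of_real u) h)"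
        by (simp only: mult.assoc [symmetric] e1)
      finally show ?thesis unfolding T_def by (simp add: integral_unique)
    qed
    have zn: "z + of_real n \<in> half_strip d" using half_strip_shift [OF z n] .
    have e2: "exp (2 * z / h) * exp (- (2 * z / h)) = 1"
      by (simp add: exp_add [symmetric])
    have "((\<lambda>z. - (exp (2 * z / h) * (P (z + of_real n) - P z))) has_field_derivative
        - (exp (2 * z / h) * (2 / h) * (P (z + of_real n) - P z)
          + exp (2 * z / h) * (exp (- (2 * (z + of_real n) / h)) * \<phi> (z + of_real n) h - exp (- (2 * z / h)) * \<phi> z h)))
        (at z)"
      using h0 P [OF z] P [OF zn, unfolded DERIV_shift] by (auto intro!: derivative_eq_intros)
    also have "- (exp (2 * z / h) * (2 / h) * (P (z + of_real n) - P z)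
          + exp (2 * z / h) * (exp (- (2 * (z + of_real n) / h)) * \<phi> (z + of_real n) h - exp (- (2 * z / h)) * \<phi> z h))
        = 2 / h * T z h + ((exp (2 * z / h) * exp (- (2 * z / h))) * \<phi> z h
          - (exp (2 * z / h) * exp (- (2 * (z + of_real n) / h))) * \<phi> (z + of_real n) h)"
      unfolding eq [OF z] by (simp add: algebra_simps diff_divide_distrib del: exp_minus_inverse)
    finally have "((\<lambda>z. - (exp (2 * z / h) * (P (z + of_real n) - P z))) has_field_derivative
        (2 / h * T z h + (\<phi> z h - exp (- (2 * of_real n / h)) * \<phi> (z + of_real n) h))) (at z)"
      by (simp only: e1 e2 mult_1_left)
    then show ?thesis
      by (rule has_field_derivative_transform_within_open [OF _ open_half_strip z]) (simp add: eq)
  qed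
  show "bounded_sep_hol T (half_strip d) V (M / (2 * K))"
    unfolding bounded_sep_hol_def
  proof (intro conjI ballI)
    fix h assume h: "h \<in> V"
    show "(\<lambda>z. T z h) holomorphic_on half_strip d"
      using deriv [OF _ h] by (auto simp: holomorphic_on_open [OF open_half_strip])
  next
    fix z assume z: "z \<in> half_strip d"
    have cz: "continuous_on (V \<times> {0..n}) (\<lambda>p. (\<lambda>(z, h). \<phi> z h) (z + of_real (snd p), fst p))"
      by (rule continuous_on_compose2 [OF cont]) (use z half_strip_shift in \<open>auto intro!: continuous_intros\<close>)
    have "(\<lambda>h. integral {0..n} ((\<lambda>h u. exp (- (2 * of_real u / h)) * \<phi> (z + of_real u) h) h)) holomorphic_on V"
    proof (rule holomorphic_on_parameter_integral [OF V])
      show "continuous_on (V \<times> {0..n}) (\<lambda>(h, u). exp (- (2 * of_real u / h)) * \<phi> (z + of_real u) h)"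
        unfolding case_prod_unfold using cz VK by (auto intro!: continuous_intros)
      show "(\<lambda>h. exp (- (2 * of_real u / h)) * \<phi> (z + of_real u) h) holomorphic_on V" if "u \<in> {0..n}" for u
      proof -
        have "\<phi> (z + of_real u) holomorphic_on V"
          using \<phi> half_strip_shift [OF z, of u] that by (auto simp: bounded_sep_hol_def)
        then show ?thesis using VK by (auto intro!: holomorphic_intros)
      qed
    qed
    then show "T z holomorphic_on V" unfolding T_def by (auto intro!: holomorphic_intros)
  next
    fix z h assume z: "z \<in> half_strip d" and h: "h \<in> V"
    have M0: "0 \<le> M" using \<phi> z h norm_ge_zero unfolding bounded_sep_hol_def by (meson order_trans)
    have hI: "((\<lambda>u. M * exp (- (2 * K * u))) has_integral
        (- M / (2 * K) * exp (- (2 * K * n)) - - M / (2 * K) * exp (- (2 * K * 0)))) {0..n}"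
      by (rule fundamental_theorem_of_calculus [OF n])
        (use K in \<open>auto intro!: derivative_eq_intros simp flip: has_real_derivative_iff_has_vector_derivative\<close>)
    note I = has_integral_integrable [OF hI]
    have Ie: "integral {0..n} (\<lambda>u. M * exp (- (2 * K * u))) = - M / (2 * K) * exp (- (2 * K * n)) + M / (2 * K)"
      by (rule trans [OF integral_unique [OF hI]]) simp
    have "norm (T z h) \<le> integral {0..n} (\<lambda>u. M * exp (- (2 * K * u)))"
      unfolding T_def norm_minus_cancel
    proof (rule integral_norm_bound_integral [OF _ I])
      show "(\<lambda>u. exp (- (2 * of_real u / h)) * \<phi> (z + of_real u) h) integrable_on {0..n}"
        by (rule integrable_continuous_real [OF contu [OF z h]])
      fix u assume u: "u \<in> {0..n}"
      have "norm (exp (- (2 * of_real u / h))) * norm (\<phi> (z + of_real u) h) \<le> exp (- (2 * K * u)) * M"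
      proof (rule mult_mono)
        show "norm (exp (- (2 * of_real u / h))) \<le> exp (- (2 * K * u))" using nexp u h by (meson atLeastAtMost_iff)
        have "z + of_real u \<in> half_strip d" using half_strip_shift [OF z, of u] u by simp
        then show "norm (\<phi> (z + of_real u) h) \<le> M" using \<phi> h unfolding bounded_sep_hol_def by blast
      qed auto
      then show "norm (exp (- (2 * of_real u / h)) * \<phi> (z + of_real u) h) \<le> M * exp (- (2 * K * u))"
        by (simp add: norm_mult mult_ac)
    qed
    also have "\<dots> \<le> M / (2 * K)"
      unfolding Ie using M0 K by simp
    finally show "norm (T z h) \<le> M / (2 * K)" .
  qed
qed

section \<open>A Riccati equation with a large parameter\<close>

lemma bounded_sep_hol_mono: "bounded_sep_hol f U V M \<Longrightarrow> M \<le> M' \<Longrightarrow> bounded_sep_hol f U V M'"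
  unfolding bounded_sep_hol_def by (meson order_trans)

lemma bounded_sep_hol_add:
  assumes "bounded_sep_hol f U V M" "bounded_sep_hol g U V N"
  shows "bounded_sep_hol (\<lambda>z h. f z h + g z h) U V (M + N)"
  using assms unfolding bounded_sep_hol_def
  by (auto intro!: holomorphic_intros norm_triangle_le add_mono)

lemma bounded_sep_hol_mult:
  assumes "bounded_sep_hol f U V M" "bounded_sep_hol g U V N" "0 \<le> M"
  shows "bounded_sep_hol (\<lambda>z h. f z h * g z h) U V (M * N)"
  using assms unfolding bounded_sep_hol_def
  by (auto intro!: holomorphic_intros mult_mono simp: norm_mult)

lemma bounded_sep_hol_uniform_limit:
  assumes U: "open U" and V: "open V" and f: "\<And>n. bounded_sep_hol (f n) U V M"
    and lim: "uniform_limit (U \<times> V) (\<lambda>n (z, h). f n z h) (\<lambda>(z, h). g z h) sequentially"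
  shows "bounded_sep_hol g U V M"
  unfolding bounded_sep_hol_def
proof (intro conjI ballI)
  fix h assume h: "h \<in> V"
  show "(\<lambda>z. g z h) holomorphic_on U"
  proof (rule holomorphic_uniform_sequence [OF U, of "\<lambda>n z. f n z h"])
    show "(\<lambda>z. f n z h) holomorphic_on U" for n using f h by (auto simp: bounded_sep_hol_def)
    fix z assume "z \<in> U"
    then obtain d where d: "0 < d" "cball z d \<subseteq> U" using U open_contains_cball by blast
    moreover have "uniform_limit (cball z d) (\<lambda>n z. f n z h) (\<lambda>z. g z h) sequentially"
      using lim h d unfolding uniform_limit_iff by (fastforce elim!: eventually_mono)
    ultimately show "\<exists>d>0. cball z d \<subseteq> U \<and>
        uniform_limit (cball z d) (\<lambda>n z. f n z h) (\<lambda>z. g z h) sequentially" by blast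
  qed
next
  fix z assume z: "z \<in> U"
  show "g z holomorphic_on V"
  proof (rule holomorphic_uniform_sequence [OF V, of "\<lambda>n. f n z"])
    show "f n z holomorphic_on V" for n using f z by (auto simp: bounded_sep_hol_def)
    fix h assume "h \<in> V"
    then obtain d where d: "0 < d" "cball h d \<subseteq> V" using V open_contains_cball by blast
    moreover have "uniform_limit (cball h d) (\<lambda>n. f n z) (g z) sequentially"
      using lim z d unfolding uniform_limit_iff by (fastforce elim!: eventually_mono)
    ultimately show "\<exists>d>0. cball h d \<subseteq> V \<and> uniform_limit (cball h d) (\<lambda>n. f n z) (g z) sequentially" by blast
  qed
next
  fix z h assume zh: "z \<in> U" "h \<in> V"
  have "((\<lambda>n. (\<lambda>(z, h). f n z h) (z, h)) \<longlongrightarrow> (\<lambda>(z, h). g z h) (z, h)) sequentially"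
    by (rule tendsto_uniform_limitI [OF lim]) (use zh in auto)
  then have "(\<lambda>n. f n z h) \<longlonglongrightarrow> g z h" by simp
  then show "norm (g z h) \<le> M"
    using f zh by (intro Lim_norm_ubound [of sequentially]) (auto simp: bounded_sep_hol_def)
qed

text \<open>Picard iteration for the bounded solution, in which the \<open>n\<close>-th step integrates over \<open>[0, n]\<close> only, so
  that a single limit has to be taken. Consecutive iterates differ by a bounded solution of a linear
  equation, to which \<open>bounded_linear_ode\<close> applies; the truncation adds an exponentially small term, and
  the differences decay like \<open>(3 / 4) ^ n\<close>.\<close>

theorem Riccati_bounded_solution:
  fixes A B :: "complex \<Rightarrow> complex \<Rightarrow> complex"
  assumes A: "bounded_sep_hol A (half_strip d) V C" and B: "bounded_sep_hol B (half_strip d) V C"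
    and C: "0 \<le> C"
    and V: "open V" "convex V" and VK: "\<And>h. h \<in> V \<Longrightarrow> h \<noteq> 0 \<and> K \<le> Re (1 / h)" and K: "2 + 2 * C \<le> K"
  shows "\<exists>y. bounded_sep_hol y (half_strip d) V 1 \<and>
    (\<forall>z\<in>half_strip d. \<forall>h\<in>V. ((\<lambda>z. y z h) has_field_derivative
       (2 / h * y z h + ((y z h)\<^sup>2 + A z h * y z h + B z h))) (at z))"
proof -
  define H where "H = half_strip d"
  define N where "N = (\<lambda>y :: complex \<Rightarrow> complex \<Rightarrow> complex. \<lambda>z h. y z h * y z h + A z h * y z h + B z h)"
  define T where "T = (\<lambda>n :: real. \<lambda>\<phi> :: complex \<Rightarrow> complex \<Rightarrow> complex. \<lambda>z h.
     - integral {0..n} (\<lambda>u. exp (- (2 * of_real u / h)) * \<phi> (z + of_real u) h))"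
  define Y where "Y = rec_nat (\<lambda>z h. 0) (\<lambda>n y. T (real n) (N y))"
  \<comment> \<open>Large enough for the truncation errors \<open>2 (1 + 2 C) (3 / 4) ^ n\<close> to be absorbed in the induction below.\<close>
  define D where "D = 4 * (1 + 2 * C)"
  have K0: "0 < K" using C K by linarith
  have oH: "open H" unfolding H_def by (rule open_half_strip)
  have Y0: "Y 0 = (\<lambda>z h. 0)" and YS: "Y (Suc n) = T (real n) (N (Y n))" for n
    unfolding Y_def by simp_all
  have N1: "bounded_sep_hol (N y) H V (1 + 2 * C)" if y: "bounded_sep_hol y H V 1" for y
  proof -
    have "bounded_sep_hol (N y) H V (1 * 1 + C * 1 + C)"
      unfolding N_def using y A B C
      by (intro bounded_sep_hol_add bounded_sep_hol_mult) (auto simp: H_def)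
    then show ?thesis by (simp add: algebra_simps)
  qed
  have Tb: "bounded_sep_hol (T (real n) (N y)) H V 1" if y: "bounded_sep_hol y H V 1" for y n
  proof -
    have "bounded_sep_hol (T (real n) (N y)) H V ((1 + 2 * C) / (2 * K))"
      unfolding T_def H_def
      by (rule truncated_Laplace(1) [OF N1 [OF y, unfolded H_def] V VK K0]) auto
    then show ?thesis by (rule bounded_sep_hol_mono) (use C K K0 in \<open>simp add: field_simps\<close>)
  qed
  have Yb: "bounded_sep_hol (Y n) H V 1" for n
  proof (induction n)
    case 0
    then show ?case by (auto simp: Y0 bounded_sep_hol_def)
  next
    case (Suc n)
    then show ?case unfolding YS by (rule Tb)
  qed
  have Yle: "norm (Y n z h) \<le> 1" if "z \<in> H" "h \<in> V" for n z h
    using Yb that by (auto simp: bounded_sep_hol_def)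
  have Nle: "norm (N (Y n) z h) \<le> 1 + 2 * C" if "z \<in> H" "h \<in> V" for n z h
    using N1 [OF Yb] that by (auto simp: bounded_sep_hol_def)
  have Yd: "((\<lambda>z. Y (Suc n) z h) has_field_derivative (2 / h * Y (Suc n) z h +
      (N (Y n) z h - exp (- (2 * of_real (real n) / h)) * N (Y n) (z + of_real (real n)) h))) (at z)"
    if "z \<in> H" "h \<in> V" for n z h
    unfolding YS T_def
    by (rule truncated_Laplace(2) [OF N1 [OF Yb, unfolded H_def] V VK K0]) (use that in \<open>auto simp: H_def\<close>)
  have ex: "norm (exp (- (2 * of_real (real n) / h))) \<le> (3 / 4) ^ n" if "h \<in> V" for n h
  proof -
    have "Re (2 * of_real (real n) / h) = 2 * real n * Re (1 / h)"
      by (simp add: complex_div_cnj [of _ h] complex_div_cnj [of 1 h])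
    moreover have "real n * 1 \<le> real n * (2 * Re (1 / h))"
      using VK [OF that] K C by (intro mult_left_mono) auto
    ultimately have "norm (exp (- (2 * of_real (real n) / h))) \<le> exp (- real n)"
      by (simp add: mult_ac)
    also have "\<dots> = exp (- 1) ^ n" by (simp flip: exp_of_nat_mult)
    also have "\<dots> \<le> (3 / 4) ^ n"
    proof (rule power_mono)
      have "(2 :: real) \<le> exp 1" using exp_ge_add_one_self [of 1] by simp
      then show "exp (- 1) \<le> (3 / 4 :: real)" by (simp add: exp_minus field_simps)
    qed simp
    finally show ?thesis .
  qed
  have diff: "norm (Y (Suc n) z h - Y n z h) \<le> D * (3 / 4) ^ n" if "z \<in> H" "h \<in> V" for n z h
    using that
  proof (induction n arbitrary: z h)
    case 0
    then show ?case using C by (simp add: YS Y0 T_def D_def)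
  next
    case (Suc n)
    define E where "E = (\<lambda>z. exp (- (2 * of_real (real n) / h)) * N (Y n) (z + of_real (real n)) h
       - exp (- (2 * of_real (real (Suc n)) / h)) * N (Y (Suc n)) (z + of_real (real (Suc n))) h)"
    define \<phi> where "\<phi> = (\<lambda>z. N (Y (Suc n)) z h - N (Y n) z h + E z)"
    have "norm (Y (Suc (Suc n)) z h - Y (Suc n) z h)
        \<le> ((2 + C) * (D * (3 / 4) ^ n) + 2 * ((3 / 4) ^ n * (1 + 2 * C))) / (2 * K)"
    proof (rule bounded_linear_ode [where w = "\<lambda>z. Y (Suc (Suc n)) z h - Y (Suc n) z h" and \<phi> = \<phi> and B = 2])
      show "((\<lambda>z. Y (Suc (Suc n)) z h - Y (Suc n) z h) has_field_derivative
          2 / h * (Y (Suc (Suc n)) z h - Y (Suc n) z h) + \<phi> z) (at z)" if "z \<in> half_strip d" for z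
        using Yd [of z h n] Yd [of z h "Suc n"] that Suc.prems
        by (auto simp: H_def \<phi>_def E_def algebra_simps intro!: derivative_eq_intros)
      show "norm (Y (Suc (Suc n)) z h - Y (Suc n) z h) \<le> 2" if "z \<in> half_strip d" for z
        using Yle [of z h "Suc n"] Yle [of z h "Suc (Suc n)"] that Suc.prems
        by (intro norm_triangle_le_diff) (auto simp: H_def)
      show "norm (\<phi> z) \<le> (2 + C) * (D * (3 / 4) ^ n) + 2 * ((3 / 4) ^ n * (1 + 2 * C))"
        if z: "z \<in> half_strip d" for z
      proof -
        have zH: "z \<in> H" and hV: "h \<in> V" using z Suc.prems by (auto simp: H_def)
        have "N (Y (Suc n)) z h - N (Y n) z h = (Y (Suc n) z h + Y n z h + A z h) * (Y (Suc n) z h - Y n z h)"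
          by (simp add: N_def algebra_simps)
        moreover have "norm (Y (Suc n) z h + Y n z h + A z h) \<le> 2 + C"
          using Yle [OF zH hV, of n] Yle [OF zH hV, of "Suc n"] A zH hV
          by (intro norm_triangle_le) (auto simp: bounded_sep_hol_def H_def intro!: norm_triangle_le add_mono [of _ 2 _ C, simplified])
        ultimately have 1: "norm (N (Y (Suc n)) z h - N (Y n) z h) \<le> (2 + C) * (D * (3 / 4) ^ n)"
          using Suc.IH [OF zH hV] C by (simp only: norm_mult) (intro mult_mono, auto)
        have sh: "z + of_real (real k) \<in> H" for k using half_strip_shift [OF z, of "real k"] by (simp add: H_def)
        have e: "norm (exp (- (2 * of_real (real k) / h)) * N (Y k) (z + of_real (real k)) h) \<le> (3 / 4) ^ k * (1 + 2 * C)" for k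
          unfolding norm_mult using ex [OF hV] Nle [OF sh hV] by (intro mult_mono) auto
        have "(3 / 4) ^ Suc n * (1 + 2 * C) \<le> (3 / 4) ^ n * (1 + 2 * C)"
          using C by (intro mult_right_mono) auto
        then have "norm (E z) \<le> 2 * ((3 / 4) ^ n * (1 + 2 * C))"
          unfolding E_def using e [of n] e [of "Suc n"] by (intro norm_triangle_le_diff) linarith
        then show ?thesis unfolding \<phi>_def using 1 by (intro norm_triangle_le) linarith
      qed
    qed (use Suc.prems VK K0 in \<open>auto simp: H_def\<close>)
    also have "\<dots> \<le> D * (3 / 4) ^ Suc n"
    proof -
      have "((2 + C) * D + 2 * (1 + 2 * C)) \<le> D * (3 / 4) * (2 * (2 + 2 * C))"
        using C by (simp add: D_def algebra_simps)
      also have "\<dots> \<le> D * (3 / 4) * (2 * K)" using K C by (intro mult_left_mono) (auto simp: D_def)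
      finally have le: "(2 + C) * D + 2 * (1 + 2 * C) \<le> D * (3 / 4) * (2 * K)" .
      define q :: real where "q = (3 / 4) ^ n"
      have "((2 + C) * D + 2 * (1 + 2 * C)) * q \<le> D * (3 / 4) * (2 * K) * q"
        by (rule mult_right_mono [OF le]) (simp add: q_def)
      then have "((2 + C) * (D * q) + 2 * (q * (1 + 2 * C))) / (2 * K) \<le> D * (3 / 4 * q)"
        using K0 by (simp add: pos_divide_le_eq algebra_simps)
      then show ?thesis by (simp add: q_def)
    qed
    finally show ?case .
  qed
  define y where "y = (\<lambda>z h. \<Sum>i. Y (Suc i) z h - Y i z h)"
  have "uniform_limit (H \<times> V) (\<lambda>n p. \<Sum>i<n. (\<lambda>i (z, h). Y (Suc i) z h - Y i z h) i p)
      (\<lambda>p. \<Sum>i. (\<lambda>i (z, h). Y (Suc i) z h - Y i z h) i p) sequentially"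
  proof (rule Weierstrass_m_test [where M = "\<lambda>n. D * (3 / 4) ^ n"])
    show "summable (\<lambda>n. D * (3 / 4) ^ n)" by (intro summable_mult summable_geometric) simp
  qed (use diff in auto)
  moreover have "(\<Sum>i<n. (\<lambda>i (z, h). Y (Suc i) z h - Y i z h) i (z, h)) = Y n z h" for n z h
    using sum_lessThan_telescope [of "\<lambda>i. Y i z h" n] by (simp add: Y0)
  ultimately have lim: "uniform_limit (H \<times> V) (\<lambda>n (z, h). Y n z h) (\<lambda>(z, h). y z h) sequentially"
    by (simp add: y_def case_prod_unfold)
  have yb: "bounded_sep_hol y H V 1"
    by (rule bounded_sep_hol_uniform_limit [OF oH V(1) Yb lim])
  have lim1: "(\<lambda>n. Y n z h) \<longlonglongrightarrow> y z h" if "z \<in> H" "h \<in> V" for z h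
    using tendsto_uniform_limitI [OF lim, of "(z, h)"] that by simp
  have "((\<lambda>z. y z h) has_field_derivative (2 / h * y z h + ((y z h)\<^sup>2 + A z h * y z h + B z h))) (at z)"
    if z: "z \<in> H" and h: "h \<in> V" for z h
  proof -
    obtain r where r: "0 < r" "cball z r \<subseteq> H" using oH z open_contains_cball by blast
    have "uniform_limit (cball z r) (\<lambda>n z. Y n z h) (\<lambda>z. y z h) sequentially"
      using lim h r unfolding uniform_limit_iff by (fastforce elim!: eventually_mono)
    then have ul: "uniform_limit (cball z r) (\<lambda>n z. Y (Suc n) z h) (\<lambda>z. y z h) sequentially"
      by (rule filterlim_compose [OF _ filterlim_Suc])
    define f' where "f' = (\<lambda>n z. 2 / h * Y (Suc n) z h +
      (N (Y n) z h - exp (- (2 * of_real (real n) / h)) * N (Y n) (z + of_real (real n)) h))"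
    have d: "((\<lambda>z. Y (Suc n) z h) has_field_derivative f' n w) (at w)" if "w \<in> cball z r" for n w
      unfolding f'_def using Yd [of w h n] h r that by auto
    obtain g' where g': "\<And>w. w \<in> ball z r \<Longrightarrow>
        ((\<lambda>z. y z h) has_field_derivative g' w) (at w) \<and> (\<lambda>n. f' n w) \<longlonglongrightarrow> g' w"
    proof (rule has_complex_derivative_uniform_limit [OF _ ul _ r(1), of f'])
      show "\<forall>\<^sub>F n in sequentially. continuous_on (cball z r) (\<lambda>z. Y (Suc n) z h) \<and>
          (\<forall>w\<in>ball z r. ((\<lambda>z. Y (Suc n) z h) has_field_derivative f' n w) (at w))"
        using d by (intro always_eventually allI conjI ballI continuous_at_imp_continuous_on)
          (auto intro: DERIV_isCont)
    qed auto
    have zr: "z \<in> ball z r" using r by simp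
    have E0: "(\<lambda>n. exp (- (2 * of_real (real n) / h)) * N (Y n) (z + of_real (real n)) h) \<longlonglongrightarrow> 0"
    proof (rule Lim_null_comparison)
      show "\<forall>\<^sub>F n in sequentially. norm (exp (- (2 * of_real (real n) / h)) * N (Y n) (z + of_real (real n)) h)
          \<le> (3 / 4) ^ n * (1 + 2 * C)"
      proof (intro always_eventually allI)
        fix n
        have "z + of_real (real n) \<in> H" using half_strip_shift [of z d "real n"] z by (simp add: H_def)
        then show "norm (exp (- (2 * of_real (real n) / h)) * N (Y n) (z + of_real (real n)) h)
          \<le> (3 / 4) ^ n * (1 + 2 * C)"
          unfolding norm_mult using ex [OF h] Nle h by (intro mult_mono) auto
      qed
      show "(\<lambda>n. (3 / 4) ^ n * (1 + 2 * C)) \<longlonglongrightarrow> 0"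
        by (intro tendsto_mult_left_zero LIMSEQ_power_zero) simp
    qed
    have "(\<lambda>n. f' n z) \<longlonglongrightarrow> 2 / h * y z h + ((y z h * y z h + A z h * y z h + B z h) - 0)"
    proof -
      have "(\<lambda>n. N (Y n) z h) \<longlonglongrightarrow> y z h * y z h + A z h * y z h + B z h"
        unfolding N_def by (intro tendsto_intros lim1 [OF z h])
      then show ?thesis
        unfolding f'_def by (intro tendsto_intros LIMSEQ_Suc [OF lim1 [OF z h]] E0)
    qed
    then have "g' z = 2 / h * y z h + ((y z h * y z h + A z h * y z h + B z h) - 0)"
      using g' [OF zr] LIMSEQ_unique by blast
    then show ?thesis using g' [OF zr] by (simp add: power2_eq_square)
  qed
  then show ?thesis using yb unfolding H_def by blast
qed

section \<open>The WKB problem on a half-strip\<close>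

text \<open>Bounds are required on all smaller half-strips rather than on the half-strip itself: Cauchy's
  estimate for a derivative costs an arbitrarily small part of the width, and the formal solution
  involves derivatives of arbitrarily high order.\<close>

definition tame :: "real \<Rightarrow> (complex \<Rightarrow> complex) \<Rightarrow> bool" where
  "tame d f \<longleftrightarrow> (\<forall>d'<d. f holomorphic_on half_strip d' \<and> (\<exists>M. \<forall>z\<in>half_strip d'. norm (f z) \<le> M))"

lemma tameD:
  assumes "tame d f" "d' < d"
  shows "f holomorphic_on half_strip d'"
    and "\<exists>M\<ge>0. \<forall>z\<in>half_strip d'. norm (f z) \<le> M"
proof -
  show "f holomorphic_on half_strip d'" using assms by (auto simp: tame_def)
  obtain M where "\<forall>z\<in>half_strip d'. norm (f z) \<le> M" using assms by (auto simp: tame_def)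
  then have "\<forall>z\<in>half_strip d'. norm (f z) \<le> max M 0" by (auto simp: le_max_iff_disj)
  then show "\<exists>M\<ge>0. \<forall>z\<in>half_strip d'. norm (f z) \<le> M" by (intro exI [of _ "max M 0"]) auto
qed

lemma tame_const [intro]: "tame d (\<lambda>z. c)"
  unfolding tame_def by (auto intro!: exI [of _ "norm c"])

lemma tame_add [intro]:
  assumes "tame d f" "tame d g"
  shows "tame d (\<lambda>z. f z + g z)"
  unfolding tame_def
proof (intro allI impI conjI)
  fix d' assume d': "d' < d"
  show "(\<lambda>z. f z + g z) holomorphic_on half_strip d'"
    by (intro holomorphic_intros tameD(1) [OF assms(1) d'] tameD(1) [OF assms(2) d'])
  obtain M N where "\<forall>z\<in>half_strip d'. norm (f z) \<le> M" "\<forall>z\<in>half_strip d'. norm (g z) \<le> N"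
    using tameD(2) [OF assms(1) d'] tameD(2) [OF assms(2) d'] by blast
  then show "\<exists>M. \<forall>z\<in>half_strip d'. norm (f z + g z) \<le> M"
    by (intro exI [of _ "M + N"]) (auto intro: norm_triangle_le add_mono)
qed

lemma tame_mult [intro]:
  assumes "tame d f" "tame d g"
  shows "tame d (\<lambda>z. f z * g z)"
  unfolding tame_def
proof (intro allI impI conjI)
  fix d' assume d': "d' < d"
  show "(\<lambda>z. f z * g z) holomorphic_on half_strip d'"
    by (intro holomorphic_intros tameD(1) [OF assms(1) d'] tameD(1) [OF assms(2) d'])
  obtain M N where "\<forall>z\<in>half_strip d'. norm (f z) \<le> M" "\<forall>z\<in>half_strip d'. norm (g z) \<le> N" "0 \<le> M"
    using tameD(2) [OF assms(1) d'] tameD(2) [OF assms(2) d'] by blast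
  then show "\<exists>M. \<forall>z\<in>half_strip d'. norm (f z * g z) \<le> M"
    by (intro exI [of _ "M * N"]) (auto simp: norm_mult intro: mult_mono)
qed

lemma tame_diff [intro]: "tame d f \<Longrightarrow> tame d g \<Longrightarrow> tame d (\<lambda>z. f z - g z)"
  using tame_add [of d f "\<lambda>z. - 1 * g z"] tame_mult [of d "\<lambda>z. - 1" g] by auto

lemma tame_sum [intro]: "(\<And>i. i \<in> I \<Longrightarrow> tame d (f i)) \<Longrightarrow> tame d (\<lambda>z. \<Sum>i\<in>I. f i z)"
  by (induction I rule: infinite_finite_induct) auto

lemma tame_deriv [intro]:
  assumes "tame d f"
  shows "tame d (deriv f)"
  unfolding tame_def
proof (intro allI impI conjI)
  fix d' assume d': "d' < d"
  show "deriv f holomorphic_on half_strip d'"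
    by (rule holomorphic_deriv [OF tameD(1) [OF assms d'] open_half_strip])
  define e where "e = (d + d') / 2"
  have e: "e < d" "d' < e" using d' by (auto simp: e_def)
  obtain M where M: "\<forall>z\<in>half_strip e. norm (f z) \<le> M" using tameD(2) [OF assms e(1)] by blast
  have "norm (deriv f z) \<le> M / (e - d')" if z: "z \<in> half_strip d'" for z
  proof (rule Cauchy_deriv_bound)
    show "f holomorphic_on ball z (e - d')"
      by (rule holomorphic_on_subset [OF tameD(1) [OF assms e(1)] ball_subset_half_strip [OF z]])
    show "norm (f w) \<le> M" if "w \<in> ball z (e - d')" for w
      using M ball_subset_half_strip [OF z, of e] that by blast
  qed (use e in auto)
  then show "\<exists>M. \<forall>z\<in>half_strip d'. norm (deriv f z) \<le> M" by blast
qed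

text \<open>The formal solution of \<open>h F' + h p F = F\<^sup>2 - (\<Sum>k. Q\<^sub>k h^k)\<close> with \<open>F\<^sub>0 = 1\<close>, where \<open>Q\<^sub>0 = 1\<close>: the
  coefficient of \<open>h ^ Suc n\<close> determines \<open>2 F\<^sub>n\<^sub>+\<^sub>1\<close>.\<close>

fun wkb_coeff :: "(complex \<Rightarrow> complex) \<Rightarrow> (nat \<Rightarrow> complex \<Rightarrow> complex) \<Rightarrow> nat \<Rightarrow> complex \<Rightarrow> complex" where
  "wkb_coeff p Q 0 = (\<lambda>z. 1)"
| "wkb_coeff p Q (Suc n) = (\<lambda>z. (deriv (wkb_coeff p Q n) z + p z * wkb_coeff p Q n z + Q (Suc n) z
     - (\<Sum>i=1..n. wkb_coeff p Q i z * wkb_coeff p Q (Suc n - i) z)) * (1 / 2))"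

lemma tame_wkb_coeff:
  assumes p: "tame d p" and Q: "\<And>k. tame d (Q k)"
  shows "tame d (wkb_coeff p Q n)"
proof (induction n rule: less_induct)
  case (less n)
  show ?case
  proof (cases n)
    case (Suc k)
    have "tame d (\<lambda>z. wkb_coeff p Q i z * wkb_coeff p Q (Suc k - i) z)" if "i \<in> {1..k}" for i
      using less.IH [of i] less.IH [of "Suc k - i"] that Suc by (intro tame_mult) auto
    then have S: "tame d (\<lambda>z. \<Sum>i=1..k. wkb_coeff p Q i z * wkb_coeff p Q (Suc k - i) z)"
      by (rule tame_sum)
    have Gk: "tame d (wkb_coeff p Q k)" using less.IH [of k] Suc by simp
    show ?thesis
      unfolding Suc wkb_coeff.simps
      by (rule tame_mult [OF tame_diff [OF tame_add [OF tame_add [OF tame_deriv [OF Gk]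
          tame_mult [OF p Gk]] Q] S] tame_const])
  qed auto
qed

text \<open>The recursion read backwards as the equation for a single power of \<open>h\<close>.\<close>

lemma wkb_coeff_rec:
  "deriv (wkb_coeff p Q n) z + p z * wkb_coeff p Q n z
     = (\<Sum>i\<le>Suc n. wkb_coeff p Q i z * wkb_coeff p Q (Suc n - i) z) - Q (Suc n) z"
proof -
  have "(\<Sum>i\<le>Suc n. wkb_coeff p Q i z * wkb_coeff p Q (Suc n - i) z)
      = 2 * wkb_coeff p Q (Suc n) z + (\<Sum>i=1..n. wkb_coeff p Q i z * wkb_coeff p Q (Suc n - i) z)"
  proof -
    have "{..Suc n} = insert 0 (insert (Suc n) {1..n})" by auto
    then show ?thesis by (simp del: wkb_coeff.simps(2))
  qed
  then show ?thesis by simp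
qed

text \<open>The disc \<open>\<bar>h - r\<bar> < r\<close> is the half-plane \<open>Re (1 / h) > 1 / (2 r)\<close> in the coordinate \<open>1 / h\<close>.\<close>

lemma tangent_disc:
  assumes "h \<in> ball (of_real r) r"
  shows "h \<noteq> 0" "0 < Re h" "norm h < 2 * r" "1 / (2 * r) \<le> Re (1 / h)"
proof -
  have lt: "norm (of_real r - h) < r" using assms by (simp add: dist_norm)
  have r: "0 < r" using lt norm_ge_zero [of "of_real r - h"] by linarith
  have "(norm (of_real r - h))\<^sup>2 < r\<^sup>2" using lt r by (intro power_strict_mono) auto
  then have *: "(Re h)\<^sup>2 + (Im h)\<^sup>2 < 2 * r * Re h"
    by (simp add: cmod_power2 power2_diff algebra_simps)
  have "0 < 2 * r * Re h" using * by (smt (verit) zero_le_power2)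
  then show h: "0 < Re h" using r by (simp add: zero_less_mult_iff)
  then show "h \<noteq> 0" by auto
  show "norm h < 2 * r" using lt norm_triangle_ineq2 [of h "of_real r"] r by (simp add: norm_minus_commute)
  have "0 < (Re h)\<^sup>2 + (Im h)\<^sup>2" using h by (simp add: sum_power2_gt_zero_iff)
  then show "1 / (2 * r) \<le> Re (1 / h)"
    using * r by (simp add: Re_divide field_simps)
qed

lemma bounded_sep_hol_fun_of_z: 
  assumes "f holomorphic_on U" "\<And>z. z \<in> U \<Longrightarrow> norm (f z) \<le> M"
  shows "bounded_sep_hol (\<lambda>z h. f z) U V M"
  using assms by (auto simp: bounded_sep_hol_def)

lemma bounded_sep_hol_polynomial:
  assumes f: "\<And>k. k < m \<Longrightarrow> f k holomorphic_on U" and M: "\<And>k z. k < m \<Longrightarrow> z \<in> U \<Longrightarrow> norm (f k z) \<le> M k"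
    and V: "\<And>h. h \<in> V \<Longrightarrow> norm h \<le> 1"
  shows "bounded_sep_hol (\<lambda>z h. \<Sum>k<m. f k z * h ^ k) U V (\<Sum>k<m. M k)"
  unfolding bounded_sep_hol_def
proof (intro conjI ballI)
  fix z h assume z: "z \<in> U" and h: "h \<in> V"
  have "norm (f k z * h ^ k) \<le> M k" if "k < m" for k
  proof -
    have "norm (f k z) * norm (h ^ k) \<le> M k * 1"
      using M [OF that z] V [OF h] order_trans [OF norm_ge_zero M [OF that z]]
      by (intro mult_mono) (auto simp: norm_power power_le_one)
    then show ?thesis by (simp add: norm_mult)
  qed
  then show "norm (\<Sum>k<m. f k z * h ^ k) \<le> (\<Sum>k<m. M k)"
    by (intro sum_norm_le) auto
qed (use f in \<open>auto intro!: holomorphic_intros\<close>)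

text \<open>Substituting \<open>1 + h (g + y)\<close> removes all terms that are singular in \<open>h\<close> except \<open>(2 / h) y\<close>; the choice
  \<open>2 g = p + Q\<^sub>1\<close> cancels the terms of order zero.\<close>

lemma shifted_Riccati_identity:
  fixes h :: complex
  assumes "h \<noteq> 0"
  shows "h * (g' + (2 / h * y + (y\<^sup>2 + (2 * g - p) * y + ((g * g - g' - p * g) + (- 1) * S))))
    = ((1 + h * (g + y))\<^sup>2 - (1 + h * (2 * g - p) + h\<^sup>2 * S)) / h - p * (1 + h * (g + y))"
proof -
  have "((1 + h * (g + y))\<^sup>2 - (1 + h * (2 * g - p) + h\<^sup>2 * S)) / h
      = (h * (2 * (g + y) + h * (g + y)\<^sup>2 - (2 * g - p) - h * S)) / h"
    by (simp add: power2_eq_square algebra_simps)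
  also have "\<dots> = 2 * (g + y) + h * (g + y)\<^sup>2 - (2 * g - p) - h * S" using assms by simp
  finally show ?thesis using assms by (simp add: power2_eq_square algebra_simps)
qed

text \<open>Two terms of the formal solution have to be split off before the fixed point argument: with only one of
  them the inhomogeneity would be of size \<open>1 / h\<close>, and the solution would be controlled merely in a domain
  of the form \<open>\<bar>h\<bar> = O(cos\<^sup>2 (arg h))\<close>.\<close>

theorem exact_WKB_on_half_strip:
  fixes p :: "complex \<Rightarrow> complex" and Q :: "nat \<Rightarrow> complex \<Rightarrow> complex"
  assumes d: "0 < d" and p: "tame d p" and Q: "\<And>k. tame d (Q k)"
    and Q0: "\<And>z. Q 0 z = 1"
  defines "G \<equiv> wkb_coeff p Q" and "H \<equiv> half_strip (d / 2)"
  obtains r F M where "0 < r" "bounded_sep_hol F H (ball (of_real r) r) 2"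
    and "\<And>z h. z \<in> H \<Longrightarrow> h \<in> ball (of_real r) r \<Longrightarrow>
      ((\<lambda>z. F z h) has_field_derivative
        ((F z h)\<^sup>2 - (\<Sum>k<Suc (Suc m). Q k z * h ^ k)) / h - p z * F z h) (at z)"
    and "\<And>z h. z \<in> H \<Longrightarrow> h \<in> ball (of_real r) r \<Longrightarrow> 0 < Re (F z h)"
    and "\<And>z h. z \<in> H \<Longrightarrow> h \<in> ball (of_real r) r \<Longrightarrow> norm (F z h - 1) \<le> M * norm h"
proof -
  have d2: "d / 2 < d" using d by simp
  have G: "tame d (G k)" for k unfolding G_def by (rule tame_wkb_coeff [OF p Q])
  define B0 where "B0 = (\<lambda>z. G 1 z * G 1 z - deriv (G 1) z - p z * G 1 z)"
  have B0: "tame d B0" unfolding B0_def using G p by (intro tame_mult tame_diff tame_deriv) auto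
  obtain MA where MA: "0 \<le> MA" "\<And>z. z \<in> H \<Longrightarrow> norm (Q 1 z) \<le> MA"
    using tameD(2) [OF Q [of 1] d2] unfolding H_def by blast
  obtain M1 where M1: "0 \<le> M1" "\<And>z. z \<in> H \<Longrightarrow> norm (G 1 z) \<le> M1"
    using tameD(2) [OF G [of 1] d2] unfolding H_def by blast
  obtain MB where MB: "0 \<le> MB" "\<And>z. z \<in> H \<Longrightarrow> norm (B0 z) \<le> MB"
    using tameD(2) [OF B0 d2] unfolding H_def by blast
  have "\<exists>M\<ge>0. \<forall>z\<in>H. norm (Q k z) \<le> M" for k using tameD(2) [OF Q [of k] d2] unfolding H_def .
  then obtain MQ where MQ: "\<And>k. 0 \<le> MQ k" "\<And>k z. z \<in> H \<Longrightarrow> norm (Q k z) \<le> MQ k" by metis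
  define C where "C = MA + MB + (\<Sum>k<m. MQ (Suc (Suc k)))"
  have C: "0 \<le> C" "MA \<le> C" "MB + (\<Sum>k<m. MQ (Suc (Suc k))) \<le> C"
    using MA MB MQ by (auto simp: C_def intro!: sum_nonneg add_nonneg_nonneg)
  \<comment> \<open>The first bound on \<open>r\<close> gives \<open>\<bar>h\<bar> \<le> 1\<close>, the second \<open>Re (1 / h) \<ge> K\<close>, the third \<open>\<bar>F - 1\<bar> \<le> 1 / 2\<close>.\<close>
  define K where "K = 2 + 2 * C"
  define r where "r = min (1 / 2) (min (1 / (2 * K)) (1 / (4 * (M1 + 1))))"
  have K0: "0 < K" using C by (simp add: K_def)
  have r: "0 < r" "r \<le> 1 / 2" "r \<le> 1 / (2 * K)" "r \<le> 1 / (4 * (M1 + 1))"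
    using K0 M1 by (auto simp: r_def)
  define V where "V = ball (complex_of_real r) r"
  have V: "open V" "convex V" by (auto simp: V_def)
  have V1: "norm h \<le> 1" and VK: "h \<noteq> 0 \<and> K \<le> Re (1 / h)" and Vr: "norm h \<le> 2 * r" if "h \<in> V" for h
  proof -
    show "norm h \<le> 1" "norm h \<le> 2 * r" using tangent_disc(3) [of h r] that r by (auto simp: V_def)
    have "K \<le> 1 / (2 * r)" using r K0 by (simp add: field_simps)
    then show "h \<noteq> 0 \<and> K \<le> Re (1 / h)"
      using tangent_disc(1,4) [of h r] that r by (auto simp: V_def)
  qed
  have QH: "Q k holomorphic_on H" for k unfolding H_def by (rule tameD(1) [OF Q d2])
  have Ab: "bounded_sep_hol (\<lambda>z h. Q 1 z) H V C"
    by (rule bounded_sep_hol_fun_of_z [OF QH]) (use MA C in fastforce)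
  have Bb: "bounded_sep_hol (\<lambda>z h. B0 z + (- 1) * (\<Sum>k<m. Q (Suc (Suc k)) z * h ^ k)) H V C"
  proof -
    have "bounded_sep_hol (\<lambda>z h. B0 z + (- 1) * (\<Sum>k<m. Q (Suc (Suc k)) z * h ^ k)) H V
        (MB + 1 * (\<Sum>k<m. MQ (Suc (Suc k))))"
      using tameD(1) [OF B0 d2] QH MB MQ V1
      by (intro bounded_sep_hol_add bounded_sep_hol_mult bounded_sep_hol_polynomial bounded_sep_hol_fun_of_z)
        (auto simp: H_def)
    then show ?thesis by (rule bounded_sep_hol_mono) (use C in simp)
  qed
  obtain y where yb: "bounded_sep_hol y H V 1"
    and yd: "\<And>z h. z \<in> H \<Longrightarrow> h \<in> V \<Longrightarrow> ((\<lambda>z. y z h) has_field_derivative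
       (2 / h * y z h + ((y z h)\<^sup>2 + Q 1 z * y z h + (B0 z + (- 1) * (\<Sum>k<m. Q (Suc (Suc k)) z * h ^ k))))) (at z)"
    using Riccati_bounded_solution [OF Ab [unfolded H_def] Bb [unfolded H_def] C(1) V VK, unfolded K_def]
    unfolding H_def by auto
  define F where "F = (\<lambda>z h. 1 + h * (G 1 z + y z h))"
  have Gd: "(G 1 has_field_derivative deriv (G 1) z) (at z)" if "z \<in> H" for z
    by (rule holomorphic_derivI [OF tameD(1) [OF G d2] open_half_strip]) (use that H_def in auto)
  have F1: "norm (F z h - 1) \<le> (M1 + 1) * norm h" if "z \<in> H" "h \<in> V" for z h
  proof -
    have "norm (G 1 z + y z h) \<le> M1 + 1"
      using M1 that yb by (auto simp: bounded_sep_hol_def intro!: norm_triangle_le add_mono)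
    then show ?thesis by (simp add: F_def norm_mult mult.commute mult_left_mono)
  qed
  have F12: "norm (F z h - 1) \<le> 1 / 2" if "z \<in> H" "h \<in> V" for z h
  proof -
    have "(M1 + 1) * norm h \<le> (M1 + 1) * (2 * r)" using Vr [OF that(2)] M1 by (intro mult_left_mono) auto
    also have "\<dots> \<le> (M1 + 1) * (2 * (1 / (4 * (M1 + 1))))" using r M1 by (intro mult_left_mono) auto
    also have "\<dots> = 1 / 2" using M1 by (simp add: field_simps)
    finally show ?thesis using F1 [OF that] by linarith
  qed
  show thesis
  proof (rule that [OF r(1), of F "M1 + 1"])
    show "bounded_sep_hol F H (ball (of_real r) r) 2"
      unfolding bounded_sep_hol_def V_def [symmetric]
    proof (intro conjI ballI)
      fix z h assume zh: "z \<in> H" "h \<in> V"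
      have "norm (F z h) \<le> norm (F z h - 1) + norm (1 :: complex)"
        using norm_triangle_ineq [of "F z h - 1" 1] by simp
      then show "norm (F z h) \<le> 2" using F12 [OF zh] by simp
    next
      fix h assume "h \<in> V"
      then show "(\<lambda>z. F z h) holomorphic_on H"
        unfolding F_def using tameD(1) [OF G d2] yb
        by (auto simp: bounded_sep_hol_def H_def intro!: holomorphic_intros)
    next
      fix z assume "z \<in> H"
      then show "F z holomorphic_on V"
        unfolding F_def using yb by (auto simp: bounded_sep_hol_def intro!: holomorphic_intros)
    qed
    fix z h :: complex assume z: "z \<in> H" and "h \<in> ball (of_real r) r"
    then have h: "h \<in> V" by (simp add: V_def)
    have h0: "h \<noteq> 0" using VK h by auto
    show "norm (F z h - 1) \<le> (M1 + 1) * norm h" by (rule F1 [OF z h])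
    show "0 < Re (F z h)" using F12 [OF z h] abs_Re_le_cmod [of "F z h - 1"] by simp
    define S where "S = (\<Sum>k<m. Q (Suc (Suc k)) z * h ^ k)"
    have sum: "(\<Sum>k<Suc (Suc m). Q k z * h ^ k) = 1 + h * Q 1 z + h\<^sup>2 * S"
      unfolding sum.lessThan_Suc_shift S_def sum_distrib_left
      by (simp add: Q0 power2_eq_square mult_ac)
    have G1: "2 * G 1 z = p z + Q 1 z" by (simp add: G_def)
    have "((\<lambda>z. F z h) has_field_derivative
        h * (deriv (G 1) z + (2 / h * y z h + ((y z h)\<^sup>2 + Q 1 z * y z h + (B0 z + (- 1) * S))))) (at z)"
      unfolding F_def S_def by (auto intro!: derivative_eq_intros yd [OF z h] Gd [OF z, unfolded One_nat_def])
    also have "h * (deriv (G 1) z + (2 / h * y z h + ((y z h)\<^sup>2 + Q 1 z * y z h + (B0 z + (- 1) * S))))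
        = ((F z h)\<^sup>2 - (1 + h * Q 1 z + h\<^sup>2 * S)) / h - p z * F z h"
    proof -
      have Q1: "Q 1 z = 2 * G 1 z - p z" using G1 by simp
      show ?thesis unfolding F_def B0_def Q1 by (rule shifted_Riccati_identity [OF h0])
    qed
    finally show "((\<lambda>z. F z h) has_field_derivative
        ((F z h)\<^sup>2 - (\<Sum>k<Suc (Suc m). Q k z * h ^ k)) / h - p z * F z h) (at z)"
      unfolding sum .
  qed
qed

definition wkb_partial :: "(complex \<Rightarrow> complex) \<Rightarrow> (nat \<Rightarrow> complex \<Rightarrow> complex) \<Rightarrow> nat \<Rightarrow> complex \<Rightarrow> complex poly" where
  "wkb_partial p Q N z = (\<Sum>k\<le>N. monom (wkb_coeff p Q k z) k)"

text \<open>The defect of a partial sum in the equation \<open>h F' + h p F - F\<^sup>2 + (\<Sum>k. Q\<^sub>k h^k) = 0\<close>, as a polynomial in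
  \<open>h\<close>, so that its order of vanishing can be read off from the coefficients.\<close>

definition wkb_residual :: "(complex \<Rightarrow> complex) \<Rightarrow> (nat \<Rightarrow> complex \<Rightarrow> complex) \<Rightarrow> nat \<Rightarrow> nat \<Rightarrow> complex \<Rightarrow> complex poly" where
  "wkb_residual p Q m N z = pCons 0 (\<Sum>k\<le>N. monom (deriv (wkb_coeff p Q k) z + p z * wkb_coeff p Q k z) k)
     - wkb_partial p Q N z * wkb_partial p Q N z + (\<Sum>k<m. monom (Q k z) k)"

lemma coeff_sum_monom_atMost: "coeff (\<Sum>k\<le>N. monom (f k) k) j = (if j \<le> N then f j else (0 :: complex))"
proof -
  have "coeff (\<Sum>k\<le>N. monom (f k) k) j = (\<Sum>k\<le>N. if k = j then f k else 0)"
    by (simp add: coeff_sum)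
  then show ?thesis by (simp add: sum.delta)
qed

lemma coeff_sum_monom_lessThan: "coeff (\<Sum>k<N. monom (f k) k) j = (if j < N then f j else (0 :: complex))"
proof -
  have "coeff (\<Sum>k<N. monom (f k) k) j = (\<Sum>k<N. if k = j then f k else 0)"
    by (simp add: coeff_sum)
  then show ?thesis by (simp add: sum.delta)
qed

lemma coeff_wkb_residual:
  "coeff (wkb_residual p Q m N z) j =
     (case j of 0 \<Rightarrow> 0 | Suc i \<Rightarrow> if i \<le> N then deriv (wkb_coeff p Q i) z + p z * wkb_coeff p Q i z else 0)
     - (\<Sum>i\<le>j. (if i \<le> N then wkb_coeff p Q i z else 0) * (if j - i \<le> N then wkb_coeff p Q (j - i) z else 0))
     + (if j < m then Q j z else 0)"
  unfolding wkb_residual_def wkb_partial_def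
  by (simp add: coeff_mult coeff_sum_monom_atMost coeff_sum_monom_lessThan coeff_pCons split: nat.split)

lemma wkb_residual_order:
  assumes Q0: "Q 0 z = 1" and m: "0 < m" and Qm: "\<And>k. m \<le> k \<Longrightarrow> Q k z = 0" and j: "j \<le> N"
  shows "coeff (wkb_residual p Q m N z) j = 0"
proof (cases j)
  case 0
  then show ?thesis using Q0 m by (simp add: coeff_wkb_residual)
next
  case (Suc n)
  have "(\<Sum>i\<le>Suc n. (if i \<le> N then wkb_coeff p Q i z else 0) * (if Suc n - i \<le> N then wkb_coeff p Q (Suc n - i) z else 0))
      = (\<Sum>i\<le>Suc n. wkb_coeff p Q i z * wkb_coeff p Q (Suc n - i) z)"
    using j Suc by (intro sum.cong) auto
  then show ?thesis
    using wkb_coeff_rec [of p Q n z] j Suc Qm [of "Suc n"]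
    by (auto simp: coeff_wkb_residual simp del: wkb_coeff.simps sum.atMost_Suc)
qed

lemma degree_wkb_residual: "degree (wkb_residual p Q m N z) \<le> 2 * N + m + 1"
proof (rule degree_le, intro allI impI)
  fix j assume j: "2 * N + m + 1 < j"
  have "(\<Sum>i\<le>j. (if i \<le> N then wkb_coeff p Q i z else 0) * (if j - i \<le> N then wkb_coeff p Q (j - i) z else 0)) = 0"
    using j by (intro sum.neutral) auto
  then show "coeff (wkb_residual p Q m N z) j = 0"
    using j by (auto simp: coeff_wkb_residual split: nat.split)
qed

lemma tame_coeff_wkb_residual:
  assumes p: "tame d p" and Q: "\<And>k. tame d (Q k)"
  shows "tame d (\<lambda>z. coeff (wkb_residual p Q m N z) j)"
proof -
  have G: "tame d (wkb_coeff p Q k)" for k by (rule tame_wkb_coeff [OF p Q])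
  have G': "tame d (\<lambda>z. if k \<le> N then wkb_coeff p Q k z else 0)" for k
    using G [of k] by (cases "k \<le> N") auto
  have 1: "tame d (\<lambda>z. case j of 0 \<Rightarrow> 0 | Suc i \<Rightarrow> if i \<le> N then deriv (wkb_coeff p Q i) z + p z * wkb_coeff p Q i z else 0)"
  proof (cases j)
    case (Suc i)
    have "tame d (\<lambda>z. deriv (wkb_coeff p Q i) z + p z * wkb_coeff p Q i z)"
      using G [of i] p by (intro tame_add tame_mult tame_deriv)
    then show ?thesis using Suc by (cases "i \<le> N") auto
  qed auto
  have 2: "tame d (\<lambda>z. if j < m then Q j z else 0)" using Q [of j] by (cases "j < m") auto
  show ?thesis
    unfolding coeff_wkb_residual by (rule tame_add [OF tame_diff [OF 1 tame_sum [OF tame_mult [OF G' G']]] 2])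
qed

text \<open>The coefficients up to order \<open>N\<close> vanish by the recursion, and the remaining finitely many ones are
  bounded.\<close>

lemma wkb_residual_bound:
  assumes p: "tame d p" and Q: "\<And>k. tame d (Q k)" and d': "d' < d"
    and Q0: "\<And>z. Q 0 z = 1" and m: "0 < m" and Qm: "\<And>k z. m \<le> k \<Longrightarrow> Q k z = 0"
  shows "\<exists>E\<ge>0. \<forall>z\<in>half_strip d'. \<forall>h. norm h \<le> 1 \<longrightarrow>
    norm (poly (wkb_residual p Q m N z) h) \<le> E * norm h ^ Suc N"
proof -
  define L where "L = 2 * N + m + 1"
  have "\<exists>M\<ge>0. \<forall>z\<in>half_strip d'. norm (coeff (wkb_residual p Q m N z) j) \<le> M" for j
    by (rule tameD(2) [OF tame_coeff_wkb_residual [OF p Q] d'])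
  then obtain M where M: "\<And>j. 0 \<le> M j" "\<And>j z. z \<in> half_strip d' \<Longrightarrow> norm (coeff (wkb_residual p Q m N z) j) \<le> M j"
    by metis
  have "norm (poly (wkb_residual p Q m N z) h) \<le> (\<Sum>j\<le>L. M j) * norm h ^ Suc N"
    if z: "z \<in> half_strip d'" and h: "norm h \<le> 1" for z h
  proof -
    let ?W = "wkb_residual p Q m N z"
    have "poly ?W h = (\<Sum>j\<le>degree ?W. coeff ?W j * h ^ j)" by (rule poly_altdef)
    also have "\<dots> = (\<Sum>j\<le>L. coeff ?W j * h ^ j)"
      using degree_wkb_residual [of p Q m N z] by (intro sum.mono_neutral_left) (auto simp: L_def coeff_eq_0)
    also have "norm \<dots> \<le> (\<Sum>j\<le>L. M j * norm h ^ Suc N)"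
    proof (rule sum_norm_le)
      fix j assume "j \<in> {..L}"
      show "norm (coeff ?W j * h ^ j) \<le> M j * norm h ^ Suc N"
      proof (cases "j \<le> N")
        case True
        then have "coeff ?W j = 0" by (intro wkb_residual_order Q0 m Qm)
        then show ?thesis using M(1) [of j] by simp
      next
        case False
        then have "norm h ^ j \<le> norm h ^ Suc N" using h by (intro power_decreasing) auto
        then show ?thesis using M(2) [OF z, of j] M(1) [of j] by (simp only: norm_mult norm_power) (intro mult_mono, auto)
      qed
    qed
    finally show ?thesis by (simp add: sum_distrib_right)
  qed
  then show ?thesis by (intro exI [of _ "\<Sum>j\<le>L. M j"]) (auto intro!: sum_nonneg M)
qed

lemma poly_wkb_partial: "poly (wkb_partial p Q N z) h = (\<Sum>k\<le>N. wkb_coeff p Q k z * h ^ k)"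
  by (simp add: wkb_partial_def poly_sum poly_monom)

lemma poly_wkb_residual:
  "poly (wkb_residual p Q m N z) h =
     h * (\<Sum>k\<le>N. (deriv (wkb_coeff p Q k) z + p z * wkb_coeff p Q k z) * h ^ k)
     - (\<Sum>k\<le>N. wkb_coeff p Q k z * h ^ k)\<^sup>2 + (\<Sum>k<m. Q k z * h ^ k)"
  unfolding wkb_residual_def by (simp add: poly_wkb_partial poly_sum poly_monom power2_eq_square)

lemma wkb_partial_minus_1_bound:
  assumes p: "tame d p" and Q: "\<And>k. tame d (Q k)" and d': "d' < d"
  shows "\<exists>E\<ge>0. \<forall>z\<in>half_strip d'. \<forall>h. norm h \<le> 1 \<longrightarrow>
    norm ((\<Sum>k\<le>N. wkb_coeff p Q k z * h ^ k) - 1) \<le> E * norm h"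
proof -
  have "\<exists>M\<ge>0. \<forall>z\<in>half_strip d'. norm (wkb_coeff p Q k z) \<le> M" for k
    by (rule tameD(2) [OF tame_wkb_coeff [OF p Q] d'])
  then obtain M where M: "\<And>j. 0 \<le> M j" "\<And>j z. z \<in> half_strip d' \<Longrightarrow> norm (wkb_coeff p Q j z) \<le> M j"
    by metis
  have "norm ((\<Sum>k\<le>N. wkb_coeff p Q k z * h ^ k) - 1) \<le> (\<Sum>k<N. M (Suc k)) * norm h"
    if z: "z \<in> half_strip d'" and h: "norm h \<le> 1" for z h
  proof -
    have "(\<Sum>k\<le>N. wkb_coeff p Q k z * h ^ k) - 1 = (\<Sum>k<N. wkb_coeff p Q (Suc k) z * h ^ Suc k)"
      unfolding sum.atMost_shift by (simp del: wkb_coeff.simps(2))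
    also have "norm \<dots> \<le> (\<Sum>k<N. M (Suc k) * norm h)"
    proof (rule sum_norm_le)
      fix k
      have "norm h ^ Suc k \<le> norm h ^ 1" using h by (intro power_decreasing) auto
      then show "norm (wkb_coeff p Q (Suc k) z * h ^ Suc k) \<le> M (Suc k) * norm h"
        using M(2) [OF z, of "Suc k"] M(1) [of "Suc k"] by (simp only: norm_mult norm_power) (intro mult_mono, auto)
    qed
    finally show ?thesis by (simp add: sum_distrib_right)
  qed
  then show ?thesis by (intro exI [of _ "\<Sum>k<N. M (Suc k)"]) (auto intro!: sum_nonneg M)
qed

text \<open>The difference \<open>w\<close> of \<open>F\<close> and a partial sum satisfies \<open>w' = (2 / h) w + (a w - W)\<close> with \<open>a\<close> bounded and
  \<open>W = O(h ^ N)\<close>. With \<open>b\<close> the supremum of \<open>\<bar>w\<bar>\<close>, \<open>bounded_linear_ode\<close> gives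
  \<open>b \<le> b / 2 + O(h ^ Suc N)\<close> for small \<open>h\<close> in a sector where \<open>Re (1 / h) \<ge> c / \<bar>h\<bar>\<close>.\<close>

theorem WKB_asymptotics_on_half_strip:
  fixes p :: "complex \<Rightarrow> complex" and Q :: "nat \<Rightarrow> complex \<Rightarrow> complex"
  assumes d: "d' < d" and p: "tame d p" and Q: "\<And>k. tame d (Q k)"
    and Q0: "\<And>z. Q 0 z = 1" and m: "0 < m" and Qm: "\<And>k z. m \<le> k \<Longrightarrow> Q k z = 0"
    and ode: "\<And>z h. z \<in> half_strip d' \<Longrightarrow> h \<in> V \<Longrightarrow>
      ((\<lambda>z. F z h) has_field_derivative ((F z h)\<^sup>2 - (\<Sum>k<m. Q k z * h ^ k)) / h - p z * F z h) (at z)"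
    and F1: "\<And>z h. z \<in> half_strip d' \<Longrightarrow> h \<in> V \<Longrightarrow> norm (F z h - 1) \<le> M * norm h"
    and c: "0 < c"
  shows "\<exists>C \<delta>. 0 < \<delta> \<and> (\<forall>z\<in>half_strip d'. \<forall>h\<in>V. h \<noteq> 0 \<and> norm h < \<delta> \<and> c \<le> norm h * Re (1 / h) \<longrightarrow>
    norm (F z h - (\<Sum>k\<le>N. wkb_coeff p Q k z * h ^ k)) \<le> C * norm h ^ Suc N)"
proof -
  define H where "H = half_strip d'"
  define P where "P = (\<lambda>z h. \<Sum>k\<le>N. wkb_coeff p Q k z * h ^ k)"
  obtain E where E: "0 \<le> E" and Eb: "\<And>z h. z \<in> H \<Longrightarrow> norm h \<le> 1 \<Longrightarrow>
      norm (poly (wkb_residual p Q m N z) h) \<le> E * norm h ^ Suc N"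
    using wkb_residual_bound [where p = p and Q = Q and N = N and m = m, OF p Q d Q0 m Qm] unfolding H_def by blast
  obtain E1 where E1: "0 \<le> E1" and E1b: "\<And>z h. z \<in> H \<Longrightarrow> norm h \<le> 1 \<Longrightarrow> norm (P z h - 1) \<le> E1 * norm h"
    using wkb_partial_minus_1_bound [where p = p and Q = Q and N = N, OF p Q d] unfolding H_def P_def by blast
  obtain Mp where Mp: "0 \<le> Mp" "\<And>z. z \<in> H \<Longrightarrow> norm (p z) \<le> Mp"
    using tameD(2) [OF p d] unfolding H_def by blast
  define A where "A = \<bar>M\<bar> + E1 + Mp"
  have A: "0 \<le> A" using E1 Mp by (simp add: A_def)
  define \<delta> where "\<delta> = min 1 (c / (A + 1))"
  have \<delta>: "0 < \<delta>" "\<delta> \<le> 1" "\<delta> * (A + 1) \<le> c"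
  proof -
    show "0 < \<delta>" "\<delta> \<le> 1" using A c by (auto simp: \<delta>_def)
    have "\<delta> \<le> c / (A + 1)" by (simp add: \<delta>_def)
    then show "\<delta> * (A + 1) \<le> c" using A by (simp add: pos_le_divide_eq)
  qed
  have main: "norm (F z h - P z h) \<le> E / c * norm h ^ Suc N"
    if z: "z \<in> H" and h: "h \<in> V" and h0: "h \<noteq> 0" and hd: "norm h < \<delta>" and hc: "c \<le> norm h * Re (1 / h)" for z h
  proof -
    have h1: "norm h \<le> 1" using hd \<delta> by simp
    define w where "w = (\<lambda>z. F z h - P z h)"
    define K where "K = c / norm h"
    have K: "0 < K" "K \<le> Re (1 / h)" using c h0 hc by (auto simp: K_def field_simps)
    define a where "a = (\<lambda>z. ((F z h - 1) + (P z h - 1)) / h - p z)"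
    define W where "W = (\<lambda>z. poly (wkb_residual p Q m N z) h / h)"
    have FM: "norm (F z h - 1) \<le> \<bar>M\<bar> * norm h" if "z \<in> H" for z
      using F1 [of z h] that h mult_right_mono [OF abs_ge_self [of M] norm_ge_zero [of h]] by (simp add: H_def)
    have aA: "norm (a z) \<le> A" if "z \<in> H" for z
    proof -
      have "norm (((F z h - 1) + (P z h - 1)) / h) \<le> (\<bar>M\<bar> * norm h + E1 * norm h) / norm h"
        unfolding norm_divide
        by (rule divide_right_mono [OF norm_triangle_le [OF add_mono [OF FM [OF that] E1b [OF that h1]]]]) simp
      also have "\<dots> = \<bar>M\<bar> + E1" using h0 by (simp add: field_simps)
      finally show ?thesis unfolding a_def A_def using Mp(2) [OF that] by (intro norm_triangle_le_diff) linarith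
    qed
    have WE: "norm (W z) \<le> E * norm h ^ N" if "z \<in> H" for z
      using Eb [OF that h1] h0 by (simp add: W_def norm_divide field_simps)
    have wd: "(w has_field_derivative (2 / h * w z + (a z * w z - W z))) (at z)" if zH: "z \<in> H" for z
    proof -
      have "(wkb_coeff p Q k has_field_derivative deriv (wkb_coeff p Q k) z) (at z)" for k
        by (rule holomorphic_derivI [OF tameD(1) [OF tame_wkb_coeff [OF p Q] d] open_half_strip])
          (use zH H_def in auto)
      then have dP: "((\<lambda>z. P z h) has_field_derivative (\<Sum>k\<le>N. deriv (wkb_coeff p Q k) z * h ^ k)) (at z)"
        unfolding P_def by (intro DERIV_sum DERIV_cmult_right)
      have "(w has_field_derivative (((F z h)\<^sup>2 - (\<Sum>k<m. Q k z * h ^ k)) / h - p z * F z h)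
          - (\<Sum>k\<le>N. deriv (wkb_coeff p Q k) z * h ^ k)) (at z)"
        unfolding w_def by (rule DERIV_diff [OF ode dP]) (use zH h H_def in auto)
      also have "(\<Sum>k\<le>N. deriv (wkb_coeff p Q k) z * h ^ k)
          = W z - p z * P z h + ((P z h)\<^sup>2 - (\<Sum>k<m. Q k z * h ^ k)) / h"
      proof -
        have "(\<Sum>k\<le>N. (deriv (wkb_coeff p Q k) z + p z * wkb_coeff p Q k z) * h ^ k)
            = (\<Sum>k\<le>N. deriv (wkb_coeff p Q k) z * h ^ k) + p z * P z h"
          by (simp add: P_def sum_distrib_left sum.distrib distrib_right mult.assoc)
        then show ?thesis using h0 unfolding W_def poly_wkb_residual
          by (simp add: P_def field_simps)
      qed
      also have "(((F z h)\<^sup>2 - (\<Sum>k<m. Q k z * h ^ k)) / h - p z * F z h)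
            - (W z - p z * P z h + ((P z h)\<^sup>2 - (\<Sum>k<m. Q k z * h ^ k)) / h)
          = 2 / h * w z + (a z * w z - W z)"
        using h0 unfolding w_def a_def by (simp add: field_simps power2_eq_square)
      finally show ?thesis .
    qed
    have wb: "norm (w z) \<le> (\<bar>M\<bar> + E1) * norm h" if "z \<in> H" for z
    proof -
      have "w z = (F z h - 1) - (P z h - 1)" by (simp add: w_def)
      also have "norm \<dots> \<le> \<bar>M\<bar> * norm h + E1 * norm h"
        by (rule norm_triangle_le_diff [OF add_mono [OF FM [OF that] E1b [OF that h1]]])
      finally show ?thesis by (simp add: algebra_simps)
    qed
    define b where "b = (SUP z\<in>H. norm (w z))"
    have bdd: "bdd_above ((\<lambda>z. norm (w z)) ` H)" using wb by (auto intro!: bdd_aboveI)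
    have le_b: "norm (w z) \<le> b" if "z \<in> H" for z
      unfolding b_def by (rule cSUP_upper [OF that bdd])
    have b0: "0 \<le> b" using le_b [OF z] norm_ge_zero order_trans by blast
    have "norm (w z) \<le> (A * b + E * norm h ^ N) / (2 * K)" if zH: "z \<in> H" for z
    proof (rule bounded_linear_ode [of d' w h "\<lambda>z. a z * w z - W z" b])
      show "norm (a z * w z - W z) \<le> A * b + E * norm h ^ N" if "z \<in> half_strip d'" for z
        using aA [of z] WE [of z] le_b [of z] that A b0
        by (intro norm_triangle_le_diff add_mono) (auto simp: H_def norm_mult intro!: mult_mono)
    qed (use wd le_b K zH in \<open>auto simp: H_def\<close>)
    then have "b \<le> (A * b + E * norm h ^ N) / (2 * K)"
      unfolding b_def using z by (intro cSUP_least) auto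
    also have "\<dots> = (A * norm h / c) * b / 2 + E / c * norm h ^ Suc N / 2"
      using c h0 by (simp add: K_def field_simps)
    also have "(A * norm h / c) * b / 2 \<le> 1 * b / 2"
    proof -
      have "A * norm h \<le> (A + 1) * \<delta>" using A hd by (intro mult_mono) auto
      then have "A * norm h / c \<le> 1" using \<delta> c by (simp add: field_simps)
      then show ?thesis using b0 by (intro divide_right_mono mult_right_mono) auto
    qed
    finally have "b \<le> E / c * norm h ^ Suc N" by simp
    then show ?thesis using le_b [OF z] by (simp add: w_def)
  qed
  then show ?thesis using \<delta>(1) unfolding H_def P_def by blast
qed

section \<open>Exponentials of Poincare expansions\<close>

lemma fps_nth_polynomial:
  assumes "finite I"
  shows "fps_nth (\<Sum>k\<in>I. fps_const (a k) * fps_X ^ k) n = (if n \<in> I then a n else (0 :: complex))"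
proof -
  have "fps_nth (\<Sum>k\<in>I. fps_const (a k) * fps_X ^ k) n = (\<Sum>k\<in>I. if n = k then a k else 0)"
    by (simp add: fps_sum_nth fps_X_power_nth if_distrib cong: if_cong)
  then show ?thesis using assms by (simp add: sum.delta')
qed

lemma has_fps_expansion_remainder:
  fixes f :: "complex \<Rightarrow> complex"
  assumes f: "f has_fps_expansion B"
  shows "(\<lambda>h. f h - (\<Sum>k<N. fps_nth B k * h ^ k)) \<in> O[at 0](\<lambda>h. h ^ N)"
proof -
  define R where "R = B - (\<Sum>k<N. fps_const (fps_nth B k) * fps_X ^ k)"
  define g where "g = (\<lambda>h. f h - (\<Sum>k<N. fps_nth B k * h ^ k))"
  have g: "g has_fps_expansion R"
    unfolding g_def R_def by (intro fps_expansion_intros f)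
  have R0: "fps_nth R k = 0" if "k < N" for k
    using that by (simp add: R_def fps_nth_polynomial)
  show ?thesis
    unfolding g_def [symmetric]
  proof (cases "R = 0")
    case True
    then have "\<forall>\<^sub>F h in nhds 0. g h = 0" using g by (auto simp: has_fps_expansion_def elim!: eventually_mono)
    then have "\<forall>\<^sub>F h in at 0. g h = 0" by (simp add: eventually_at_filter eventually_mono)
    then show "g \<in> O[at 0](\<lambda>h. h ^ N)" by (intro bigoI [of _ 1]) (auto elim!: eventually_mono)
  next
    case False
    then have "N \<le> subdegree R" using R0 by (intro subdegree_geI) auto
    then have "(\<lambda>h. if h = 0 then fps_nth R N else g h / h ^ N) has_fps_expansion fps_shift N R"
      by (rule has_fps_expansion_shift [OF g]) simp
    then have "((\<lambda>h. if h = 0 then fps_nth R N else g h / h ^ N) \<longlongrightarrow> fps_nth R N) (at 0)"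
      by (drule_tac has_fps_expansion_imp_continuous [where A = UNIV]) (simp add: continuous_within)
    then have "((\<lambda>h. g h / h ^ N) \<longlongrightarrow> fps_nth R N) (at 0)"
      by (rule Lim_transform_eventually) (auto simp: eventually_at_filter)
    then show "g \<in> O[at 0](\<lambda>h. h ^ N)"
      by (rule bigoI_tendsto) (rule eventually_mono [OF eventually_neq_at_within [of 0]], simp)
  qed
qed

lemma fps_nth_power_cong:
  fixes f g :: "complex fps"
  assumes "\<And>j. j \<le> n \<Longrightarrow> fps_nth f j = fps_nth g j"
  shows "fps_nth (f ^ i) n = fps_nth (g ^ i) n"
  using assms
proof (induction i arbitrary: n)
  case (Suc i)
  have "fps_nth f j * fps_nth (f ^ i) (n - j) = fps_nth g j * fps_nth (g ^ i) (n - j)" if "j \<le> n" for j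
  proof -
    have "fps_nth (f ^ i) (n - j) = fps_nth (g ^ i) (n - j)" by (rule Suc.IH) (use Suc.prems in simp)
    then show ?thesis using Suc.prems [OF that] by simp
  qed
  then show ?case unfolding power_Suc fps_mult_nth by (intro sum.cong) auto
qed simp

lemma fps_nth_compose_cong:
  fixes f g F :: "complex fps"
  assumes "\<And>j. j \<le> n \<Longrightarrow> fps_nth f j = fps_nth g j"
  shows "fps_nth (fps_compose F f) n = fps_nth (fps_compose F g) n"
  by (simp add: fps_compose_nth fps_nth_power_cong [OF assms])

text \<open>The exponential of a polynomial is holomorphic, so its expansion is its Taylor series; up to order \<open>N\<close> the
  composition of formal series sees only the first \<open>N\<close> coefficients of the exponent.\<close>

lemma exp_polynomial_expansion:
  fixes a :: "nat \<Rightarrow> complex"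
  shows "(\<lambda>h. exp (\<Sum>k<N. a k * h ^ k) - (\<Sum>k<N. fps_nth (fps_exponential (Abs_fps a)) k * h ^ k))
    \<in> O[at 0](\<lambda>h. h ^ N)"
proof (cases "N = 0")
  case True
  then show ?thesis by (simp add: bigoI [of _ 1])
next
  case False
  define T where "T = (\<Sum>k\<in>{1..<N}. fps_const (a k) * fps_X ^ k)"
  define E where "E = fps_const (exp (a 0)) * fps_compose (fps_exp 1) T"
  have T: "(\<lambda>h. \<Sum>k\<in>{1..<N}. a k * h ^ k) has_fps_expansion T"
    unfolding T_def by (intro fps_expansion_intros)
  have "(\<lambda>h. exp (a 0) * (exp \<circ> (\<lambda>h. \<Sum>k\<in>{1..<N}. a k * h ^ k)) h) has_fps_expansion E"
    unfolding E_def
    by (intro has_fps_expansion_mult has_fps_expansion_const has_fps_expansion_compose has_fps_expansion_exp1 T)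
      (simp add: T_def fps_nth_polynomial)
  moreover have "exp (a 0) * (exp \<circ> (\<lambda>h. \<Sum>k\<in>{1..<N}. a k * h ^ k)) h = exp (\<Sum>k<N. a k * h ^ k)" for h
  proof -
    have "{..<N} = insert 0 {1..<N}" using False by auto
    then show ?thesis by (simp add: exp_add)
  qed
  ultimately have "(\<lambda>h. exp (\<Sum>k<N. a k * h ^ k)) has_fps_expansion E" by simp
  then have R: "(\<lambda>h. exp (\<Sum>k<N. a k * h ^ k) - (\<Sum>k<N. fps_nth E k * h ^ k)) \<in> O[at 0](\<lambda>h. h ^ N)"
    by (rule has_fps_expansion_remainder)
  have eq: "(\<Sum>k<N. fps_nth E k * h ^ k) = (\<Sum>k<N. fps_nth (fps_exponential (Abs_fps a)) k * h ^ k)" for h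
  proof (intro sum.cong refl)
    fix n assume "n \<in> {..<N}"
    then have "fps_nth (fps_compose (fps_exp 1) T) n
        = fps_nth (fps_compose (fps_exp 1) (Abs_fps a - fps_const (a 0))) n"
      by (intro fps_nth_compose_cong) (auto simp: T_def fps_nth_polynomial not_le Suc_le_eq)
    then show "fps_nth E n * h ^ n = fps_nth (fps_exponential (Abs_fps a)) n * h ^ n"
      by (simp add: E_def fps_exponential_def)
  qed
  show ?thesis using R unfolding eq .
qed

lemma exp_diff_bound:
  fixes a b :: complex
  assumes "norm a \<le> R" "norm b \<le> R"
  shows "norm (exp a - exp b) \<le> exp R * norm (a - b)"
proof (rule field_differentiable_bound [where S = "cball 0 R" and f' = exp])
  fix z :: complex assume "z \<in> cball 0 R"
  then have "norm z \<le> R" by simp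
  then show "norm (exp z) \<le> exp R"
    using complex_Re_le_cmod [of z] by simp
  show "(exp has_field_derivative exp z) (at z within cball 0 R)"
    by (rule has_field_derivative_at_within [OF DERIV_exp])
qed (use assms in auto)

text \<open>The exponent is replaced by a polynomial at the cost of \<open>O(h ^ N)\<close>, because the exponential function is
  Lipschitz on bounded sets.\<close>

lemma poincare_expansion_exp:
  assumes A: "poincare_expansion \<alpha> \<beta> S A (Abs_fps a)"
  shows "poincare_expansion \<alpha> \<beta> S (\<lambda>h. exp (A h)) (fps_exponential (Abs_fps a))"
  unfolding poincare_expansion_def
proof (intro allI impI)
  fix \<alpha>' \<beta>' N assume ab: "\<alpha> < \<alpha>' \<and> \<alpha>' \<le> \<beta>' \<and> \<beta>' < \<beta>"
  define F where "F = at (0 :: complex) within (S \<inter> closed_sector \<alpha>' \<beta>')"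
  define P where "P = (\<lambda>h. \<Sum>k<N. a k * h ^ k)"
  have Ak: "(\<lambda>h. A h - (\<Sum>k<n. a k * h ^ k)) \<in> O[F](\<lambda>h. h ^ n)" for n
    using A [unfolded poincare_expansion_def fps_nth_Abs_fps, rule_format, OF ab] unfolding F_def .
  have AN: "(\<lambda>h. A h - P h) \<in> O[F](\<lambda>h. h ^ N)" unfolding P_def by (rule Ak)
  have "(\<lambda>h. A h) \<in> O[F](\<lambda>h. 1)" using Ak [of 0] by simp
  then obtain R1 where R1: "\<forall>\<^sub>F h in F. norm (A h) \<le> R1 * norm (1 :: complex)"
    unfolding bigo_def by blast
  have "(P \<longlongrightarrow> P 0) (at 0)"
    unfolding P_def by (intro tendsto_intros)
  then have "(P \<longlongrightarrow> P 0) F" unfolding F_def by (rule tendsto_within_subset) simp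
  from order_tendstoD(2) [OF tendsto_norm [OF this], of "norm (P 0) + 1"]
  have "\<forall>\<^sub>F h in F. norm (P h) < norm (P 0) + 1" by simp
  with R1 have "\<forall>\<^sub>F h in F. norm (exp (A h) - exp (P h)) \<le> exp (max R1 (norm (P 0) + 1)) * norm (A h - P h)"
    by eventually_elim (rule exp_diff_bound, auto)
  then have "(\<lambda>h. exp (A h) - exp (P h)) \<in> O[F](\<lambda>h. A h - P h)"
    by (rule bigoI)
  then have 1: "(\<lambda>h. exp (A h) - exp (P h)) \<in> O[F](\<lambda>h. h ^ N)"
    using AN by (rule landau_o.big_trans)
  have 2: "(\<lambda>h. exp (P h) - (\<Sum>k<N. fps_nth (fps_exponential (Abs_fps a)) k * h ^ k)) \<in> O[F](\<lambda>h. h ^ N)"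
    unfolding P_def F_def by (rule landau_o.big.filter_mono [OF at_le exp_polynomial_expansion]) simp
  show "(\<lambda>h. exp (A h) - (\<Sum>k<N. fps_nth (fps_exponential (Abs_fps a)) k * h ^ k))
      \<in> O[at 0 within (S \<inter> closed_sector \<alpha>' \<beta>')](\<lambda>h. h ^ N)"
    using sum_in_bigo(1) [OF 1 2] by (simp add: F_def)
qed

section \<open>From a half-strip to a neighbourhood of the base point\<close>

lemma rat_eval_0 [simp]: "rat_eval 0 x = 0"
  by (simp add: rat_eval_def)

lemma coeff_potential_at: "coeff (potential_at q x) k = rat_eval (coeff q k) x"
  by (simp add: potential_at_def coeff_map_poly)

lemma poly_potential_at:
  assumes "degree q < m"
  shows "poly (potential_at q x) h = (\<Sum>k<m. rat_eval (coeff q k) x * h ^ k)"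
proof -
  have d: "degree (potential_at q x) \<le> degree q"
    by (rule degree_le) (simp add: coeff_potential_at coeff_eq_0)
  have "poly (potential_at q x) h = (\<Sum>k\<le>degree (potential_at q x). coeff (potential_at q x) k * h ^ k)"
    by (rule poly_altdef)
  also have "\<dots> = (\<Sum>k<m. coeff (potential_at q x) k * h ^ k)"
    using d assms by (intro sum.mono_neutral_left) (auto simp: coeff_eq_0)
  finally show ?thesis by (simp add: coeff_potential_at)
qed

text \<open>A half-strip on which the equation has the form of \<open>exact_WKB_on_half_strip\<close>: \<open>X\<close> inverts
  \<open>z = \<integral> sqrt q0 dx\<close>, \<open>\<sigma>\<close> is the branch of \<open>sqrt q0\<close> in the coordinate \<open>z\<close>, and the two last conditions
  bound \<open>\<sigma>' / \<sigma>\<close> and \<open>q\<^sub>k / q0\<close>.\<close>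

definition wkb_chart :: "complex poly fract poly \<Rightarrow> complex \<Rightarrow> complex \<Rightarrow> real \<Rightarrow> (complex \<Rightarrow> complex) \<Rightarrow> (complex \<Rightarrow> complex) \<Rightarrow> bool"
  where
  "wkb_chart q x0 s0 d X \<sigma> \<longleftrightarrow> 0 < d \<and> X 0 = x0 \<and> \<sigma> 0 = s0 \<and> \<sigma> holomorphic_on half_strip d \<and>
     (\<forall>z\<in>half_strip d. \<sigma> z \<noteq> 0 \<and> (\<sigma> z)\<^sup>2 = rat_eval (coeff q 0) (X z) \<and>
        (X has_field_derivative 1 / \<sigma> z) (at z)) \<and>
     (\<forall>k. (\<lambda>z. rat_eval (coeff q k) (X z)) holomorphic_on half_strip d) \<and>
     (\<exists>C. \<forall>z\<in>half_strip d. norm (deriv \<sigma> z) \<le> C * norm (\<sigma> z)) \<and>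
     (\<forall>k. \<exists>C. \<forall>z\<in>half_strip d. norm (rat_eval (coeff q k) (X z)) \<le> C * norm (rat_eval (coeff q 0) (X z)))"

lemma tameI:
  assumes "f holomorphic_on half_strip d" "\<And>z. z \<in> half_strip d \<Longrightarrow> norm (f z) \<le> C"
  shows "tame d f"
  unfolding tame_def
proof (intro allI impI conjI)
  fix d' assume "d' < d"
  then have "half_strip d' \<subseteq> half_strip d" by (intro half_strip_mono) simp
  then show "f holomorphic_on half_strip d'" "\<exists>M. \<forall>z\<in>half_strip d'. norm (f z) \<le> M"
    using assms by (auto intro: holomorphic_on_subset)
qed

lemma linepath_primitive:
  assumes U: "open U" "convex U" and x0: "x0 \<in> U" and f: "f holomorphic_on U" and x: "x \<in> U"
  shows "((\<lambda>x. contour_integral (linepath x0 x) f) has_field_derivative f x) (at x)"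
    and "f contour_integrable_on linepath x0 x"
proof -
  obtain P where P: "\<And>x. x \<in> U \<Longrightarrow> (P has_field_derivative f x) (at x within U)"
    using holomorphic_convex_primitive' [OF U(2,1) f] by blast
  have I: "(f has_contour_integral (P x - P x0)) (linepath x0 x)" if "x \<in> U" for x
  proof -
    have "closed_segment x0 x \<subseteq> U" using U x0 that by (intro closed_segment_subset) auto
    then show ?thesis using contour_integral_primitive [OF P, of "linepath x0 x"] by simp
  qed
  then show "f contour_integrable_on linepath x0 x" using x by (auto simp: contour_integrable_on_def)
  have "((\<lambda>x. P x - P x0) has_field_derivative f x) (at x)"
    using DERIV_diff [OF P [OF x, unfolded at_within_open [OF x U(1)]] DERIV_const] by simp
  then show "((\<lambda>x. contour_integral (linepath x0 x) f) has_field_derivative f x) (at x)"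
    by (rule has_field_derivative_transform_within_open [OF _ U(1) x])
      (simp add: contour_integral_unique [OF I])
qed

lemma linepath_integral_sep_hol:
  assumes U: "open U" "convex U" and V: "open V" "convex V" and x0: "x0 \<in> U" and UB: "\<And>x. x \<in> U \<Longrightarrow> norm (x - x0) \<le> B"
    and f: "bounded_sep_hol f U V M"
  shows "bounded_sep_hol (\<lambda>x h. contour_integral (linepath x0 x) (\<lambda>t. f t h)) U V (M * B)"
  unfolding bounded_sep_hol_def
proof (intro conjI ballI)
  have hx: "(\<lambda>t. f t h) holomorphic_on U" if "h \<in> V" for h using f that by (auto simp: bounded_sep_hol_def)
  fix h assume h: "h \<in> V"
  show "(\<lambda>x. contour_integral (linepath x0 x) (\<lambda>t. f t h)) holomorphic_on U"
    using linepath_primitive(1) [OF U x0 hx [OF h]] U(1) by (auto simp: holomorphic_on_open)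
next
  fix x assume x: "x \<in> U"
  have seg: "linepath x0 x t \<in> U" if "t \<in> {0..1}" for t
  proof -
    have "linepath x0 x t \<in> closed_segment x0 x" using that by (intro linepath_in_path) auto
    moreover have "closed_segment x0 x \<subseteq> U" using U x0 x by (intro closed_segment_subset) auto
    ultimately show ?thesis by auto
  qed
  have cont: "continuous_on (U \<times> V) (\<lambda>(x, h). f x h)"
    by (rule bounded_sep_hol_continuous [OF f U(1) V(1)])
  have "continuous_on (V \<times> {0..1}) (\<lambda>p. (\<lambda>(x, h). f x h) (linepath x0 x (snd p), fst p))"
  proof (rule continuous_on_compose2 [OF cont])
    show "continuous_on (V \<times> {0..1}) (\<lambda>p. (linepath x0 x (snd p), fst p))"
      unfolding linepath_def by (intro continuous_intros)
  qed (use seg in auto)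
  then have "continuous_on (V \<times> {0..1}) (\<lambda>(h, t). f (linepath x0 x t) h * (x - x0))"
    unfolding case_prod_unfold by (intro continuous_on_mult continuous_on_const) simp
  then have "(\<lambda>h. integral {0..1} ((\<lambda>h t. f (linepath x0 x t) h * (x - x0)) h)) holomorphic_on V"
  proof (rule holomorphic_on_parameter_integral [OF V])
    show "(\<lambda>h. f (linepath x0 x t) h * (x - x0)) holomorphic_on V" if "t \<in> {0..1}" for t
      using f seg [OF that] by (auto simp: bounded_sep_hol_def intro!: holomorphic_intros)
  qed
  then show "(\<lambda>h. contour_integral (linepath x0 x) (\<lambda>t. f t h)) holomorphic_on V"
    by (simp add: contour_integral_integral)
next
  fix x h assume x: "x \<in> U" and h: "h \<in> V"
  have hx: "(\<lambda>t. f t h) holomorphic_on U" using f h by (auto simp: bounded_sep_hol_def)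
  have M: "0 \<le> M" using f x h norm_ge_zero unfolding bounded_sep_hol_def by (meson order_trans)
  have seg: "closed_segment x0 x \<subseteq> U" using U x0 x by (intro closed_segment_subset) auto
  have "norm (contour_integral (linepath x0 x) (\<lambda>t. f t h)) \<le> M * norm (x - x0)"
    by (rule contour_integral_bound_linepath [OF linepath_primitive(2) [OF U x0 hx x] M])
      (use f h seg in \<open>auto simp: bounded_sep_hol_def\<close>)
  also have "\<dots> \<le> M * B" using UB [OF x] M by (rule mult_left_mono)
  finally show "norm (contour_integral (linepath x0 x) (\<lambda>t. f t h)) \<le> M * B" .
qed

text \<open>For \<open>h = rcis r \<theta>\<close> the right-hand side is \<open>cos \<theta>\<close>.\<close>

lemma closed_sector_aperture:
  assumes "- pi / 2 < \<alpha>" "\<beta> < pi / 2"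
  shows "\<exists>c>0. \<forall>h\<in>closed_sector \<alpha> \<beta>. c \<le> norm h * Re (1 / h)"
proof (cases "\<alpha> \<le> \<beta>")
  case False
  then have "closed_sector \<alpha> \<beta> = {}" by (auto simp: closed_sector_def)
  then show ?thesis by (intro exI [of _ 1]) auto
next
  case True
  define c where "c = min (cos \<alpha>) (cos \<beta>)"
  have "0 < c" using assms True by (auto simp: c_def intro!: cos_gt_zero_pi)
  moreover have "c \<le> norm h * Re (1 / h)" if h: "h \<in> closed_sector \<alpha> \<beta>" for h
  proof -
    obtain r \<theta> where r: "0 < r" "\<alpha> \<le> \<theta>" "\<theta> \<le> \<beta>" "h = rcis r \<theta>" using h by (auto simp: closed_sector_def)
    have "norm h * Re (1 / h) = cos \<theta>"
    proof -
      have "norm h = r" "Re h = r * cos \<theta>" using r by auto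
      moreover have "Re (1 / h) = Re h / (norm h)\<^sup>2" by (simp add: Re_divide cmod_power2)
      ultimately show ?thesis using r(1) by (simp add: power2_eq_square)
    qed
    moreover have "c \<le> cos \<theta>"
    proof (cases "0 \<le> \<theta>")
      case True
      then have "cos \<beta> \<le> cos \<theta>" using r assms by (intro cos_monotone_0_pi_le) auto
      then show ?thesis by (simp add: c_def)
    next
      case False
      then have "cos (- \<alpha>) \<le> cos (- \<theta>)" using r assms by (intro cos_monotone_0_pi_le) auto
      then show ?thesis by (simp add: c_def)
    qed
    ultimately show ?thesis by simp
  qed
  ultimately show ?thesis by blast
qed

text \<open>Near the base point the coordinate \<open>z\<close> is a holomorphic function \<open>Z\<close> of \<open>x\<close>, and the solutions on the
  half-strip become \<open>f\<^sub>k = \<sigma> G\<^sub>k\<close> and \<open>W = \<sigma> F\<close> at \<open>Z x\<close>. The derivative of \<open>\<psi>\<close> at the base point is recorded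
  in the form in which the Wronskian of two such solutions can be seen not to vanish.\<close>

theorem exact_WKB_from_chart:
  assumes chart: "wkb_chart q x0 s0 d X \<sigma>" and s0: "s0 \<noteq> 0"
  obtains e r f \<psi> where "0 < e" "0 < r"
    "formal_riccati_solution q (ball x0 e) x0 s0 f"
    "holomorphic2_on \<psi> (ball x0 e \<times> ball (of_real r) r)"
    "\<And>h. h \<in> ball (of_real r) r \<Longrightarrow> (\<lambda>x. \<psi> x h) \<in> schroedinger_solutions q (ball x0 e) h"
    "\<And>h. \<psi> x0 h = 1"
    "\<And>h. h \<in> ball (of_real r) r \<Longrightarrow> \<exists>c. deriv (\<lambda>x. \<psi> x h) x0 = - (s0 * c / h) \<and> 0 < Re c"
    "asymptotic_to_formal_wkb x0 f (ball x0 e) (ball (of_real r) r) \<psi>"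
proof -
  define m where "m = Suc (Suc (degree q))"
  have dm: "degree q < m" "0 < m" by (simp_all add: m_def)
  define R where "R = (\<lambda>k x. rat_eval (coeff q k) x)"
  define p where "p = (\<lambda>z. deriv \<sigma> z / \<sigma> z)"
  define Q where "Q = (\<lambda>k z. if k = 0 then 1 else R k (X z) / (\<sigma> z)\<^sup>2)"
  have d: "0 < d" and X0: "X 0 = x0" and \<sigma>0: "\<sigma> 0 = s0" and \<sigma>h: "\<sigma> holomorphic_on half_strip d"
    using chart by (auto simp: wkb_chart_def)
  have \<sigma>n: "\<sigma> z \<noteq> 0" and \<sigma>2: "(\<sigma> z)\<^sup>2 = R 0 (X z)" and Xd: "(X has_field_derivative 1 / \<sigma> z) (at z)"
    if "z \<in> half_strip d" for z
    using chart that by (auto simp: wkb_chart_def R_def)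
  have Rh: "(\<lambda>z. R k (X z)) holomorphic_on half_strip d" for k
    using chart by (simp add: wkb_chart_def R_def)
  have ptame: "tame d p"
  proof -
    obtain C where "\<forall>z\<in>half_strip d. norm (deriv \<sigma> z) \<le> C * norm (\<sigma> z)"
      using chart by (auto simp: wkb_chart_def)
    then show ?thesis
      unfolding p_def
      by (intro tameI [of _ _ C] holomorphic_on_divide holomorphic_deriv \<sigma>h open_half_strip)
        (auto simp: \<sigma>n norm_divide divide_le_eq)
  qed
  have Qtame: "tame d (Q k)" for k
  proof (cases "k = 0")
    case True
    then show ?thesis by (simp add: Q_def tame_const)
  next
    case False
    obtain C where C: "\<forall>z\<in>half_strip d. norm (R k (X z)) \<le> C * norm (R 0 (X z))"
      using chart unfolding wkb_chart_def R_def by blast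
    have "tame d (\<lambda>z. R k (X z) / (\<sigma> z)\<^sup>2)"
    proof (rule tameI)
      show "(\<lambda>z. R k (X z) / (\<sigma> z)\<^sup>2) holomorphic_on half_strip d"
        using \<sigma>n by (intro holomorphic_intros Rh \<sigma>h) auto
      fix z assume z: "z \<in> half_strip d"
      then have "norm (R k (X z)) \<le> C * norm ((\<sigma> z)\<^sup>2)" using C \<sigma>2 by auto
      then show "norm (R k (X z) / (\<sigma> z)\<^sup>2) \<le> C"
        using \<sigma>n [OF z] by (simp add: norm_divide divide_le_eq)
    qed
    then show ?thesis using False by (simp add: Q_def)
  qed
  have Q0: "Q 0 z = 1" for z by (simp add: Q_def)
  have Qm: "Q k z = 0" if "m \<le> k" for k z
    using that by (auto simp: Q_def R_def m_def coeff_eq_0)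
  have RQ: "R k (X z) = (\<sigma> z)\<^sup>2 * Q k z" if "z \<in> half_strip d" for k z
    using \<sigma>2 [OF that] \<sigma>n [OF that] by (auto simp: Q_def)
  define G where "G = wkb_coeff p Q"
  define H where "H = half_strip (d / 2)"
  have Hd: "H \<subseteq> half_strip d" unfolding H_def using d by (intro half_strip_mono) simp
  obtain r F M where r: "0 < r" and Fb: "bounded_sep_hol F H (ball (of_real r) r) 2"
    and Fd: "\<And>z h. z \<in> H \<Longrightarrow> h \<in> ball (of_real r) r \<Longrightarrow>
      ((\<lambda>z. F z h) has_field_derivative ((F z h)\<^sup>2 - (\<Sum>k<m. Q k z * h ^ k)) / h - p z * F z h) (at z)"
    and FRe: "\<And>z h. z \<in> H \<Longrightarrow> h \<in> ball (of_real r) r \<Longrightarrow> 0 < Re (F z h)"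
    and FM: "\<And>z h. z \<in> H \<Longrightarrow> h \<in> ball (of_real r) r \<Longrightarrow> norm (F z h - 1) \<le> M * norm h"
  proof (rule exact_WKB_on_half_strip [where p = p and Q = Q and m = "degree q", OF d ptame Qtame Q0])
    fix r F M
    assume "0 < r" "bounded_sep_hol F (half_strip (d / 2)) (ball (of_real r) r) 2"
      and "\<And>z h. z \<in> half_strip (d / 2) \<Longrightarrow> h \<in> ball (of_real r) r \<Longrightarrow> ((\<lambda>z. F z h) has_field_derivative
        ((F z h)\<^sup>2 - (\<Sum>k<Suc (Suc (degree q)). Q k z * h ^ k)) / h - p z * F z h) (at z)"
      and "\<And>z h. z \<in> half_strip (d / 2) \<Longrightarrow> h \<in> ball (of_real r) r \<Longrightarrow> 0 < Re (F z h)"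
      and "\<And>z h. z \<in> half_strip (d / 2) \<Longrightarrow> h \<in> ball (of_real r) r \<Longrightarrow> norm (F z h - 1) \<le> M * norm h"
    then show thesis by (intro that [of r F M, unfolded H_def m_def])
  qed
  define V where "V = ball (complex_of_real r) r"
  have V: "open V" "convex V" by (auto simp: V_def)
  have V0: "h \<noteq> 0" if "h \<in> V" for h using tangent_disc(1) that unfolding V_def by blast
  have H0: "0 \<in> H" using d by (simp add: H_def half_strip_def)
  have oH: "open H" unfolding H_def by (rule open_half_strip)
  have XH: "X holomorphic_on half_strip d"
    using Xd by (auto simp: holomorphic_on_open open_half_strip)
  have "deriv X 0 \<noteq> 0" using DERIV_imp_deriv [OF Xd [of 0]] \<sigma>n [of 0] H0 Hd by auto
  then obtain \<rho>1 where \<rho>1: "0 < \<rho>1" "ball 0 \<rho>1 \<subseteq> half_strip d" "inj_on X (ball 0 \<rho>1)"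
    using has_complex_derivative_locally_injective [OF XH _ open_half_strip, of 0] H0 Hd by auto
  obtain \<rho>2 where \<rho>2: "0 < \<rho>2" "cball 0 \<rho>2 \<subseteq> H" using oH H0 open_contains_cball by blast
  define \<rho> where "\<rho> = min \<rho>1 \<rho>2"
  define B where "B = ball (0 :: complex) \<rho>"
  have \<rho>: "0 < \<rho>" using \<rho>1 \<rho>2 by (simp add: \<rho>_def)
  have BH: "B \<subseteq> H" "cball 0 \<rho> \<subseteq> H" using \<rho>2 by (auto simp: B_def \<rho>_def subset_iff)
  have inj: "inj_on X B" by (rule inj_on_subset [OF \<rho>1(3)]) (auto simp: B_def \<rho>_def)
  have XB: "X holomorphic_on B" by (rule holomorphic_on_subset [OF XH]) (use BH Hd in auto)
  obtain Z where Zh: "Z holomorphic_on X ` B" and Zd: "\<And>z. z \<in> B \<Longrightarrow> deriv X z * deriv Z (X z) = 1"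
    and ZX: "\<And>z. z \<in> B \<Longrightarrow> Z (X z) = z"
    using holomorphic_has_inverse [OF XB _ inj] unfolding B_def by blast
  have "open (X ` B)" by (rule open_mapping_thm3 [OF XB _ inj]) (simp add: B_def)
  moreover have "x0 \<in> X ` B" using X0 \<rho> by (force simp: B_def)
  ultimately obtain e where e: "0 < e" "ball x0 e \<subseteq> X ` B" using open_contains_ball by blast
  define U where "U = ball x0 e"
  have U: "open U" "convex U" "x0 \<in> U" using e by (auto simp: U_def)
  have ZU: "Z x \<in> B" "X (Z x) = x" if "x \<in> U" for x
    using that e ZX unfolding U_def by (metis imageE subsetD)+
  have ZH: "Z x \<in> H" if "x \<in> U" for x using ZU(1) [OF that] BH by auto
  have Zs: "Z x \<in> half_strip d" if "x \<in> U" for x using ZH [OF that] Hd by auto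
  have Z0: "Z x0 = 0" using ZX [of 0] X0 \<rho> by (simp add: B_def)
  have ZhU: "Z holomorphic_on U" by (rule holomorphic_on_subset [OF Zh]) (use e U_def in auto)
  have Zder: "(Z has_field_derivative \<sigma> (Z x)) (at x)" if x: "x \<in> U" for x
  proof -
    have dX: "deriv X (Z x) = 1 / \<sigma> (Z x)" by (rule DERIV_imp_deriv [OF Xd [OF Zs [OF x]]])
    have "1 / \<sigma> (Z x) * deriv Z x = 1"
      using Zd [OF ZU(1) [OF x]] unfolding dX ZU(2) [OF x] .
    then have "deriv Z x = \<sigma> (Z x)" using \<sigma>n [OF Zs [OF x]] by (simp add: field_simps)
    then show ?thesis using holomorphic_derivI [OF ZhU U(1) x] by simp
  qed
  have \<sigma>d: "(\<sigma> has_field_derivative p z * \<sigma> z) (at z)" if "z \<in> half_strip d" for z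
    using holomorphic_derivI [OF \<sigma>h open_half_strip that] \<sigma>n [OF that] by (simp add: p_def)
  have \<sigma>Zd: "((\<lambda>x. \<sigma> (Z x)) has_field_derivative p (Z x) * \<sigma> (Z x) * \<sigma> (Z x)) (at x)" if "x \<in> U" for x
    by (rule DERIV_chain2 [OF \<sigma>d [OF Zs [OF that]] Zder [OF that]])
  have \<sigma>Zh: "(\<lambda>x. \<sigma> (Z x)) holomorphic_on U"
    using \<sigma>Zd U(1) by (auto simp: holomorphic_on_open)
  obtain S where S: "0 \<le> S" "\<And>x. x \<in> U \<Longrightarrow> norm (\<sigma> (Z x)) \<le> S"
  proof -
    have "continuous_on (cball 0 \<rho>) \<sigma>"
      using \<sigma>h BH Hd by (intro holomorphic_on_imp_continuous_on) (auto intro: holomorphic_on_subset)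
    then have "compact (\<sigma> ` cball 0 \<rho>)" by (intro compact_continuous_image) auto
    then obtain S where S: "\<forall>y\<in>\<sigma> ` cball 0 \<rho>. norm y \<le> S" using compact_imp_bounded bounded_iff by metis
    have "norm (\<sigma> (Z x)) \<le> max S 0" if "x \<in> U" for x
    proof -
      have "Z x \<in> cball 0 \<rho>" using ZU(1) [OF that] by (simp add: B_def)
      then show ?thesis using S by (auto simp: le_max_iff_disj)
    qed
    then show thesis using that [of "max S 0"] by auto
  qed
  define f where "f = (\<lambda>k x. \<sigma> (Z x) * G k (Z x))"
  have Gd: "(G k has_field_derivative deriv (G k) z) (at z)" if "z \<in> H" for k z
    unfolding G_def
    by (rule holomorphic_derivI [OF tameD(1) [OF tame_wkb_coeff [OF ptame Qtame], of "d / 2"] open_half_strip])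
      (use d that H_def in auto)
  have fd: "(f k has_field_derivative (\<sigma> (Z x))\<^sup>2 * (deriv (G k) (Z x) + p (Z x) * G k (Z x))) (at x)"
    if x: "x \<in> U" for k x
  proof -
    have "((\<lambda>x. G k (Z x)) has_field_derivative deriv (G k) (Z x) * \<sigma> (Z x)) (at x)"
      by (rule DERIV_chain2 [OF Gd [OF ZH [OF x]] Zder [OF x]])
    then show ?thesis unfolding f_def using \<sigma>Zd [OF x]
      by (auto intro!: derivative_eq_intros simp: power2_eq_square algebra_simps)
  qed
  have fh: "f k holomorphic_on U" for k using fd U(1) by (auto simp: holomorphic_on_open)
  have ric: "formal_riccati_solution q U x0 s0 f"
    unfolding formal_riccati_solution_def
  proof (intro conjI allI ballI)
    show "f k holomorphic_on U" for k by (rule fh)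
    show "f 0 x0 = s0" by (simp add: f_def Z0 \<sigma>0 G_def)
    fix x assume x: "x \<in> U"
    show "fps_X * Abs_fps (\<lambda>k. deriv (f k) x) = (Abs_fps (\<lambda>k. f k x))\<^sup>2 - fps_of_poly (potential_at q x)"
    proof (rule fps_ext)
      fix n
      have Rx: "rat_eval (coeff q n) x = (\<sigma> (Z x))\<^sup>2 * Q n (Z x)" for n
        using RQ [OF Zs [OF x], of n] ZU(2) [OF x] by (simp add: R_def)
      have sq: "fps_nth ((Abs_fps (\<lambda>k. f k x))\<^sup>2) n = (\<sigma> (Z x))\<^sup>2 * (\<Sum>i\<le>n. G i (Z x) * G (n - i) (Z x))"
        by (simp add: power2_eq_square fps_mult_nth f_def sum_distrib_left atLeast0AtMost mult_ac)
      show "fps_nth (fps_X * Abs_fps (\<lambda>k. deriv (f k) x)) n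
          = fps_nth ((Abs_fps (\<lambda>k. f k x))\<^sup>2 - fps_of_poly (potential_at q x)) n"
      proof (cases n)
        case 0
        then show ?thesis using Rx [of 0] sq by (simp add: coeff_potential_at Q0 G_def)
      next
        case (Suc j)
        have "deriv (f j) x = (\<sigma> (Z x))\<^sup>2 * (deriv (G j) (Z x) + p (Z x) * G j (Z x))"
          by (rule DERIV_imp_deriv [OF fd [OF x]])
        also have "\<dots> = (\<sigma> (Z x))\<^sup>2 * ((\<Sum>i\<le>n. G i (Z x) * G (n - i) (Z x)) - Q n (Z x))"
          unfolding G_def wkb_coeff_rec Suc ..
        finally show ?thesis
          using Suc sq Rx [of n] by (simp add: coeff_potential_at right_diff_distrib)
      qed
    qed
  qed
  define W where "W = (\<lambda>x h. \<sigma> (Z x) * F (Z x) h)"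
  have Wd: "((\<lambda>x. W x h) has_field_derivative ((W x h)\<^sup>2 - poly (potential_at q x) h) / h) (at x)"
    if x: "x \<in> U" and h: "h \<in> V" for x h
  proof -
    have "((\<lambda>x. F (Z x) h) has_field_derivative
        (((F (Z x) h)\<^sup>2 - (\<Sum>k<m. Q k (Z x) * h ^ k)) / h - p (Z x) * F (Z x) h) * \<sigma> (Z x)) (at x)"
      by (rule DERIV_chain2 [OF Fd [OF ZH [OF x]] Zder [OF x]]) (use h in \<open>simp add: V_def\<close>)
    then have "((\<lambda>x. W x h) has_field_derivative
        (p (Z x) * \<sigma> (Z x) * \<sigma> (Z x)) * F (Z x) h +
        ((((F (Z x) h)\<^sup>2 - (\<Sum>k<m. Q k (Z x) * h ^ k)) / h - p (Z x) * F (Z x) h) * \<sigma> (Z x)) * \<sigma> (Z x)) (at x)"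
      unfolding W_def by (rule DERIV_mult [OF \<sigma>Zd [OF x]])
    also have "(p (Z x) * \<sigma> (Z x) * \<sigma> (Z x)) * F (Z x) h +
        ((((F (Z x) h)\<^sup>2 - (\<Sum>k<m. Q k (Z x) * h ^ k)) / h - p (Z x) * F (Z x) h) * \<sigma> (Z x)) * \<sigma> (Z x)
        = ((W x h)\<^sup>2 - (\<sigma> (Z x))\<^sup>2 * (\<Sum>k<m. Q k (Z x) * h ^ k)) / h"
      using V0 [OF h] by (simp add: W_def field_simps power2_eq_square)
    also have "(\<sigma> (Z x))\<^sup>2 * (\<Sum>k<m. Q k (Z x) * h ^ k) = poly (potential_at q x) h"
      using RQ [OF Zs [OF x]] ZU(2) [OF x]
      by (simp add: poly_potential_at [OF dm(1)] R_def sum_distrib_left mult.assoc)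
    finally show ?thesis .
  qed
  have Wb: "bounded_sep_hol W U V (S * 2)"
    unfolding bounded_sep_hol_def
  proof (intro conjI ballI)
    show "(\<lambda>x. W x h) holomorphic_on U" if "h \<in> V" for h
      using Wd that U(1) by (auto simp: holomorphic_on_open)
    show "W x holomorphic_on V" if "x \<in> U" for x
      unfolding W_def using Fb ZH [OF that] by (auto simp: bounded_sep_hol_def V_def intro!: holomorphic_intros)
    show "norm (W x h) \<le> S * 2" if "x \<in> U" "h \<in> V" for x h
      unfolding W_def norm_mult using Fb ZH [OF that(1)] S that
      by (intro mult_mono) (auto simp: bounded_sep_hol_def V_def)
  qed
  have Wh: "(\<lambda>x. W x h) holomorphic_on U" if "h \<in> V" for h using Wb that by (auto simp: bounded_sep_hol_def)
  define I where "I = (\<lambda>x h. contour_integral (linepath x0 x) (\<lambda>t. W t h))"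
  have Ib: "bounded_sep_hol I U V (S * 2 * e)"
    unfolding I_def using Wb
    by (rule linepath_integral_sep_hol [OF U(1,2) V U(3), rotated]) (simp add: U_def dist_norm norm_minus_commute)
  have Id: "((\<lambda>x. I x h) has_field_derivative W x h) (at x)" if "x \<in> U" "h \<in> V" for x h
    unfolding I_def by (rule linepath_primitive(1) [OF U Wh [OF that(2)] that(1)])
  define \<psi> where "\<psi> = (\<lambda>x h. exp (- (I x h / h)))"
  have \<psi>d: "((\<lambda>x. \<psi> x h) has_field_derivative - (W x h * \<psi> x h / h)) (at x)" if "x \<in> U" "h \<in> V" for x h
    unfolding \<psi>_def using V0 [OF that(2)] by (auto intro!: derivative_eq_intros Id [OF that])
  show thesis
  proof (rule that [OF e(1) r, of f \<psi>]; (unfold U_def [symmetric] V_def [symmetric])?)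
    show "formal_riccati_solution q U x0 s0 f" by (rule ric)
    show "holomorphic2_on \<psi> (U \<times> V)"
    proof (rule holomorphic2_onI [OF U(1) V(1)])
      have "continuous_on (U \<times> V) (\<lambda>(x, h). I x h)"
        by (rule bounded_sep_hol_continuous [OF Ib U(1) V(1)])
      then show "continuous_on (U \<times> V) (\<lambda>(x, h). \<psi> x h)"
        unfolding \<psi>_def case_prod_unfold using V0 by (intro continuous_intros) auto
      show "(\<lambda>x. \<psi> x h) holomorphic_on U" if "h \<in> V" for h
        using \<psi>d that U(1) by (auto simp: holomorphic_on_open)
      show "\<psi> x holomorphic_on V" if "x \<in> U" for x
        unfolding \<psi>_def using Ib that V0 by (auto simp: bounded_sep_hol_def intro!: holomorphic_intros)
    qed
    show "\<psi> x0 h = 1" for h by (simp add: \<psi>_def I_def)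
    fix h assume h: "h \<in> V"
    show "(\<lambda>x. \<psi> x h) \<in> schroedinger_solutions q U h"
      unfolding schroedinger_solutions_def
    proof (intro CollectI conjI ballI)
      show "(\<lambda>x. \<psi> x h) holomorphic_on U" using \<psi>d h U(1) by (auto simp: holomorphic_on_open)
      fix x assume x: "x \<in> U"
      have "((\<lambda>x. - (W x h * \<psi> x h / h)) has_field_derivative
          - ((((W x h)\<^sup>2 - poly (potential_at q x) h) / h * \<psi> x h + - (W x h * \<psi> x h / h) * W x h) / h)) (at x)"
        by (rule DERIV_minus [OF DERIV_cdivide [OF DERIV_mult [OF Wd [OF x h] \<psi>d [OF x h]]]])
      then have "(deriv (\<lambda>x. \<psi> x h) has_field_derivative
          - ((((W x h)\<^sup>2 - poly (potential_at q x) h) / h * \<psi> x h + - (W x h * \<psi> x h / h) * W x h) / h)) (at x)"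
        by (rule has_field_derivative_transform_within_open [OF _ U(1) x])
          (rule DERIV_imp_deriv [OF \<psi>d [OF _ h], symmetric])
      then have "(deriv ^^ 2) (\<lambda>x. \<psi> x h) x =
          - ((((W x h)\<^sup>2 - poly (potential_at q x) h) / h * \<psi> x h + - (W x h * \<psi> x h / h) * W x h) / h)"
        by (simp add: numeral_2_eq_2 DERIV_imp_deriv)
      then show "h\<^sup>2 * (deriv ^^ 2) (\<lambda>x. \<psi> x h) x - poly (potential_at q x) h * \<psi> x h = 0"
        using V0 [OF h] by (simp add: field_simps power2_eq_square)
    qed
    show "\<exists>c. deriv (\<lambda>x. \<psi> x h) x0 = - (s0 * c / h) \<and> 0 < Re c"
    proof (intro exI conjI)
      show "deriv (\<lambda>x. \<psi> x h) x0 = - (s0 * F 0 h / h)"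
        using DERIV_imp_deriv [OF \<psi>d [OF U(3) h]] by (simp add: W_def Z0 \<sigma>0 \<psi>_def I_def)
      show "0 < Re (F 0 h)" using FRe [OF H0] h by (simp add: V_def)
    qed
  next
    show "asymptotic_to_formal_wkb x0 f U V \<psi>"
      unfolding asymptotic_to_formal_wkb_def
    proof
      fix x assume x: "x \<in> U"
      have seg: "closed_segment x0 x \<subseteq> U" using U x by (intro closed_segment_subset) auto
      have fI: "f k contour_integrable_on linepath x0 x" for k
        by (rule linepath_primitive(2) [OF U fh x])
      define a where "a = (\<lambda>k. - contour_integral (linepath x0 x) (f (Suc k)))"
      define A where "A = (\<lambda>h. - (I x h - contour_integral (linepath x0 x) (f 0)) / h)"
      have "poincare_expansion (- pi / 2) (pi / 2) V A (Abs_fps a)"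
        unfolding poincare_expansion_def fps_nth_Abs_fps
      proof (intro allI impI)
        fix \<alpha> \<beta> N assume ab: "- pi / 2 < \<alpha> \<and> \<alpha> \<le> \<beta> \<and> \<beta> < pi / 2"
        obtain c where c: "0 < c" "\<And>h. h \<in> closed_sector \<alpha> \<beta> \<Longrightarrow> c \<le> norm h * Re (1 / h)"
          using closed_sector_aperture ab by blast
        have asy: "\<exists>C \<delta>. 0 < \<delta> \<and> (\<forall>z\<in>H. \<forall>h\<in>V. h \<noteq> 0 \<and> norm h < \<delta> \<and> c \<le> norm h * Re (1 / h) \<longrightarrow>
            norm (F z h - (\<Sum>k\<le>N. G k z * h ^ k)) \<le> C * norm h ^ Suc N)"
          unfolding H_def G_def
        proof (rule WKB_asymptotics_on_half_strip [where M = M and Q = Q and p = p, OF _ ptame Qtame Q0 dm(2) Qm _ _ c(1)])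
          show "d / 2 < d" using d by simp
          fix z h assume z: "z \<in> half_strip (d / 2)" and h: "h \<in> V"
          show "((\<lambda>z. F z h) has_field_derivative ((F z h)\<^sup>2 - (\<Sum>k<m. Q k z * h ^ k)) / h - p z * F z h) (at z)"
            using Fd z h unfolding H_def V_def by blast
          show "norm (F z h - 1) \<le> M * norm h" using FM z h unfolding H_def V_def by blast
        qed
        obtain C \<delta> where \<delta>: "0 < \<delta>" and C: "\<And>z h. z \<in> H \<Longrightarrow> h \<in> V \<Longrightarrow> h \<noteq> 0 \<Longrightarrow> norm h < \<delta> \<Longrightarrow>
            c \<le> norm h * Re (1 / h) \<Longrightarrow> norm (F z h - (\<Sum>k\<le>N. G k z * h ^ k)) \<le> C * norm h ^ Suc N"
          using asy by blast
        have "norm (A h - (\<Sum>k<N. a k * h ^ k)) \<le> S * \<bar>C\<bar> * norm (x - x0) * norm (h ^ N)"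
          if h: "h \<in> V" "h \<in> closed_sector \<alpha> \<beta>" "norm h < \<delta>" for h
        proof -
          have h0: "h \<noteq> 0" using V0 h by blast
          let ?D = "\<lambda>t. W t h - (\<Sum>k\<le>N. f k t * h ^ k)"
          have WI: "(\<lambda>t. W t h) contour_integrable_on linepath x0 x"
            by (rule linepath_primitive(2) [OF U Wh [OF h(1)] x])
          have fkI: "(\<lambda>t. f k t * h ^ k) contour_integrable_on linepath x0 x" for k
            by (rule contour_integrable_rmul [OF fI])
          have SI: "(\<lambda>t. \<Sum>k\<le>N. f k t * h ^ k) contour_integrable_on linepath x0 x"
            by (rule contour_integrable_sum) (auto intro: fkI)
          have "contour_integral (linepath x0 x) ?D
              = I x h - (\<Sum>k\<le>N. contour_integral (linepath x0 x) (f k) * h ^ k)"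
            unfolding I_def using WI SI fkI fI
            by (simp add: contour_integral_diff contour_integral_sum contour_integral_rmul)
          also have "\<dots> = - h * (A h - (\<Sum>k<N. a k * h ^ k))"
            unfolding sum.atMost_shift A_def a_def using h0
            by (simp add: field_simps sum_distrib_left sum_negf)
          finally have eq: "norm (A h - (\<Sum>k<N. a k * h ^ k)) * norm h = norm (contour_integral (linepath x0 x) ?D)"
            by (simp add: norm_mult)
          have "norm (contour_integral (linepath x0 x) ?D) \<le> (S * (\<bar>C\<bar> * norm h ^ Suc N)) * norm (x - x0)"
          proof (rule contour_integral_bound_linepath)
            show "?D contour_integrable_on linepath x0 x" by (rule contour_integrable_diff [OF WI SI])
            show "0 \<le> S * (\<bar>C\<bar> * norm h ^ Suc N)" using S by simp
            fix t assume "t \<in> closed_segment x0 x"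
            then have t: "t \<in> U" using seg by auto
            have "?D t = \<sigma> (Z t) * (F (Z t) h - (\<Sum>k\<le>N. G k (Z t) * h ^ k))"
              by (simp add: W_def f_def right_diff_distrib sum_distrib_left mult.assoc)
            moreover have "norm (F (Z t) h - (\<Sum>k\<le>N. G k (Z t) * h ^ k)) \<le> \<bar>C\<bar> * norm h ^ Suc N"
              by (rule order_trans [OF C [OF ZH [OF t] h(1) h0 h(3) c(2) [OF h(2)]]])
                (intro mult_right_mono, auto)
            ultimately show "norm (?D t) \<le> S * (\<bar>C\<bar> * norm h ^ Suc N)"
              using S(1) S(2) [OF t] by (simp only: norm_mult) (intro mult_mono, auto)
          qed
          then have "norm (A h - (\<Sum>k<N. a k * h ^ k)) * norm h \<le> (S * \<bar>C\<bar> * norm (x - x0) * norm (h ^ N)) * norm h"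
            unfolding eq by (simp add: norm_power mult_ac)
          then show ?thesis using h0 by simp
        qed
        moreover have "\<forall>\<^sub>F h in at 0 within V \<inter> closed_sector \<alpha> \<beta>. h \<in> V \<and> h \<in> closed_sector \<alpha> \<beta> \<and> norm h < \<delta>"
          using \<delta> by (auto simp: eventually_at intro!: exI [of _ \<delta>])
        ultimately show "(\<lambda>h. A h - (\<Sum>k<N. a k * h ^ k)) \<in> O[at 0 within V \<inter> closed_sector \<alpha> \<beta>](\<lambda>h. h ^ N)"
          by (intro bigoI [of _ "S * \<bar>C\<bar> * norm (x - x0)"]) (auto elim!: eventually_mono)
      qed
      then have "poincare_expansion (- pi / 2) (pi / 2) V (\<lambda>h. exp (A h)) (fps_exponential (Abs_fps a))"
        by (rule poincare_expansion_exp)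
      moreover have "exp (A h) = \<psi> x h * exp (1 / h * contour_integral (linepath x0 x) (f 0))" for h
        by (simp add: A_def \<psi>_def exp_add [symmetric] diff_divide_distrib)
      ultimately show "poincare_expansion (- pi / 2) (pi / 2) V
          (\<lambda>h. \<psi> x h * exp (1 / h * contour_integral (linepath x0 x) (f 0))) (formal_wkb_series x0 f x)"
        by (simp add: formal_wkb_series_def a_def)
    qed
  qed
qed

section \<open>Rational functions near their poles\<close>

text \<open>Numerator and denominator in lowest terms have no common zero.\<close>

lemma rat_eval_pole_or_regular:
  "Some x \<notin> rat_poles r \<longleftrightarrow> poly (snd (quot_of_fract r)) x \<noteq> 0"
proof -
  define N where "N = fst (quot_of_fract r)"
  define D where "D = snd (quot_of_fract r)"
  have cop: "coprime N D" unfolding N_def D_def by (rule coprime_quot_of_fract)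
  have D0: "D \<noteq> 0" unfolding D_def by (rule snd_quot_of_fract_nonzero)
  have germ: "rat_germ r (Some x) = (\<lambda>u. poly N (x + u) / poly D (x + u))"
    by (simp add: rat_eval_def N_def D_def)
  show ?thesis
  proof (cases "poly D x = 0")
    case True
    have Nx: "poly N x \<noteq> 0"
    proof
      assume "poly N x = 0"
      then have "[:-x, 1:] dvd N" "[:-x, 1:] dvd D" using True by (simp_all add: poly_eq_0_iff_dvd)
      then have "is_unit [:-x, 1:]" using cop coprime_common_divisor by blast
      then show False by (simp add: is_unit_poly_iff)
    qed
    have "filterlim (\<lambda>u. poly N (x + u) / poly D (x + u)) at_infinity (at 0)"
    proof (rule filterlim_divide_at_infinity)
      show "((\<lambda>u. poly N (x + u)) \<longlongrightarrow> poly N (x + 0)) (at 0)" by (intro tendsto_intros)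
      show "poly N (x + 0) \<noteq> 0" using Nx by simp
      have "\<not> x islimpt {y. poly D y = 0}" by (rule islimpt_finite) (rule poly_roots_finite [OF D0])
      then have "\<forall>\<^sub>F y in at x. poly D y \<noteq> 0" by (simp add: islimpt_iff_eventually)
      then have ne: "\<forall>\<^sub>F u in at 0. poly D (x + u) \<noteq> 0"
        by (subst (asm) at_to_0) (simp add: eventually_filtermap add.commute)
      have "((\<lambda>u. poly D (x + u)) \<longlongrightarrow> poly D (x + 0)) (at 0)" by (intro tendsto_intros)
      then show "filterlim (\<lambda>u. poly D (x + u)) (at 0) (at 0)"
        using ne True by (simp add: filterlim_at)
    qed
    then show ?thesis using True by (simp add: rat_poles_def germ [unfolded N_def D_def] is_pole_def N_def D_def rat_eval_def)
  next
    case False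
    have "((\<lambda>u. poly N (x + u) / poly D (x + u)) \<longlongrightarrow> poly N (x + 0) / poly D (x + 0)) (at 0)"
      using False by (intro tendsto_intros) auto
    then have "\<not> is_pole (rat_germ r (Some x)) 0"
      unfolding germ is_pole_def using not_tendsto_and_filterlim_at_infinity trivial_limit_at by blast
    then show ?thesis using False by (simp add: rat_poles_def D_def)
  qed
qed

text \<open>The value at a finite pole is \<open>0\<close> by convention, so a nonzero value certifies regularity.\<close>

lemma rat_eval_nonzero_regular: "rat_eval r x \<noteq> 0 \<Longrightarrow> Some x \<notin> rat_poles r"
  by (auto simp: rat_eval_pole_or_regular rat_eval_def)

lemma rat_eval_differentiable:
  assumes "Some x \<notin> rat_poles r"
  shows "rat_eval r field_differentiable (at x)"
proof -
  have poly: "(\<lambda>x. poly P x) field_differentiable (at x)" for P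
    unfolding field_differentiable_def using poly_DERIV [of P x] by blast
  have "(\<lambda>x. poly (fst (quot_of_fract r)) x / poly (snd (quot_of_fract r)) x) field_differentiable (at x)"
    by (rule field_differentiable_divide [OF poly poly]) (use assms in \<open>simp add: rat_eval_pole_or_regular\<close>)
  then show ?thesis by (simp add: rat_eval_def [abs_def])
qed

text \<open>A disc about \<open>x1\<close> on which \<open>q0\<close> is nearly constant and dominates all \<open>q\<^sub>k\<close>, and whose radius is at least
  \<open>\<delta>\<close> when measured by the length element \<open>\<bar>sqrt q0\<bar> \<bar>dx\<bar>\<close>. The constants \<open>\<delta>\<close> and \<open>C\<close> will be the same for
  all points of the level curve.\<close>

definition good_disc :: "complex poly fract poly \<Rightarrow> real \<Rightarrow> real \<Rightarrow> complex \<Rightarrow> bool" where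
  "good_disc q \<delta> C x1 \<longleftrightarrow> rat_eval (coeff q 0) x1 \<noteq> 0 \<and>
     (\<exists>\<rho>>0. \<delta>\<^sup>2 \<le> \<rho>\<^sup>2 * norm (rat_eval (coeff q 0) x1) \<and>
       (\<forall>x\<in>ball x1 \<rho>. norm (rat_eval (coeff q 0) x / rat_eval (coeff q 0) x1 - 1) \<le> 1 / 2 \<and>
          (\<forall>k. norm (rat_eval (coeff q k) x) \<le> C * norm (rat_eval (coeff q 0) x))))"

lemma good_disc_mono:
  assumes "good_disc q \<delta> C x" "0 \<le> \<delta>'" "\<delta>' \<le> \<delta>" "C \<le> C'"
  shows "good_disc q \<delta>' C' x"
proof -
  have "\<delta>'\<^sup>2 \<le> \<delta>\<^sup>2" using assms by (intro power_mono) auto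
  moreover have "C * norm y \<le> C' * norm y" for y :: complex using assms by (intro mult_right_mono) auto
  ultimately show ?thesis using assms(1) unfolding good_disc_def by (meson order_trans)
qed

text \<open>Only finitely many coefficients of the potential are nonzero, so one constant suffices for all of them.\<close>

lemma bounded_ratio_all_k:
  fixes g :: "nat \<Rightarrow> 'a \<Rightarrow> complex"
  assumes "\<And>k. \<exists>C. \<forall>\<^sub>F u in F. norm (g k u) \<le> C * norm (g 0 u)" and "\<And>k u. n < k \<Longrightarrow> g k u = 0"
  shows "\<exists>C. \<forall>\<^sub>F u in F. \<forall>k. norm (g k u) \<le> C * norm (g 0 u)"
proof -
  obtain C where C: "\<And>k. \<forall>\<^sub>F u in F. norm (g k u) \<le> C k * norm (g 0 u)" using assms(1) by metis
  define B where "B = (\<Sum>k\<le>n. \<bar>C k\<bar>)"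
  have CB: "C k \<le> B" if "k \<le> n" for k
  proof -
    have "\<bar>C k\<bar> \<le> B" unfolding B_def by (rule member_le_sum) (use that in auto)
    then show ?thesis by simp
  qed
  have B0: "0 \<le> B" by (simp add: B_def sum_nonneg)
  have "\<forall>\<^sub>F u in F. \<forall>k\<in>{..n}. norm (g k u) \<le> C k * norm (g 0 u)"
    using C by (intro eventually_ball_finite) auto
  then have "\<forall>\<^sub>F u in F. \<forall>k. norm (g k u) \<le> B * norm (g 0 u)"
  proof eventually_elim
    case (elim u)
    show ?case
    proof
      fix k
      show "norm (g k u) \<le> B * norm (g 0 u)"
      proof (cases "k \<le> n")
        case True
        have "norm (g k u) \<le> C k * norm (g 0 u)" using elim True by simp
        also have "\<dots> \<le> B * norm (g 0 u)" using CB [OF True] by (rule mult_right_mono) simp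
        finally show ?thesis .
      next
        case False
        then show ?thesis using assms(2) [of k u] B0 by simp
      qed
    qed
  qed
  then show ?thesis by blast
qed

lemma meromorphic_rat_germ: "rat_germ r p meromorphic_on {0}"
proof -
  have poly: "(\<lambda>u. poly P (w u)) meromorphic_on {0}" if "w meromorphic_on {0}" for P and w :: "complex \<Rightarrow> complex"
    unfolding poly_altdef by (intro meromorphic_intros that)
  show ?thesis
  proof (cases p)
    case None
    have "(\<lambda>u. 1 / u :: complex) meromorphic_on {0}" by (intro meromorphic_intros)
    then have "(\<lambda>u. poly (fst (quot_of_fract r)) (1 / u) / poly (snd (quot_of_fract r)) (1 / u)) meromorphic_on {0}"
      by (intro meromorphic_on_divide [OF poly poly])
    then show ?thesis by (simp add: None rat_eval_def)
  next
    case (Some a)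
    have "(\<lambda>u. a + u) meromorphic_on {0}" by (intro meromorphic_intros)
    then have "(\<lambda>u. poly (fst (quot_of_fract r)) (a + u) / poly (snd (quot_of_fract r)) (a + u)) meromorphic_on {0}"
      by (intro meromorphic_on_divide [OF poly poly])
    then show ?thesis by (simp add: Some rat_eval_def)
  qed
qed

lemma rat_germ_factor:
  assumes "\<exists>\<^sub>F u in at 0. rat_germ r p u \<noteq> 0"
  obtains G \<eta> where "0 < \<eta>" "isCont G 0" "G 0 \<noteq> 0"
    "\<And>u. u \<noteq> 0 \<Longrightarrow> norm u < \<eta> \<Longrightarrow> rat_germ r p u = G u * u powi zorder (rat_germ r p) 0"
proof -
  have "isolated_singularity_at (rat_germ r p) 0" "not_essential (rat_germ r p) 0"
    using meromorphic_rat_germ [of r p] by (simp_all add: meromorphic_at_iff)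
  from zorder_exist [OF this assms] obtain \<eta> where \<eta>: "0 < \<eta>" "zor_poly (rat_germ r p) 0 0 \<noteq> 0"
    "zor_poly (rat_germ r p) 0 holomorphic_on cball 0 \<eta>"
    "\<And>w. w \<in> cball 0 \<eta> - {0} \<Longrightarrow> rat_germ r p w = zor_poly (rat_germ r p) 0 w * (w - 0) powi zorder (rat_germ r p) 0"
    by blast
  have "isCont (zor_poly (rat_germ r p) 0) 0"
  proof -
    have "continuous_on (ball 0 \<eta>) (zor_poly (rat_germ r p) 0)"
      using \<eta>(3) by (intro holomorphic_on_imp_continuous_on) (auto intro: holomorphic_on_subset)
    then show ?thesis using \<eta>(1) by (simp add: continuous_on_eq_continuous_at)
  qed
  then show thesis using that [of \<eta> "zor_poly (rat_germ r p) 0"] \<eta>(1,2,4) by auto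
qed

text \<open>A function with a pole of order \<open>m\<close> is nearly constant on a disc about \<open>u1\<close> whose radius is a small
  multiple of \<open>\<bar>u1\<bar>\<close>, with a factor that does not depend on \<open>u1\<close>.\<close>

lemma germ_ratio:
  fixes G :: "complex \<Rightarrow> complex"
  assumes G: "isCont G 0" and G0: "G 0 \<noteq> 0"
  obtains \<eta> \<kappa> where "0 < \<eta>" "0 < \<kappa>" "\<kappa> \<le> 1 / 2"
    "\<And>u. norm u < \<eta> \<Longrightarrow> norm (G 0) / 2 \<le> norm (G u)"
    "\<And>u u1. u1 \<noteq> 0 \<Longrightarrow> norm u1 < \<eta> \<Longrightarrow> norm (u - u1) \<le> \<kappa> * norm u1 \<Longrightarrow>
       norm ((G u * (1 / u) ^ m) / (G u1 * (1 / u1) ^ m) - 1) \<le> 1 / 2"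
proof -
  define A where "A = norm (G 0)"
  have A: "0 < A" using G0 by (simp add: A_def)
  obtain \<eta> where \<eta>: "0 < \<eta>" "\<And>u. norm u < \<eta> \<Longrightarrow> norm (G u - G 0) < A / 20"
    using G A unfolding continuous_at_eps_delta by (metis dist_norm diff_zero zero_less_divide_iff zero_less_numeral)
  have "isCont (\<lambda>v :: complex. (1 / v) ^ m) 1" by (intro continuous_intros) auto
  then obtain \<kappa>1 where \<kappa>1: "0 < \<kappa>1" "\<And>v :: complex. norm (v - 1) < \<kappa>1 \<Longrightarrow> norm ((1 / v) ^ m - (1 / 1) ^ m) < 1 / 4"
    unfolding continuous_at_eps_delta dist_norm by (metis zero_less_divide_1_iff zero_less_numeral)
  define \<kappa> where "\<kappa> = min (1 / 2) (\<kappa>1 / 2)"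
  have \<kappa>: "0 < \<kappa>" "\<kappa> \<le> 1 / 2" "\<kappa> < \<kappa>1" using \<kappa>1(1) by (auto simp: \<kappa>_def)
  show thesis
  proof (rule that [of "\<eta> / 2" \<kappa>])
    show "0 < \<eta> / 2" "0 < \<kappa>" "\<kappa> \<le> 1 / 2" using \<eta> \<kappa> by auto
    show "norm (G 0) / 2 \<le> norm (G u)" if "norm u < \<eta> / 2" for u
    proof -
      have "norm (G u - G 0) < A / 20" using \<eta> that by auto
      moreover have "A - norm (G u) \<le> norm (G u - G 0)"
        using norm_triangle_ineq2 [of "G 0" "G u"] by (simp add: A_def norm_minus_commute)
      ultimately show ?thesis using A unfolding A_def [symmetric] by linarith
    qed
    fix u u1 :: complex
    assume u1: "u1 \<noteq> 0" "norm u1 < \<eta> / 2" and uu: "norm (u - u1) \<le> \<kappa> * norm u1"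
    have "\<kappa> * norm u1 \<le> 1 / 2 * norm u1" using \<kappa> by (intro mult_right_mono) auto
    then have u: "norm u < \<eta>" using uu u1(2) \<eta>(1) norm_triangle_ineq2 [of u u1] by linarith
    have u1\<eta>: "norm u1 < \<eta>" using u1(2) \<eta>(1) by linarith
    have u0: "u \<noteq> 0"
    proof
      assume "u = 0"
      then have "norm u1 \<le> \<kappa> * norm u1" using uu by simp
      moreover have "0 < norm u1" using u1 by simp
      ultimately show False using \<open>\<kappa> * norm u1 \<le> 1 / 2 * norm u1\<close> by linarith
    qed
    define a where "a = G u / G u1"
    define w where "w = (1 / (u / u1)) ^ m"
    have d: "norm (G u - G 0) < A / 20" "norm (G u1 - G 0) < A / 20" using \<eta>(2) u u1\<eta> by blast+
    have g1: "19 / 20 * A \<le> norm (G u1)"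
      using d(2) norm_triangle_ineq2 [of "G 0" "G u1"] by (simp add: A_def norm_minus_commute)
    have "norm (G u - G u1) \<le> A / 10"
      using d norm_triangle_ineq4 [of "G u - G 0" "G u1 - G 0"] by simp
    then have a1: "norm (a - 1) \<le> 1 / 8"
    proof -
      have "G u1 \<noteq> 0" using g1 A by auto
      then have "norm (a - 1) = norm (G u - G u1) / norm (G u1)"
        by (simp add: a_def norm_divide [symmetric] diff_divide_distrib)
      also have "\<dots> \<le> (A / 10) / (19 / 20 * A)"
        using \<open>norm (G u - G u1) \<le> A / 10\<close> g1 A by (intro frac_le) auto
      also have "\<dots> \<le> 1 / 8" using A by simp
      finally show ?thesis .
    qed
    have w1: "norm (w - 1) \<le> 1 / 4"
    proof -
      have "norm (u / u1 - 1) = norm (u - u1) / norm u1" using u1 by (simp add: norm_divide [symmetric] diff_divide_distrib)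
      also have "\<dots> \<le> \<kappa>" using uu u1 by (simp add: divide_le_eq)
      finally have "norm (u / u1 - 1) < \<kappa>1" using \<kappa> by simp
      from \<kappa>1(2) [OF this] show ?thesis by (simp add: w_def)
    qed
    have eq: "(G u * (1 / u) ^ m) / (G u1 * (1 / u1) ^ m) = a * w"
      by (simp add: a_def w_def power_divide)
    have e: "a * w - 1 = (a - 1) * w + (w - 1)" by (simp add: algebra_simps)
    have "norm w \<le> 5 / 4" using w1 norm_triangle_ineq2 [of w 1] by simp
    then have "norm ((a - 1) * w) \<le> 1 / 8 * (5 / 4)"
      unfolding norm_mult using a1 by (intro mult_mono) auto
    then show "norm ((G u * (1 / u) ^ m) / (G u1 * (1 / u1) ^ m) - 1) \<le> 1 / 2"
      unfolding eq e using w1 norm_triangle_ineq [of "(a - 1) * w" "w - 1"] by linarith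
  qed
qed

text \<open>In the local coordinate \<open>u\<close> the comparison of orders bounds \<open>q\<^sub>k / q0\<close>, and an order of at least two
  bounds \<open>1 / sqrt q0\<close> by a multiple of \<open>\<bar>u\<bar>\<close>.\<close>

lemma pole_germ_estimates:
  assumes p: "p \<in> rat_poles (coeff q 0)"
    and ord0: "2 \<le> pole_order (coeff q 0) p"
    and ordk: "\<And>k. pole_order (coeff q k) p \<le> pole_order (coeff q 0) p"
  obtains \<eta> \<kappa> c C where "0 < \<eta>" "0 < \<kappa>" "\<kappa> \<le> 1 / 2" "0 < c"
    "\<And>u. u \<noteq> 0 \<Longrightarrow> norm u < \<eta> \<Longrightarrow> c \<le> norm (rat_germ (coeff q 0) p u) * (norm u)\<^sup>2"
    "\<And>u. u \<noteq> 0 \<Longrightarrow> norm u < \<eta> \<Longrightarrow> \<forall>k. norm (rat_germ (coeff q k) p u) \<le> C * norm (rat_germ (coeff q 0) p u)"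
    "\<And>u u1. u1 \<noteq> 0 \<Longrightarrow> norm u1 < \<eta> \<Longrightarrow> norm (u - u1) \<le> \<kappa> * norm u1 \<Longrightarrow>
       norm (rat_germ (coeff q 0) p u / rat_germ (coeff q 0) p u1 - 1) \<le> 1 / 2"
proof -
  define g where "g = (\<lambda>k. rat_germ (coeff q k) p)"
  have pole: "is_pole (g 0) 0" using p by (simp add: rat_poles_def g_def)
  have ev0: "\<forall>\<^sub>F u in at 0. g 0 u \<noteq> 0" by (rule non_zero_neighbour_pole [OF pole])
  have fr0: "\<exists>\<^sub>F u in at 0. g 0 u \<noteq> 0" using ev0 by (intro eventually_frequently) auto
  have q0: "coeff q 0 \<noteq> 0"
  proof
    assume "coeff q 0 = 0"
    then have "g 0 = (\<lambda>u. 0)" unfolding g_def by (cases p) (auto simp: rat_eval_def)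
    then show False using ev0 by simp
  qed
  define m where "m = nat (- zorder (g 0) 0)"
  have m: "2 \<le> m" "zorder (g 0) 0 = - int m"
    using ord0 q0 by (auto simp: pole_order_def m_def g_def)
  obtain G \<eta>1 where G: "0 < \<eta>1" "isCont G 0" "G 0 \<noteq> 0"
    and Gf: "\<And>u. u \<noteq> 0 \<Longrightarrow> norm u < \<eta>1 \<Longrightarrow> g 0 u = G u * u powi zorder (g 0) 0"
    using rat_germ_factor [OF fr0 [unfolded g_def]] unfolding g_def by blast
  have Gm: "g 0 u = G u * (1 / u) ^ m" if "u \<noteq> 0" "norm u < \<eta>1" for u
    using Gf [OF that] by (simp add: m(2) power_int_minus power_one_over inverse_eq_divide)
  obtain \<eta>2 \<kappa> where \<eta>2: "0 < \<eta>2" "0 < \<kappa>" "\<kappa> \<le> 1 / 2"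
    and G2: "\<And>u. norm u < \<eta>2 \<Longrightarrow> norm (G 0) / 2 \<le> norm (G u)"
    and rat: "\<And>u u1. u1 \<noteq> 0 \<Longrightarrow> norm u1 < \<eta>2 \<Longrightarrow> norm (u - u1) \<le> \<kappa> * norm u1 \<Longrightarrow>
       norm ((G u * (1 / u) ^ m) / (G u1 * (1 / u1) ^ m) - 1) \<le> 1 / 2"
    using germ_ratio [OF G(2,3), of m] by blast
  have ratio: "\<exists>C. \<forall>\<^sub>F u in at 0. norm (g k u) \<le> C * norm (g 0 u)" for k
  proof (cases "\<exists>\<^sub>F u in at 0. g k u \<noteq> 0")
    case False
    then have "\<forall>\<^sub>F u in at 0. g k u = 0" by (simp add: frequently_def)
    then show ?thesis by (intro exI [of _ 0]) (auto elim!: eventually_mono)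
  next
    case True
    have qk: "coeff q k \<noteq> 0"
    proof
      assume "coeff q k = 0"
      then have "g k = (\<lambda>u. 0)" unfolding g_def by (cases p) (auto simp: rat_eval_def)
      then show False using True by simp
    qed
    define n where "n = zorder (g k) 0"
    have n: "- int m \<le> n" using ordk [of k] qk q0 m(2) by (simp add: pole_order_def n_def g_def)
    obtain Gk \<eta>k where Gk: "0 < \<eta>k" "isCont Gk 0"
      and Gkf: "\<And>u. u \<noteq> 0 \<Longrightarrow> norm u < \<eta>k \<Longrightarrow> g k u = Gk u * u powi n"
      using rat_germ_factor [OF True [unfolded g_def]] unfolding g_def n_def by blast
    have "(Gk \<longlongrightarrow> Gk 0) (at 0)" using Gk(2) by (simp add: isCont_def)
    from order_tendstoD(2) [OF tendsto_norm [OF this], of "norm (Gk 0) + 1"]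
    have ev1: "\<forall>\<^sub>F u in at 0. norm (Gk u) < norm (Gk 0) + 1" by simp
    have ev2: "\<forall>\<^sub>F u in at 0. u \<noteq> 0 \<and> norm u < min (min \<eta>k \<eta>1) (min \<eta>2 1)"
      using Gk(1) G(1) \<eta>2(1) by (auto simp: eventually_at intro!: exI [of _ "min (min \<eta>k \<eta>1) (min \<eta>2 1)"])
    define B where "B = (norm (Gk 0) + 1) / (norm (G 0) / 2)"
    have "\<forall>\<^sub>F u in at 0. norm (g k u) \<le> B * norm (g 0 u)"
      using ev1 ev2
    proof eventually_elim
      case (elim u)
      have u: "u \<noteq> 0" "norm u < \<eta>k" "norm u < \<eta>1" "norm u < \<eta>2" "norm u < 1" using elim by auto
      have "norm (u powi n) \<le> norm (u powi (- int m))"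
        unfolding norm_power_int using n u by (intro power_int_decreasing) auto
      then have le: "norm (g k u) \<le> (norm (Gk 0) + 1) * norm (u powi (- int m))"
        unfolding Gkf [OF u(1,2)] norm_mult using elim by (intro mult_mono) auto
      have Gu: "0 < norm (G 0) / 2" "norm (G 0) / 2 \<le> norm (G u)" using G2 [OF u(4)] G(3) by auto
      have "norm (u powi (- int m)) = norm (g 0 u) / norm (G u)"
        using Gf [OF u(1,3)] Gu by (auto simp: m(2) norm_mult)
      also have "norm (g 0 u) / norm (G u) \<le> norm (g 0 u) / (norm (G 0) / 2)"
        by (intro divide_left_mono mult_pos_pos) (use Gu in \<open>linarith | simp\<close>)+
      finally have "(norm (Gk 0) + 1) * norm (u powi (- int m)) \<le> (norm (Gk 0) + 1) * (norm (g 0 u) / (norm (G 0) / 2))"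
        by (rule mult_left_mono) simp
      also have "\<dots> = B * norm (g 0 u)" by (simp add: B_def)
      finally show ?case using le by simp
    qed
    then show ?thesis by blast
  qed
  have "g k u = 0" if "degree q < k" for k u
    using that unfolding g_def by (cases p) (auto simp: rat_eval_def coeff_eq_0)
  from bounded_ratio_all_k [of g, OF ratio this]
  obtain C where C: "\<forall>\<^sub>F u in at 0. \<forall>k. norm (g k u) \<le> C * norm (g 0 u)" by blast
  then obtain \<eta>3 where \<eta>3: "0 < \<eta>3" "\<And>u. u \<noteq> 0 \<Longrightarrow> norm u < \<eta>3 \<Longrightarrow> \<forall>k. norm (g k u) \<le> C * norm (g 0 u)"
    unfolding eventually_at by auto
  define \<eta> where "\<eta> = min (min (\<eta>1 / 2) \<eta>2) (min \<eta>3 1)"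
  have \<eta>: "0 < \<eta>" "\<eta> \<le> \<eta>1 / 2" "\<eta> \<le> \<eta>2" "\<eta> \<le> \<eta>3" "\<eta> \<le> 1" using G(1) \<eta>2 \<eta>3 by (auto simp: \<eta>_def)
  have gk: "rat_germ (coeff q k) p = g k" for k by (simp add: g_def)
  show thesis
  proof (rule that [OF \<eta>(1) \<eta>2(2,3), of "norm (G 0) / 2" C]; (unfold gk)?)
    show "0 < norm (G 0) / 2" using G by simp
    show "\<forall>k. norm (g k u) \<le> C * norm (g 0 u)" if "u \<noteq> 0" "norm u < \<eta>" for u
      using \<eta>3 that \<eta> by auto
    show "norm (G 0) / 2 \<le> norm (g 0 u) * (norm u)\<^sup>2" if u: "u \<noteq> 0" "norm u < \<eta>" for u
    proof -
      have "norm u ^ m \<le> norm u ^ 2" using m u \<eta> by (intro power_decreasing) auto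
      then have "1 \<le> (norm u)\<^sup>2 / norm u ^ m" using u by simp
      then have "norm (G u) * 1 \<le> norm (G u) * ((norm u)\<^sup>2 / norm u ^ m)" by (intro mult_left_mono) auto
      moreover have "norm (g 0 u) = norm (G u) / norm u ^ m"
        using u \<eta> Gm [of u] by (simp add: norm_mult norm_power norm_divide power_one_over)
      ultimately have "norm (G u) \<le> norm (g 0 u) * (norm u)\<^sup>2" by simp
      moreover have "norm (G 0) / 2 \<le> norm (G u)" using G2 [of u] u \<eta> by linarith
      ultimately show ?thesis by linarith
    qed
    fix u u1 :: complex
    assume u1: "u1 \<noteq> 0" "norm u1 < \<eta>" and uu: "norm (u - u1) \<le> \<kappa> * norm u1"
    have "\<kappa> * norm u1 \<le> 1 / 2 * norm u1" using \<eta>2 by (intro mult_right_mono) auto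
    moreover have "0 < norm u1" using u1 by simp
    ultimately have "norm u < \<eta>1" "0 < norm u"
      using uu u1(2) \<eta>(1,2) norm_triangle_ineq2 [of u u1] norm_triangle_ineq3 [of u u1] by linarith+
    then have u: "norm u < \<eta>1" "u \<noteq> 0" by auto
    show "norm (g 0 u / g 0 u1 - 1) \<le> 1 / 2"
      using rat [OF u1(1) _ uu] Gm [OF u(2,1)] Gm [OF u1(1)] u1 \<eta> by simp
  qed
qed

lemma good_disc_near_finite_pole:
  assumes p: "Some a \<in> rat_poles (coeff q 0)"
    and ord0: "2 \<le> pole_order (coeff q 0) (Some a)"
    and ordk: "\<And>k. pole_order (coeff q k) (Some a) \<le> pole_order (coeff q 0) (Some a)"
  obtains \<eta> \<delta> C c where "0 < \<eta>" "0 < \<delta>" "0 < c"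
    "\<And>x. x \<noteq> a \<Longrightarrow> norm (x - a) < \<eta> \<Longrightarrow>
      good_disc q \<delta> C x \<and> c \<le> norm (rat_eval (coeff q 0) x) * (norm (x - a))\<^sup>2"
proof -
  obtain \<eta> \<kappa> c C where \<eta>: "0 < \<eta>" "0 < \<kappa>" "\<kappa> \<le> 1 / 2" "0 < c"
    and c: "\<And>u. u \<noteq> 0 \<Longrightarrow> norm u < \<eta> \<Longrightarrow> c \<le> norm (rat_eval (coeff q 0) (a + u)) * (norm u)\<^sup>2"
    and C: "\<And>u. u \<noteq> 0 \<Longrightarrow> norm u < \<eta> \<Longrightarrow>
       \<forall>k. norm (rat_eval (coeff q k) (a + u)) \<le> C * norm (rat_eval (coeff q 0) (a + u))"
    and rat: "\<And>u u1. u1 \<noteq> 0 \<Longrightarrow> norm u1 < \<eta> \<Longrightarrow> norm (u - u1) \<le> \<kappa> * norm u1 \<Longrightarrow>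
       norm (rat_eval (coeff q 0) (a + u) / rat_eval (coeff q 0) (a + u1) - 1) \<le> 1 / 2"
    using pole_germ_estimates [OF p ord0 ordk] unfolding rat_germ.simps by blast
  show thesis
  proof (rule that [of "\<eta> / 2" "\<kappa> * sqrt c" c C])
    show "0 < \<eta> / 2" "0 < \<kappa> * sqrt c" "0 < c" using \<eta> by auto
    fix x assume x: "x \<noteq> a" "norm (x - a) < \<eta> / 2"
    define u1 where "u1 = x - a"
    have u1: "u1 \<noteq> 0" "norm u1 < \<eta> / 2" "norm u1 < \<eta>" "x = a + u1"
      using x \<eta>(1) by (auto simp: u1_def)
    have c1: "c \<le> norm (rat_eval (coeff q 0) x) * (norm u1)\<^sup>2" using c [OF u1(1,3)] u1 by simp
    have "good_disc q (\<kappa> * sqrt c) C x"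
      unfolding good_disc_def
    proof (intro conjI exI [of _ "\<kappa> * norm u1"] ballI)
      show "rat_eval (coeff q 0) x \<noteq> 0" using c1 \<eta>(4) by auto
      show "0 < \<kappa> * norm u1" using \<eta> u1 by simp
      have "\<kappa>\<^sup>2 * c \<le> \<kappa>\<^sup>2 * (norm (rat_eval (coeff q 0) x) * (norm u1)\<^sup>2)"
        using c1 by (intro mult_left_mono) auto
      then show "(\<kappa> * sqrt c)\<^sup>2 \<le> (\<kappa> * norm u1)\<^sup>2 * norm (rat_eval (coeff q 0) x)"
        using \<eta>(4) by (simp add: power_mult_distrib mult_ac)
      fix y assume y: "y \<in> ball x (\<kappa> * norm u1)"
      define u where "u = y - a"
      have uu: "norm (u - u1) < \<kappa> * norm u1"
        using y by (simp add: u_def u1_def dist_norm norm_minus_commute)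
      then show "norm (rat_eval (coeff q 0) y / rat_eval (coeff q 0) x - 1) \<le> 1 / 2"
        using rat [OF u1(1,3), of u] by (simp add: u_def u1(4))
      have "\<kappa> * norm u1 \<le> 1 / 2 * norm u1" using \<eta> by (intro mult_right_mono) auto
      moreover have "0 < norm u1" using u1 by simp
      ultimately have "norm u < \<eta>" "0 < norm u"
        using uu u1(2) norm_triangle_ineq2 [of u u1] norm_triangle_ineq3 [of u u1] by linarith+
      then show "\<forall>k. norm (rat_eval (coeff q k) y) \<le> C * norm (rat_eval (coeff q 0) y)"
        using C [of u] by (simp add: u_def)
    qed
    then show "good_disc q (\<kappa> * sqrt c) C x \<and> c \<le> norm (rat_eval (coeff q 0) x) * (norm (x - a))\<^sup>2"
      using c1 by (simp add: u1_def)
  qed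
qed

text \<open>In the coordinate \<open>u = 1 / x\<close> a disc about \<open>x\<close> with radius proportional to \<open>\<bar>x\<bar>\<close> becomes a region whose
  diameter is proportional to \<open>\<bar>u\<bar>\<close>.\<close>

lemma good_disc_near_infinity:
  assumes p: "None \<in> rat_poles (coeff q 0)"
    and ord0: "2 \<le> pole_order (coeff q 0) None"
    and ordk: "\<And>k. pole_order (coeff q k) None \<le> pole_order (coeff q 0) None"
  obtains R \<delta> C c where "0 < R" "0 < \<delta>" "0 < c"
    "\<And>x. R < norm x \<Longrightarrow>
      good_disc q \<delta> C x \<and> c * (norm x)\<^sup>2 \<le> norm (rat_eval (coeff q 0) x)"
proof -
  obtain \<eta> \<kappa> c C where \<eta>: "0 < \<eta>" "0 < \<kappa>" "\<kappa> \<le> 1 / 2" "0 < c"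
    and c: "\<And>u. u \<noteq> 0 \<Longrightarrow> norm u < \<eta> \<Longrightarrow> c \<le> norm (rat_eval (coeff q 0) (1 / u)) * (norm u)\<^sup>2"
    and C: "\<And>u. u \<noteq> 0 \<Longrightarrow> norm u < \<eta> \<Longrightarrow>
       \<forall>k. norm (rat_eval (coeff q k) (1 / u)) \<le> C * norm (rat_eval (coeff q 0) (1 / u))"
    and rat: "\<And>u u1. u1 \<noteq> 0 \<Longrightarrow> norm u1 < \<eta> \<Longrightarrow> norm (u - u1) \<le> \<kappa> * norm u1 \<Longrightarrow>
       norm (rat_eval (coeff q 0) (1 / u) / rat_eval (coeff q 0) (1 / u1) - 1) \<le> 1 / 2"
    using pole_germ_estimates [OF p ord0 ordk] unfolding rat_germ.simps by blast
  show thesis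
  proof (rule that [of "max (2 / \<eta>) 1" "\<kappa> / 2 * sqrt c" c C])
    show "0 < max (2 / \<eta>) 1" "0 < \<kappa> / 2 * sqrt c" "0 < c" using \<eta> by auto
    fix x :: complex assume "max (2 / \<eta>) 1 < norm x"
    then have x: "2 / \<eta> < norm x" and x1: "1 \<le> norm x" by auto
    have x0: "0 < norm x" using x \<eta>(1) by (meson divide_pos_pos order_less_trans zero_less_numeral)
    define u1 where "u1 = 1 / x"
    have u1: "u1 \<noteq> 0" "norm u1 < \<eta> / 2" "norm u1 < \<eta>" "x = 1 / u1" "norm u1 = 1 / norm x"
      using x x0 \<eta>(1) by (auto simp: u1_def norm_divide field_simps)
    have c1: "c * (norm x)\<^sup>2 \<le> norm (rat_eval (coeff q 0) x)"
    proof -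
      have "c \<le> norm (rat_eval (coeff q 0) x) * (1 / norm x)\<^sup>2"
        using c [OF u1(1,3)] u1(4,5) by simp
      then show ?thesis using x0 by (simp add: power_divide field_simps)
    qed
    have "good_disc q (\<kappa> / 2 * sqrt c) C x"
      unfolding good_disc_def
    proof (intro conjI exI [of _ "\<kappa> / 2 * norm x"] ballI)
      have "0 < c * (norm x)\<^sup>2" using \<eta> x0 by simp
      then show "rat_eval (coeff q 0) x \<noteq> 0" using c1 by auto
      show "0 < \<kappa> / 2 * norm x" using \<eta> x0 by simp
      have "1 \<le> (norm x)\<^sup>2" using x1 by (simp add: one_le_power)
      then have "c * 1 \<le> c * (norm x)\<^sup>2" using \<eta> by (intro mult_left_mono) auto
      then have "c \<le> norm (rat_eval (coeff q 0) x)" using c1 by simp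
      then have "(\<kappa> / 2)\<^sup>2 * (1 * c) \<le> (\<kappa> / 2)\<^sup>2 * ((norm x)\<^sup>2 * norm (rat_eval (coeff q 0) x))"
        using \<open>1 \<le> (norm x)\<^sup>2\<close> \<eta>(4) by (intro mult_left_mono mult_mono) auto
      moreover have "(\<kappa> / 2 * sqrt c)\<^sup>2 = (\<kappa> / 2)\<^sup>2 * (1 * c)"
        using \<eta>(4) by (simp only: power_mult_distrib) simp
      moreover have "(\<kappa> / 2 * norm x)\<^sup>2 = (\<kappa> / 2)\<^sup>2 * (norm x)\<^sup>2" by (rule power_mult_distrib)
      ultimately show "(\<kappa> / 2 * sqrt c)\<^sup>2 \<le> (\<kappa> / 2 * norm x)\<^sup>2 * norm (rat_eval (coeff q 0) x)"
        by (simp only: mult.assoc)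
      fix y assume y: "y \<in> ball x (\<kappa> / 2 * norm x)"
      have yx: "norm (x - y) < \<kappa> / 2 * norm x" using y by (simp add: dist_norm)
      have "\<kappa> / 2 * norm x \<le> 1 / 4 * norm x" using \<eta> by (intro mult_right_mono) auto
      then have ny: "norm x / 2 \<le> norm y" "0 < norm y"
        using yx x0 norm_triangle_ineq2 [of x y] by linarith+
      define u where "u = 1 / y"
      have u: "u \<noteq> 0" "y = 1 / u" using ny by (auto simp: u_def)
      have "u - u1 = (x - y) / (x * y)" using x0 ny by (simp add: u_def u1_def field_simps)
      then have "norm (u - u1) = norm (x - y) / (norm x * norm y)" by (simp add: norm_divide norm_mult)
      also have "\<dots> \<le> (\<kappa> / 2 * norm x) / (norm x * (norm x / 2))"
        using yx ny x0 \<eta>(2) by (intro frac_le mult_left_mono) auto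
      also have "\<dots> = \<kappa> * norm u1" using x0 by (simp add: u1(5))
      finally have uu: "norm (u - u1) \<le> \<kappa> * norm u1" .
      then show "norm (rat_eval (coeff q 0) y / rat_eval (coeff q 0) x - 1) \<le> 1 / 2"
        using rat [OF u1(1,3), of u] unfolding u(2) u1(4) by simp
      have "norm u = 1 / norm y" by (simp add: u_def norm_divide)
      also have "\<dots> \<le> 1 / (norm x / 2)" using ny x0 by (intro divide_left_mono) auto
      also have "\<dots> < \<eta>" using x x0 \<eta>(1) by (simp add: field_simps)
      finally show "\<forall>k. norm (rat_eval (coeff q k) y) \<le> C * norm (rat_eval (coeff q 0) y)"
        using C [OF u(1)] unfolding u(2) by blast
    qed
    then show "good_disc q (\<kappa> / 2 * sqrt c) C x \<and> c * (norm x)\<^sup>2 \<le> norm (rat_eval (coeff q 0) x)"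
      using c1 by simp
  qed
qed

lemma good_disc_near_regular:
  assumes x0: "rat_eval (coeff q 0) x0 \<noteq> 0"
    and poles: "\<And>k. rat_poles (coeff q k) \<subseteq> rat_poles (coeff q 0)"
  obtains \<epsilon> \<delta> C where "0 < \<epsilon>" "0 < \<delta>" "\<And>x. x \<in> ball x0 \<epsilon> \<Longrightarrow> good_disc q \<delta> C x"
proof -
  define g where "g = (\<lambda>k. rat_eval (coeff q k))"
  define A where "A = norm (g 0 x0)"
  have A: "0 < A" using x0 by (simp add: A_def g_def)
  have reg: "Some x0 \<notin> rat_poles (coeff q k)" for k
    using rat_eval_nonzero_regular [OF x0] poles by auto
  have cont: "isCont (g k) x0" for k
    using rat_eval_differentiable [OF reg [of k]] unfolding g_def
    by (rule field_differentiable_imp_continuous_at)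
  have tend: "(g k \<longlongrightarrow> g k x0) (nhds x0)" for k
    using cont [of k] by (simp add: isCont_def tendsto_at_iff_tendsto_nhds)
  have ev0: "\<forall>\<^sub>F x in nhds x0. norm (g 0 x - g 0 x0) < A / 8"
    using tendstoD [OF tend [of 0], of "A / 8"] A by (simp add: dist_norm)
  have "\<exists>C. \<forall>\<^sub>F x in nhds x0. norm (g k x) \<le> C * norm (g 0 x)" for k
  proof -
    have "\<forall>\<^sub>F x in nhds x0. norm (g k x) < norm (g k x0) + 1"
      using order_tendstoD(2) [OF tendsto_norm [OF tend [of k]], of "norm (g k x0) + 1"] by simp
    with ev0 have "\<forall>\<^sub>F x in nhds x0. norm (g k x) \<le> ((norm (g k x0) + 1) / (A / 2)) * norm (g 0 x)"
    proof eventually_elim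
      case (elim x)
      have "A / 2 \<le> norm (g 0 x)"
      proof -
        have "A - norm (g 0 x) \<le> norm (g 0 x - g 0 x0)"
          using norm_triangle_ineq2 [of "g 0 x0" "g 0 x"] by (simp add: A_def norm_minus_commute)
        then show ?thesis using elim(1) A by linarith
      qed
      then have "(norm (g k x0) + 1) / (A / 2) * (A / 2) \<le> ((norm (g k x0) + 1) / (A / 2)) * norm (g 0 x)"
        using A by (intro mult_left_mono) auto
      then show ?case using elim(2) A by simp
    qed
    then show ?thesis by blast
  qed
  moreover have "g k x = 0" if "degree q < k" for k x
    using that by (simp add: g_def coeff_eq_0 rat_eval_def)
  ultimately obtain C where "\<forall>\<^sub>F x in nhds x0. \<forall>k. norm (g k x) \<le> C * norm (g 0 x)"
    using bounded_ratio_all_k [of g "nhds x0" "degree q"] by blast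
  with ev0 have "\<forall>\<^sub>F x in nhds x0. norm (g 0 x - g 0 x0) < A / 8 \<and> (\<forall>k. norm (g k x) \<le> C * norm (g 0 x))"
    by (rule eventually_conj)
  then obtain \<epsilon> where \<epsilon>: "0 < \<epsilon>" "\<And>x. dist x x0 < \<epsilon> \<Longrightarrow>
      norm (g 0 x - g 0 x0) < A / 8 \<and> (\<forall>k. norm (g k x) \<le> C * norm (g 0 x))"
    unfolding eventually_nhds_metric by blast
  show thesis
  proof (rule that [of "\<epsilon> / 2" "\<epsilon> / 2 * sqrt (A / 2)" C])
    show "0 < \<epsilon> / 2" "0 < \<epsilon> / 2 * sqrt (A / 2)" using \<epsilon> A by auto
    fix x assume x: "x \<in> ball x0 (\<epsilon> / 2)"
    have x1: "norm (g 0 x - g 0 x0) < A / 8" using \<epsilon> x by (auto simp: dist_commute)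
    have "A - norm (g 0 x) \<le> norm (g 0 x - g 0 x0)"
      using norm_triangle_ineq2 [of "g 0 x0" "g 0 x"] by (simp add: A_def norm_minus_commute)
    then have gx: "A * (7 / 8) \<le> norm (g 0 x)" using x1 by linarith
    show "good_disc q (\<epsilon> / 2 * sqrt (A / 2)) C x"
      unfolding good_disc_def g_def [THEN fun_cong, symmetric]
    proof (intro conjI exI [of _ "\<epsilon> / 2"] ballI)
      show "g 0 x \<noteq> 0" using gx A by auto
      show "0 < \<epsilon> / 2" using \<epsilon> by simp
      have "(\<epsilon> / 2)\<^sup>2 * (A / 2) \<le> (\<epsilon> / 2)\<^sup>2 * norm (g 0 x)"
        using gx A by (intro mult_left_mono) auto
      then show "(\<epsilon> / 2 * sqrt (A / 2))\<^sup>2 \<le> (\<epsilon> / 2)\<^sup>2 * norm (g 0 x)"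
        using A by (simp only: power_mult_distrib) simp
      fix y assume y: "y \<in> ball x (\<epsilon> / 2)"
      have yd: "dist y x0 < \<epsilon>" using x y dist_triangle [of y x0 x] by (auto simp: dist_commute)
      show "\<forall>k. norm (g k y) \<le> C * norm (g 0 y)" using \<epsilon>(2) [OF yd] by blast
      have "norm (g 0 y - g 0 x) \<le> A / 4"
        using \<epsilon>(2) [OF yd] x1 norm_triangle_ineq4 [of "g 0 y - g 0 x0" "g 0 x - g 0 x0"] by simp
      then have "norm (g 0 y - g 0 x) / norm (g 0 x) \<le> (A / 4) / (A * (7 / 8))"
        using gx A by (intro frac_le) auto
      also have "\<dots> \<le> 1 / 2" using A by simp
      finally show "norm (g 0 y / g 0 x - 1) \<le> 1 / 2"
        using \<open>g 0 x \<noteq> 0\<close> by (simp add: norm_divide [symmetric] diff_divide_distrib)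
    qed
  qed
qed

section \<open>The strip around a curve\<close>

text \<open>On a good disc the branch \<open>b\<close> of \<open>sqrt q0\<close> stays within \<open>\<bar>s1\<bar> / 2\<close> of \<open>s1\<close>, hence its primitive \<open>Z\<close>
  is injective and its image contains a disc of radius \<open>\<delta> / 4\<close>. The last conclusion is the uniqueness of
  solutions of \<open>c' = 1 / sqrt q0\<close>: in the coordinate \<open>Z\<close> such a curve is a translation.\<close>

lemma good_disc_chart:
  assumes good: "good_disc q \<delta> C x1" and \<delta>: "0 < \<delta>" and s1: "s1\<^sup>2 = rat_eval (coeff q 0) x1"
  obtains X \<sigma> where "X holomorphic_on ball 0 (\<delta> / 4)" "\<sigma> holomorphic_on ball 0 (\<delta> / 4)"
    "X 0 = x1" "\<sigma> 0 = s1"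
    "\<And>w. w \<in> ball 0 (\<delta> / 4) \<Longrightarrow> (X has_field_derivative 1 / \<sigma> w) (at w) \<and>
       (\<sigma> w)\<^sup>2 = rat_eval (coeff q 0) (X w) \<and> norm (\<sigma> w - s1) \<le> norm s1 / 2 \<and>
       (\<forall>k. norm (rat_eval (coeff q k) (X w)) \<le> C * norm (rat_eval (coeff q 0) (X w)))"
    "\<And>(c :: real \<Rightarrow> complex) v t. c t = x1 \<Longrightarrow> v t = s1 \<Longrightarrow> continuous_on UNIV v \<Longrightarrow>
       (\<And>\<tau>. (v \<tau>)\<^sup>2 = rat_eval (coeff q 0) (c \<tau>)) \<Longrightarrow>
       (\<And>\<tau>. (c has_vector_derivative 1 / v \<tau>) (at \<tau>)) \<Longrightarrow>
       \<forall>\<^sub>F \<tau> in nhds t. X (of_real (\<tau> - t)) = c \<tau> \<and> \<sigma> (of_real (\<tau> - t)) = v \<tau>"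
proof -
  define g where "g = rat_eval (coeff q 0)"
  obtain \<rho> where g1: "g x1 \<noteq> 0" and \<rho>: "0 < \<rho>" "\<delta>\<^sup>2 \<le> \<rho>\<^sup>2 * norm (g x1)"
    and rat: "\<And>x. x \<in> ball x1 \<rho> \<Longrightarrow> norm (g x / g x1 - 1) \<le> 1 / 2"
    and C: "\<And>x. x \<in> ball x1 \<rho> \<Longrightarrow> \<forall>k. norm (rat_eval (coeff q k) x) \<le> C * norm (g x)"
    using good unfolding good_disc_def g_def by blast
  define B where "B = ball x1 \<rho>"
  have B: "open B" "convex B" "x1 \<in> B" using \<rho> by (auto simp: B_def)
  have s0: "s1 \<noteq> 0" using s1 g1 by (auto simp: g_def)
  have \<delta>\<rho>: "\<delta> \<le> \<rho> * norm s1"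
  proof -
    have "\<delta>\<^sup>2 \<le> (\<rho> * norm s1)\<^sup>2"
      using \<rho>(2) unfolding g_def s1 [symmetric] norm_power power_mult_distrib .
    then show ?thesis by (rule power2_le_imp_le) (use \<rho>(1) in simp)
  qed
  have gn: "g x \<noteq> 0" if "x \<in> B" for x
    using rat [of x] that by (auto simp: B_def)
  have gh: "g holomorphic_on B"
    unfolding holomorphic_on_def
  proof
    fix x assume "x \<in> B"
    then have "Some x \<notin> rat_poles (coeff q 0)"
      using gn by (intro rat_eval_nonzero_regular) (auto simp: g_def)
    then show "g field_differentiable at x within B"
      unfolding g_def by (rule field_differentiable_at_within [OF rat_eval_differentiable])
  qed
  \<comment> \<open>The quotient lies in the right half-plane, where the principal square root is holomorphic.\<close>
  define b where "b = (\<lambda>x. s1 * csqrt (g x / g x1))"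
  have Re: "1 / 2 \<le> Re (g x / g x1)" if "x \<in> B" for x
    using rat [of x] that abs_Re_le_cmod [of "g x / g x1 - 1"] by (simp add: B_def)
  have bh: "b holomorphic_on B"
  proof -
    have "(\<lambda>x. csqrt (g x / g x1)) holomorphic_on B"
    proof (rule holomorphic_on_csqrt')
      show "(\<lambda>x. g x / g x1) holomorphic_on B" using gh g1 by (intro holomorphic_intros)
      show "g x / g x1 \<notin> \<real>\<^sub>\<le>\<^sub>0" if "x \<in> B" for x
        using Re [OF that] by (auto simp: complex_nonpos_Reals_iff)
    qed
    then show ?thesis unfolding b_def by (rule holomorphic_on_mult [OF holomorphic_on_const])
  qed
  have b2: "(b x)\<^sup>2 = g x" for x
    using g1 s1 by (simp add: b_def power_mult_distrib g_def)
  have b1: "b x1 = s1" using g1 by (simp add: b_def)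
  have bs: "norm (b x - s1) \<le> norm s1 / 2" if "x \<in> B" for x
  proof -
    define w where "w = csqrt (g x / g x1)"
    have "w\<^sup>2 = g x / g x1" by (simp add: w_def)
    then have "(w - 1) * (w + 1) = g x / g x1 - 1" by (simp add: power2_eq_square algebra_simps)
    then have "norm (w - 1) * norm (w + 1) \<le> 1 / 2" using rat [of x] that unfolding norm_mult [symmetric] by (simp add: B_def)
    moreover have "0 \<le> Re w" unfolding w_def by (rule Re_csqrt)
    then have "1 \<le> norm (w + 1)" using complex_Re_le_cmod [of "w + 1"] by simp
    then have "norm (w - 1) * 1 \<le> norm (w - 1) * norm (w + 1)" by (intro mult_left_mono) auto
    ultimately have "norm (w - 1) \<le> 1 / 2" by linarith
    then have "norm s1 * norm (w - 1) \<le> norm s1 * (1 / 2)" by (intro mult_left_mono) auto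
    moreover have "b x - s1 = s1 * (w - 1)" by (simp add: b_def w_def algebra_simps)
    ultimately show ?thesis by (simp add: norm_mult)
  qed
  have bn: "b x \<noteq> 0" if "x \<in> B" for x using b2 [of x] gn [OF that] by auto
  obtain Z0 where Z0: "\<And>x. x \<in> B \<Longrightarrow> (Z0 has_field_derivative b x) (at x within B)"
    using holomorphic_convex_primitive' [OF B(2,1) bh] by blast
  define Z where "Z = (\<lambda>x. Z0 x - Z0 x1)"
  have Zd: "(Z has_field_derivative b x) (at x)" if "x \<in> B" for x
    unfolding Z_def using DERIV_diff [OF Z0 [OF that, unfolded at_within_open [OF that B(1)]] DERIV_const] by simp
  have Z1: "Z x1 = 0" by (simp add: Z_def)
  have Zh: "Z holomorphic_on B" using Zd B(1) by (auto simp: holomorphic_on_open)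
  have Zlow: "norm s1 / 2 * norm (x - y) \<le> norm (Z x - Z y)" if "x \<in> B" "y \<in> B" for x y
  proof -
    have "norm ((Z x - s1 * x) - (Z y - s1 * y)) \<le> norm s1 / 2 * norm (x - y)"
    proof (rule field_differentiable_bound [OF B(2), where f = "\<lambda>x. Z x - s1 * x" and f' = "\<lambda>x. b x - s1"])
      show "((\<lambda>x. Z x - s1 * x) has_field_derivative b x - s1) (at x within B)" if "x \<in> B" for x
        using DERIV_diff [OF Zd [OF that] DERIV_cmult [OF DERIV_ident, of s1]]
        by (simp add: has_field_derivative_at_within)
    qed (use bs that in auto)
    moreover have "(Z x - s1 * x) - (Z y - s1 * y) = (Z x - Z y) - s1 * (x - y)" by (simp add: algebra_simps)
    ultimately have "norm ((Z x - Z y) - s1 * (x - y)) \<le> norm s1 / 2 * norm (x - y)" by simp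
    moreover have "norm (s1 * (x - y)) - norm (Z x - Z y) \<le> norm ((Z x - Z y) - s1 * (x - y))"
      using norm_triangle_ineq2 [of "s1 * (x - y)" "Z x - Z y"] by (simp add: norm_minus_commute)
    ultimately show ?thesis by (simp add: norm_mult)
  qed
  have Zinj: "inj_on Z B"
  proof (rule inj_onI)
    fix x y assume "x \<in> B" "y \<in> B" "Z x = Z y"
    then have "norm s1 / 2 * norm (x - y) \<le> 0" using Zlow [of x y] by simp
    then show "x = y" using s0 by (simp add: mult_le_0_iff)
  qed
  define S where "S = cball x1 (\<rho> / 2)"
  have SB: "S \<subseteq> B" using \<rho> by (auto simp: S_def B_def)
  have "ball (Z x1) (\<delta> / 4) \<subseteq> Z ` S"
  proof (rule ball_subset_open_map_image)
    show "continuous_on (closure S) Z"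
    proof -
      have "closure S = S" by (simp add: S_def)
      then show ?thesis using holomorphic_on_imp_continuous_on [OF holomorphic_on_subset [OF Zh SB]] by simp
    qed
    show "open (Z ` interior S)"
    proof (rule open_mapping_thm3)
      have "interior S \<subseteq> B" using SB interior_subset [of S] by (rule subset_trans [rotated])
      then show "Z holomorphic_on interior S" "inj_on Z (interior S)"
        by (rule holomorphic_on_subset [OF Zh], rule inj_on_subset [OF Zinj])
    qed auto
    show "\<delta> / 4 \<le> norm (Z z - Z x1)" if "z \<in> frontier S" for z
    proof -
      have z: "norm (z - x1) = \<rho> / 2" "z \<in> S" using that \<rho> by (auto simp: S_def frontier_cball dist_norm norm_minus_commute)
      have "norm s1 / 2 * (\<rho> / 2) \<le> norm (Z z - Z x1)" using Zlow [of z x1] z SB B(3) by auto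
      then show ?thesis using \<delta>\<rho> by (simp add: mult.commute)
    qed
  qed (use \<rho> \<delta> in \<open>auto simp: S_def\<close>)
  then have surj: "ball 0 (\<delta> / 4) \<subseteq> Z ` B" using SB Z1 by auto
  obtain X where Xh: "X holomorphic_on Z ` B" and Xd: "\<And>x. x \<in> B \<Longrightarrow> deriv Z x * deriv X (Z x) = 1"
    and XZ: "\<And>x. x \<in> B \<Longrightarrow> X (Z x) = x"
    using holomorphic_has_inverse [OF Zh B(1) Zinj] by blast
  have XB: "X w \<in> B" "Z (X w) = w" if w: "w \<in> ball 0 (\<delta> / 4)" for w
  proof -
    obtain x where "x \<in> B" "w = Z x" using w surj by blast
    then show "X w \<in> B" "Z (X w) = w" using XZ by auto
  qed
  have XhD: "X holomorphic_on ball 0 (\<delta> / 4)" by (rule holomorphic_on_subset [OF Xh surj])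
  define \<sigma> where "\<sigma> = (\<lambda>w. b (X w))"
  have Xder: "(X has_field_derivative 1 / \<sigma> w) (at w)" if w: "w \<in> ball 0 (\<delta> / 4)" for w
  proof -
    have "(X has_field_derivative deriv X w) (at w)"
      by (rule holomorphic_derivI [OF XhD _ w]) simp
    moreover have "b (X w) * deriv X w = 1"
      using Xd [OF XB(1) [OF w]] unfolding XB(2) [OF w] DERIV_imp_deriv [OF Zd [OF XB(1) [OF w]]] .
    then have "deriv X w = 1 / \<sigma> w" using bn [OF XB(1) [OF w]] by (simp add: \<sigma>_def field_simps)
    ultimately show ?thesis by simp
  qed
  have X0: "X 0 = x1" using XZ [OF B(3)] Z1 by simp
  show thesis
  proof (rule that [of X \<sigma>])
    show "X holomorphic_on ball 0 (\<delta> / 4)" by (rule XhD)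
    show "\<sigma> holomorphic_on ball 0 (\<delta> / 4)"
    proof -
      have "X ` ball 0 (\<delta> / 4) \<subseteq> B" using XB(1) by blast
      from holomorphic_on_compose_gen [OF XhD bh this] show ?thesis by (simp add: o_def \<sigma>_def [abs_def])
    qed
    show "X 0 = x1" by (rule X0)
    show "\<sigma> 0 = s1" by (simp add: \<sigma>_def X0 b1)
    show "(X has_field_derivative 1 / \<sigma> w) (at w) \<and>
       (\<sigma> w)\<^sup>2 = rat_eval (coeff q 0) (X w) \<and> norm (\<sigma> w - s1) \<le> norm s1 / 2 \<and>
       (\<forall>k. norm (rat_eval (coeff q k) (X w)) \<le> C * norm (rat_eval (coeff q 0) (X w)))"
      if w: "w \<in> ball 0 (\<delta> / 4)" for w
      using Xder [OF w] b2 bs [OF XB(1) [OF w]] C [of "X w"] XB(1) [OF w]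
      by (auto simp: \<sigma>_def g_def B_def)
    fix c :: "real \<Rightarrow> complex" and v t
    assume ct: "c t = x1" and vt: "v t = s1" and vc: "continuous_on UNIV v"
      and v2: "\<And>\<tau>. (v \<tau>)\<^sup>2 = rat_eval (coeff q 0) (c \<tau>)"
      and cd: "\<And>\<tau>. (c has_vector_derivative 1 / v \<tau>) (at \<tau>)"
    have ccont: "isCont c \<tau>" for \<tau> using cd [of \<tau>] by (rule has_vector_derivative_continuous)
    have vcont: "isCont v \<tau>" for \<tau> using vc by (simp add: continuous_on_eq_continuous_at)
    have "\<forall>\<^sub>F \<tau> in nhds t. c \<tau> \<in> B"
    proof -
      have "(c \<longlongrightarrow> c t) (nhds t)" using ccont [of t] by (simp only: isCont_def tendsto_at_iff_tendsto_nhds)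
      from topological_tendstoD [OF this B(1)] show ?thesis using B(3) ct by simp
    qed
    moreover have "\<forall>\<^sub>F \<tau> in nhds t. norm (v \<tau> - s1) < norm s1"
    proof -
      have "(v \<longlongrightarrow> v t) (nhds t)" using vcont [of t] by (simp only: isCont_def tendsto_at_iff_tendsto_nhds)
      from tendstoD [OF this, of "norm s1"] show ?thesis using s0 vt by (simp add: dist_norm)
    qed
    ultimately have "\<forall>\<^sub>F \<tau> in nhds t. c \<tau> \<in> B \<and> norm (v \<tau> - s1) < norm s1" by (rule eventually_conj)
    then obtain e where e: "0 < e" and eB: "\<And>\<tau>. dist \<tau> t < e \<Longrightarrow> c \<tau> \<in> B \<and> norm (v \<tau> - s1) < norm s1"
      unfolding eventually_nhds_metric by blast
    have bv: "b (c \<tau>) = v \<tau>" if "dist \<tau> t < e" for \<tau>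
    proof -
      have "(b (c \<tau>))\<^sup>2 = (v \<tau>)\<^sup>2" using b2 v2 by (simp add: g_def)
      then consider "b (c \<tau>) = v \<tau>" | "b (c \<tau>) = - v \<tau>" by (auto simp: power2_eq_iff)
      then show ?thesis
      proof cases
        case 2
        have "norm (- v \<tau> - s1) \<le> norm s1 / 2" using bs [of "c \<tau>"] eB [OF that] 2 by auto
        moreover have "norm (v \<tau> - s1) < norm s1" using eB [OF that] by blast
        moreover have "norm (2 * s1) \<le> norm (v \<tau> - s1) + norm (- v \<tau> - s1)"
        proof -
          have "(v \<tau> - s1) + (- v \<tau> - s1) = - (2 * s1)" by simp
          then show ?thesis using norm_triangle_ineq [of "v \<tau> - s1" "- v \<tau> - s1"] by (simp only: norm_minus_cancel)
        qed
        moreover have "0 < norm s1" using s0 by simp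
        ultimately show ?thesis by (simp add: norm_mult)
      qed
    qed
    have hd: "((\<lambda>\<tau>. Z (c \<tau>) - of_real (\<tau> - t)) has_vector_derivative 0) (at \<tau>)" if "dist \<tau> t < e" for \<tau>
    proof -
      have cB: "c \<tau> \<in> B" using eB that by blast
      have "((Z \<circ> c) has_vector_derivative (1 / v \<tau>) * b (c \<tau>)) (at \<tau>)"
        by (rule field_vector_diff_chain_at [OF cd Zd [OF cB]])
      moreover have "(1 / v \<tau>) * b (c \<tau>) = 1" using bn [OF cB] bv [OF that] by simp
      ultimately have "((\<lambda>\<tau>. Z (c \<tau>)) has_vector_derivative 1) (at \<tau>)" by (simp add: o_def)
      moreover have "((\<lambda>\<tau>. of_real (\<tau> - t)) has_vector_derivative (1 :: complex)) (at \<tau>)"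
      proof -
        have "((\<lambda>z :: complex. z - of_real t) has_field_derivative 1) (at (of_real \<tau>))"
          by (auto intro!: derivative_eq_intros)
        from has_vector_derivative_real_field [OF this] show ?thesis by simp
      qed
      ultimately have "((\<lambda>\<tau>. Z (c \<tau>) - of_real (\<tau> - t)) has_vector_derivative 1 - 1) (at \<tau>)"
        by (rule has_vector_derivative_diff)
      then show ?thesis by simp
    qed
    obtain k where k: "\<And>\<tau>. \<tau> \<in> ball t e \<Longrightarrow> Z (c \<tau>) - of_real (\<tau> - t) = k"
      by (rule has_vector_derivative_zero_constant [of "ball t e" "\<lambda>\<tau>. Z (c \<tau>) - of_real (\<tau> - t)"])
        (simp, rule has_vector_derivative_at_within [OF hd], simp add: dist_commute, blast)
    have "k = 0" using k [of t] e ct Z1 by simp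
    then have Zc: "Z (c \<tau>) = of_real (\<tau> - t)" if "dist \<tau> t < e" for \<tau>
      using k [of \<tau>] that by (simp add: dist_commute)
    have "X (of_real (\<tau> - t)) = c \<tau> \<and> \<sigma> (of_real (\<tau> - t)) = v \<tau>" if "dist \<tau> t < e" for \<tau>
      using XZ [of "c \<tau>"] eB [OF that] bv [OF that] unfolding Zc [OF that] \<sigma>_def by simp
    then show "\<forall>\<^sub>F \<tau> in nhds t. X (of_real (\<tau> - t)) = c \<tau> \<and> \<sigma> (of_real (\<tau> - t)) = v \<tau>"
      using e unfolding eventually_nhds_metric by blast
  qed
qed

text \<open>Discs with real centres and equal radii overlap in convex sets that meet the real axis, so agreement with
  one function on small real intervals determines a single holomorphic function on the strip.\<close>

lemma strip_glue:
  fixes f :: "real \<Rightarrow> complex \<Rightarrow> complex" and \<phi> :: "real \<Rightarrow> complex"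
  assumes \<epsilon>: "0 < \<epsilon>" and hol: "\<And>t. f t holomorphic_on ball 0 \<epsilon>"
    and loc: "\<And>t. \<forall>\<^sub>F \<tau> in nhds t. f t (of_real (\<tau> - t)) = \<phi> \<tau>"
  obtains F where "F holomorphic_on {z. \<bar>Im z\<bar> < \<epsilon>}"
    "\<And>t w. w \<in> ball 0 \<epsilon> \<Longrightarrow> F (of_real t + w) = f t w"
proof -
  \<comment> \<open>Every point is evaluated in the disc centred at its own real part.\<close>
  define F where "F = (\<lambda>z. f (Re z) (z - of_real (Re z)))"
  have hol': "(\<lambda>z. f t (z - of_real t)) holomorphic_on ball (of_real t) \<epsilon>" for t
  proof -
    have "(f t \<circ> (\<lambda>z. z - of_real t)) holomorphic_on ball (of_real t) \<epsilon>"
      by (rule holomorphic_on_compose_gen [OF _ hol]) (auto intro!: holomorphic_intros simp: dist_norm norm_minus_commute)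
    then show ?thesis by (simp add: o_def)
  qed
  have local: "\<exists>N. open N \<and> z0 \<in> N \<and> N \<subseteq> ball (of_real (Re z0)) \<epsilon> \<and> (\<forall>z\<in>N. F z = f (Re z0) (z - of_real (Re z0)))"
    if z0: "\<bar>Im z0\<bar> < \<epsilon>" for z0
  proof -
    define t0 where "t0 = Re z0"
    obtain e0 where e0: "0 < e0" "\<And>\<tau>. dist \<tau> t0 < e0 \<Longrightarrow> f t0 (of_real (\<tau> - t0)) = \<phi> \<tau>"
      using loc [of t0] unfolding eventually_nhds_metric by blast
    define e where "e = min e0 \<epsilon>"
    have e: "0 < e" "e \<le> \<epsilon>" "e \<le> e0" using e0 \<epsilon> by (auto simp: e_def)
    define N where "N = {z. \<bar>Re z - t0\<bar> < e} \<inter> ball (of_real t0) \<epsilon>"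
    have "F z = f t0 (z - of_real t0)" if z: "z \<in> N" for z
    proof -
      define t where "t = Re z"
      have t: "\<bar>t - t0\<bar> < e" using z by (simp add: N_def t_def)
      obtain e1 where e1: "0 < e1" "\<And>\<tau>. dist \<tau> t < e1 \<Longrightarrow> f t (of_real (\<tau> - t)) = \<phi> \<tau>"
        using loc [of t] unfolding eventually_nhds_metric by blast
      define S where "S = ball (complex_of_real t0) \<epsilon> \<inter> ball (of_real t) \<epsilon>"
      have S: "open S" "connected S" unfolding S_def by (auto intro!: convex_connected convex_Int)
      have tS: "of_real t \<in> S" using t e \<epsilon> by (simp add: S_def dist_of_real dist_real_def abs_minus_commute)
      define e2 where "e2 = min e1 (e - \<bar>t - t0\<bar>)"
      have e2: "0 < e2" "e2 \<le> e1" "e2 \<le> e - \<bar>t - t0\<bar>" using e1 t by (auto simp: e2_def)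
      define U where "U = complex_of_real ` {t<..<t + e2} \<inter> S"
      have zS: "z \<in> S"
      proof -
        have zt: "z \<in> ball (of_real t0) \<epsilon>" using z by (simp add: N_def)
        have "\<bar>Im z\<bar> \<le> norm (z - of_real t0)" using abs_Im_le_cmod [of "z - of_real t0"] by simp
        moreover have "z - of_real t = \<i> * of_real (Im z)" by (simp add: t_def complex_eq_iff)
        ultimately have "norm (z - of_real t) < \<epsilon>" using zt by (simp add: norm_mult dist_norm norm_minus_commute)
        then show ?thesis using zt by (simp add: S_def dist_norm norm_minus_commute)
      qed
      have lim: "of_real t islimpt U"
        unfolding islimpt_approachable
      proof (intro allI impI)
        fix r :: real assume r: "0 < r"
        obtain s where s: "0 < s" "ball (of_real t) s \<subseteq> S" using S(1) tS open_contains_ball by blast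
        define k where "k = min (min r s) e2 / 2"
        have k: "0 < k" "k < r" "k < s" "k < e2" using r s e2 by (auto simp: k_def)
        have "dist (complex_of_real t) (of_real (t + k)) = k" using k by (simp add: dist_norm)
        then have "complex_of_real (t + k) \<in> S" using k by (intro subsetD [OF s(2)]) simp
        moreover have "complex_of_real (t + k) \<in> complex_of_real ` {t<..<t + e2}"
          by (rule imageI) (use k in simp)
        ultimately have "complex_of_real (t + k) \<in> U" unfolding U_def by blast
        moreover have "complex_of_real (t + k) \<noteq> of_real t" using k by simp
        moreover have "dist (complex_of_real (t + k)) (of_real t) < r" using k by (simp add: dist_norm)
        ultimately show "\<exists>x'\<in>U. x' \<noteq> complex_of_real t \<and> dist x' (complex_of_real t) < r" by blast
      qed
      have "f t0 (z - of_real t0) - f t (z - of_real t) = 0"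
      proof (rule analytic_continuation [where S = S and U = U and \<xi> = "of_real t" and f = "\<lambda>z. f t0 (z - of_real t0) - f t (z - of_real t)"])
        show "(\<lambda>z. f t0 (z - of_real t0) - f t (z - of_real t)) holomorphic_on S"
          using holomorphic_on_subset [OF hol' [of t0], of S] holomorphic_on_subset [OF hol' [of t], of S]
          by (intro holomorphic_on_diff) (auto simp: S_def)
        show "f t0 (y - of_real t0) - f t (y - of_real t) = 0" if y: "y \<in> U" for y
        proof -
          obtain \<tau> where \<tau>: "y = of_real \<tau>" "t < \<tau>" "\<tau> < t + e2" using y by (auto simp: U_def)
          have "dist \<tau> t < e1" "dist \<tau> t0 < e0" using \<tau> e2 e by (auto simp: dist_real_def)
          then have "f t (of_real (\<tau> - t)) = f t0 (of_real (\<tau> - t0))" using e1(2) e0(2) by simp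
          then show ?thesis by (simp add: \<tau>(1))
        qed
      qed (use S tS lim zS in \<open>auto simp: U_def\<close>)
      then show ?thesis by (simp add: F_def t_def)
    qed
    moreover have "open N"
    proof -
      have "open {z. \<bar>Re z - t0\<bar> < e}" by (intro open_Collect_less continuous_intros)
      then show ?thesis unfolding N_def by auto
    qed
    moreover have "z0 \<in> N"
    proof -
      have "of_real t0 - z0 = - (\<i> * of_real (Im z0))" by (simp add: t0_def complex_eq_iff)
      then have "norm (of_real t0 - z0) = \<bar>Im z0\<bar>" by (simp add: norm_mult)
      then show ?thesis using z0 e by (simp add: N_def t0_def dist_norm)
    qed
    moreover have "N \<subseteq> ball (of_real t0) \<epsilon>" by (auto simp: N_def)
    ultimately show ?thesis unfolding t0_def by blast
  qed
  have oS: "open {z. \<bar>Im z\<bar> < \<epsilon>}" by (intro open_Collect_less continuous_intros)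
  have Fh: "F holomorphic_on {z. \<bar>Im z\<bar> < \<epsilon>}"
    unfolding holomorphic_on_open [OF oS]
  proof
    fix z0 assume "z0 \<in> {z. \<bar>Im z\<bar> < \<epsilon>}"
    then have "\<bar>Im z0\<bar> < \<epsilon>" by simp
    from local [OF this] obtain N where N: "open N" "z0 \<in> N" "N \<subseteq> ball (of_real (Re z0)) \<epsilon>"
      and NF: "\<forall>z\<in>N. F z = f (Re z0) (z - of_real (Re z0))"
      by (elim exE conjE)
    have zb: "z0 \<in> ball (of_real (Re z0)) \<epsilon>" using N by auto
    have "(F has_field_derivative deriv (\<lambda>z. f (Re z0) (z - of_real (Re z0))) z0) (at z0)"
      by (rule has_field_derivative_transform_within_open [OF holomorphic_derivI [OF hol' open_ball zb] N(1,2)])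
        (simp add: NF)
    then show "\<exists>f'. (F has_field_derivative f') (at z0)" by blast
  qed
  show thesis
  proof (rule that [OF Fh])
    fix t w assume w: "w \<in> ball (0 :: complex) \<epsilon>"
    have "\<bar>Im (of_real t)\<bar> < \<epsilon>" using \<epsilon> by simp
    from local [OF this] obtain N where N: "open N" "of_real t \<in> N" "N \<subseteq> ball (of_real t) \<epsilon>"
      and NF: "\<forall>z\<in>N. F z = f t (z - of_real t)"
      unfolding Re_complex_of_real by (elim exE conjE)
    have sub: "ball (of_real t) \<epsilon> \<subseteq> {z. \<bar>Im z\<bar> < \<epsilon>}"
    proof
      fix z assume "z \<in> ball (complex_of_real t) \<epsilon>"
      then show "z \<in> {z. \<bar>Im z\<bar> < \<epsilon>}"
        using abs_Im_le_cmod [of "z - of_real t"] by (simp add: dist_norm norm_minus_commute)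
    qed
    have "F (of_real t + w) = f t ((of_real t + w) - of_real t)"
      by (rule analytic_continuation_open [OF N(1) _ _ _ N(3) holomorphic_on_subset [OF Fh sub] hol' bspec [OF NF]])
        (use N w in \<open>auto simp: dist_norm\<close>)
    then show "F (of_real t + w) = f t w" by simp
  qed
qed

lemma wkb_chartI:
  assumes \<epsilon>: "0 < \<epsilon>" and X0: "X 0 = x0" and s0: "\<sigma> 0 = s0" and sh: "\<sigma> holomorphic_on {z. \<bar>Im z\<bar> < \<epsilon>}"
    and st: "\<And>z. \<bar>Im z\<bar> < \<epsilon> \<Longrightarrow> \<sigma> z \<noteq> 0 \<and> (\<sigma> z)\<^sup>2 = rat_eval (coeff q 0) (X z) \<and>
       (X has_field_derivative 1 / \<sigma> z) (at z) \<and>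
       (\<forall>k. norm (rat_eval (coeff q k) (X z)) \<le> C * norm (rat_eval (coeff q 0) (X z)))"
    and d\<sigma>: "\<And>z. \<bar>Im z\<bar> < \<epsilon> / 2 \<Longrightarrow> norm (deriv \<sigma> z) \<le> K * norm (\<sigma> z)"
    and poles: "\<And>k. rat_poles (coeff q k) \<subseteq> rat_poles (coeff q 0)"
  shows "wkb_chart q x0 s0 (\<epsilon> / 2) X \<sigma>"
proof -
  have H: "\<bar>Im z\<bar> < \<epsilon> / 2" "\<bar>Im z\<bar> < \<epsilon>" if "z \<in> half_strip (\<epsilon> / 2)" for z
    using that \<epsilon> by (auto simp: half_strip_def)
  have hol: "(\<lambda>z. rat_eval (coeff q k) (X z)) holomorphic_on half_strip (\<epsilon> / 2)" for k
    unfolding holomorphic_on_open [OF open_half_strip]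
  proof
    fix z assume z: "z \<in> half_strip (\<epsilon> / 2)"
    have "rat_eval (coeff q 0) (X z) \<noteq> 0" using st [OF H(2) [OF z]] by (metis power_not_zero)
    then have "Some (X z) \<notin> rat_poles (coeff q k)" using rat_eval_nonzero_regular poles by blast
    then obtain D where "(rat_eval (coeff q k) has_field_derivative D) (at (X z))"
      using rat_eval_differentiable by (auto simp: field_differentiable_def)
    then show "\<exists>f'. ((\<lambda>z. rat_eval (coeff q k) (X z)) has_field_derivative f') (at z)"
      using DERIV_chain2 st [OF H(2) [OF z]] by blast
  qed
  show ?thesis
    unfolding wkb_chart_def
  proof (intro conjI allI)
    show "\<sigma> holomorphic_on half_strip (\<epsilon> / 2)"
      by (rule holomorphic_on_subset [OF sh]) (use H in blast)
    show "0 < \<epsilon> / 2" "X 0 = x0" "\<sigma> 0 = s0" using \<epsilon> X0 s0 by auto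
    show "(\<lambda>z. rat_eval (coeff q k) (X z)) holomorphic_on half_strip (\<epsilon> / 2)" for k by (rule hol)
    show "\<forall>z\<in>half_strip (\<epsilon> / 2). \<sigma> z \<noteq> 0 \<and> (\<sigma> z)\<^sup>2 = rat_eval (coeff q 0) (X z) \<and>
        (X has_field_derivative 1 / \<sigma> z) (at z)"
      using st H(2) by blast
    show "\<exists>C. \<forall>z\<in>half_strip (\<epsilon> / 2). norm (deriv \<sigma> z) \<le> C * norm (\<sigma> z)"
      using d\<sigma> H(1) by blast
    show "\<exists>C. \<forall>z\<in>half_strip (\<epsilon> / 2). norm (rat_eval (coeff q k) (X z)) \<le> C * norm (rat_eval (coeff q 0) (X z))" for k
      using st H(2) by blast
  qed
qed

text \<open>The charts along the curve glue to a strip. On each of them \<open>\<sigma>\<close> is comparable to its value at the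
  centre, so Cauchy's estimate bounds \<open>\<sigma>' / \<sigma>\<close> without any computation with \<open>q0\<close>.\<close>

lemma wkb_charts_of_curve:
  fixes c v :: "real \<Rightarrow> complex"
  assumes \<delta>: "0 < \<delta>" and good: "\<And>t. good_disc q \<delta> C (c t)"
    and v: "continuous_on UNIV v" "\<And>t. (v t)\<^sup>2 = rat_eval (coeff q 0) (c t)"
    and cd: "\<And>t. (c has_vector_derivative 1 / v t) (at t)"
    and c0: "c 0 = x0" and v0: "v 0 = s0"
    and poles: "\<And>k. rat_poles (coeff q k) \<subseteq> rat_poles (coeff q 0)"
  shows "\<exists>d X \<sigma>. wkb_chart q x0 s0 d X \<sigma> \<and> wkb_chart q x0 (- s0) d (\<lambda>z. X (- z)) (\<lambda>z. - \<sigma> (- z))"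
proof -
  define \<epsilon> where "\<epsilon> = \<delta> / 4"
  have \<epsilon>: "0 < \<epsilon>" using \<delta> by (simp add: \<epsilon>_def)
  define P where "P = (\<lambda>t (X :: complex \<Rightarrow> complex) \<sigma>. X holomorphic_on ball 0 \<epsilon> \<and> \<sigma> holomorphic_on ball 0 \<epsilon> \<and>
    (\<forall>w\<in>ball 0 \<epsilon>. (X has_field_derivative 1 / \<sigma> w) (at w) \<and>
       (\<sigma> w)\<^sup>2 = rat_eval (coeff q 0) (X w) \<and> norm (\<sigma> w - v t) \<le> norm (v t) / 2 \<and>
       (\<forall>k. norm (rat_eval (coeff q k) (X w)) \<le> C * norm (rat_eval (coeff q 0) (X w)))) \<and>
    (\<forall>\<^sub>F \<tau> in nhds t. X (of_real (\<tau> - t)) = c \<tau> \<and> \<sigma> (of_real (\<tau> - t)) = v \<tau>))"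
  have "\<exists>X \<sigma>. P t X \<sigma>" for t
  proof (rule good_disc_chart [OF good [of t] \<delta> v(2)])
    fix X \<sigma> :: "complex \<Rightarrow> complex"
    assume a: "X holomorphic_on ball 0 (\<delta> / 4)" "\<sigma> holomorphic_on ball 0 (\<delta> / 4)"
      "\<And>w. w \<in> ball 0 (\<delta> / 4) \<Longrightarrow> (X has_field_derivative 1 / \<sigma> w) (at w) \<and>
       (\<sigma> w)\<^sup>2 = rat_eval (coeff q 0) (X w) \<and> norm (\<sigma> w - v t) \<le> norm (v t) / 2 \<and>
       (\<forall>k. norm (rat_eval (coeff q k) (X w)) \<le> C * norm (rat_eval (coeff q 0) (X w)))"
      and u: "\<And>(c' :: real \<Rightarrow> complex) v' t'. c' t' = c t \<Longrightarrow> v' t' = v t \<Longrightarrow> continuous_on UNIV v' \<Longrightarrow>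
       (\<And>\<tau>. (v' \<tau>)\<^sup>2 = rat_eval (coeff q 0) (c' \<tau>)) \<Longrightarrow>
       (\<And>\<tau>. (c' has_vector_derivative 1 / v' \<tau>) (at \<tau>)) \<Longrightarrow>
       \<forall>\<^sub>F \<tau> in nhds t'. X (of_real (\<tau> - t')) = c' \<tau> \<and> \<sigma> (of_real (\<tau> - t')) = v' \<tau>"
    have ev: "\<forall>\<^sub>F \<tau> in nhds t. X (of_real (\<tau> - t)) = c \<tau> \<and> \<sigma> (of_real (\<tau> - t)) = v \<tau>"
      by (rule u [of c t v, OF refl refl v cd])
    have "P t X \<sigma>"
      unfolding P_def \<epsilon>_def by (intro conjI ballI a(1,2) ev a(3) [THEN conjunct1] a(3) [THEN conjunct2, THEN conjunct1]
        a(3) [THEN conjunct2, THEN conjunct2, THEN conjunct1] a(3) [THEN conjunct2, THEN conjunct2, THEN conjunct2])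
    then show ?thesis by blast
  qed
  then obtain Xt \<sigma>t where P: "P t (Xt t) (\<sigma>t t)" for t by metis
  obtain X where Xh: "X holomorphic_on {z. \<bar>Im z\<bar> < \<epsilon>}"
    and Xe: "\<And>t w. w \<in> ball 0 \<epsilon> \<Longrightarrow> X (of_real t + w) = Xt t w"
  proof (rule strip_glue [of \<epsilon> Xt c])
    show "\<forall>\<^sub>F \<tau> in nhds t. Xt t (of_real (\<tau> - t)) = c \<tau>" for t
      using P [of t] unfolding P_def by (auto elim: eventually_mono)
  qed (use \<epsilon> P in \<open>auto simp: P_def\<close>)
  obtain \<sigma> where sh: "\<sigma> holomorphic_on {z. \<bar>Im z\<bar> < \<epsilon>}"
    and se: "\<And>t w. w \<in> ball 0 \<epsilon> \<Longrightarrow> \<sigma> (of_real t + w) = \<sigma>t t w"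
  proof (rule strip_glue [of \<epsilon> \<sigma>t v])
    show "\<forall>\<^sub>F \<tau> in nhds t. \<sigma>t t (of_real (\<tau> - t)) = v \<tau>" for t
      using P [of t] unfolding P_def by (auto elim: eventually_mono)
  qed (use \<epsilon> P in \<open>auto simp: P_def\<close>)
  have v_ne: "v t \<noteq> 0" for t using v(2) [of t] good [of t] by (auto simp: good_disc_def)
  have dec: "z = of_real (Re z) + (z - of_real (Re z))" "norm (z - of_real (Re z)) = \<bar>Im z\<bar>" for z
  proof -
    have "z - of_real (Re z) = \<i> * of_real (Im z)" by (simp add: complex_eq_iff)
    then show "norm (z - of_real (Re z)) = \<bar>Im z\<bar>" by (simp add: norm_mult)
  qed simp
  have s_near: "norm (\<sigma> z - v t) \<le> norm (v t) / 2" if "norm (z - of_real t) < \<epsilon>" for z t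
  proof -
    have "z - of_real t \<in> ball 0 \<epsilon>" using that by simp
    then show ?thesis using se [of "z - of_real t" t] P [of t] by (auto simp: P_def)
  qed
  have st: "\<sigma> z \<noteq> 0 \<and> (\<sigma> z)\<^sup>2 = rat_eval (coeff q 0) (X z) \<and>
       (X has_field_derivative 1 / \<sigma> z) (at z) \<and>
       (\<forall>k. norm (rat_eval (coeff q k) (X z)) \<le> C * norm (rat_eval (coeff q 0) (X z)))"
    if z: "\<bar>Im z\<bar> < \<epsilon>" for z
  proof -
    define t where "t = Re z"
    define w where "w = z - of_real t"
    have zw: "z = of_real t + w" and w: "w \<in> ball 0 \<epsilon>" using z dec(2) [of z] by (auto simp: w_def t_def)
    have Xz: "X z = Xt t w" and sz: "\<sigma> z = \<sigma>t t w" using Xe [OF w] se [OF w] zw by auto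
    have Pw: "(Xt t has_field_derivative 1 / \<sigma>t t w) (at w)" "(\<sigma>t t w)\<^sup>2 = rat_eval (coeff q 0) (Xt t w)"
       "norm (\<sigma>t t w - v t) \<le> norm (v t) / 2"
       "\<forall>k. norm (rat_eval (coeff q k) (Xt t w)) \<le> C * norm (rat_eval (coeff q 0) (Xt t w))"
      using P [of t] w by (auto simp: P_def)
    have "\<sigma>t t w \<noteq> 0" using Pw(3) v_ne [of t] by auto
    moreover have "(X has_field_derivative 1 / \<sigma>t t w) (at z)"
    proof (rule has_field_derivative_transform_within_open [where S = "ball (of_real t) \<epsilon>"])
      show "((\<lambda>z. Xt t (- of_real t + z)) has_field_derivative 1 / \<sigma>t t w) (at z)"
        by (rule has_field_derivative_shift) (use Pw(1) in \<open>simp add: zw\<close>)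
      show "z \<in> ball (of_real t) \<epsilon>" using w by (simp add: zw dist_norm)
      show "Xt t (- of_real t + y) = X y" if "y \<in> ball (of_real t) \<epsilon>" for y
        using Xe [of "y - of_real t" t] that by (simp add: dist_norm norm_minus_commute)
    qed simp
    ultimately show ?thesis using Pw unfolding Xz sz by blast
  qed
  have d\<sigma>: "norm (deriv \<sigma> z) \<le> 6 / \<epsilon> * norm (\<sigma> z)" if z: "\<bar>Im z\<bar> < \<epsilon> / 2" for z
  proof -
    define t where "t = Re z"
    have zt: "norm (z - of_real t) < \<epsilon> / 2" using z dec(2) [of z] by (simp add: t_def)
    have near: "norm (y - of_real t) < \<epsilon>" if "y \<in> ball z (\<epsilon> / 2)" for y
    proof -
      have "norm (y - z) < \<epsilon> / 2" using that by (simp add: dist_norm norm_minus_commute)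
      then show ?thesis using zt norm_triangle_ineq [of "y - z" "z - of_real t"] by simp
    qed
    have "norm (deriv \<sigma> z) \<le> (3 / 2 * norm (v t)) / (\<epsilon> / 2)"
    proof (rule Cauchy_deriv_bound)
      show "\<sigma> holomorphic_on ball z (\<epsilon> / 2)"
      proof (rule holomorphic_on_subset [OF sh], rule subsetI)
        fix y assume "y \<in> ball z (\<epsilon> / 2)"
        then show "y \<in> {z. \<bar>Im z\<bar> < \<epsilon>}"
          using near [of y] abs_Im_le_cmod [of "y - of_real t"] by simp
      qed
      show "norm (\<sigma> y) \<le> 3 / 2 * norm (v t)" if "y \<in> ball z (\<epsilon> / 2)" for y
        using s_near [OF near [OF that]] norm_triangle_ineq2 [of "\<sigma> y" "v t"] by simp
    qed (use \<epsilon> in auto)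
    also have "\<dots> = 3 / \<epsilon> * norm (v t)" using \<epsilon> by (simp add: field_simps)
    also have "\<dots> \<le> 3 / \<epsilon> * (2 * norm (\<sigma> z))"
    proof (rule mult_left_mono)
      have "norm (\<sigma> z - v t) \<le> norm (v t) / 2" using zt \<epsilon> by (intro s_near) linarith
      then show "norm (v t) \<le> 2 * norm (\<sigma> z)"
        using norm_triangle_ineq2 [of "v t" "\<sigma> z"] by (simp add: norm_minus_commute)
    qed (use \<epsilon> in simp)
    finally show ?thesis by simp
  qed
  have X0: "X 0 = x0" "\<sigma> 0 = s0"
  proof -
    have "X 0 = Xt 0 0" "\<sigma> 0 = \<sigma>t 0 0" using Xe [of 0 0] se [of 0 0] \<epsilon> by auto
    moreover have "Xt 0 0 = c 0 \<and> \<sigma>t 0 0 = v 0"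
      using eventually_nhds_x_imp_x [of _ 0] P [of 0] unfolding P_def by fastforce
    ultimately show "X 0 = x0" "\<sigma> 0 = s0" using c0 v0 by auto
  qed
  have "wkb_chart q x0 s0 (\<epsilon> / 2) X \<sigma>"
    by (rule wkb_chartI [OF \<epsilon> X0 sh st d\<sigma> poles])
  moreover have "wkb_chart q x0 (- s0) (\<epsilon> / 2) (\<lambda>z. X (- z)) (\<lambda>z. - \<sigma> (- z))"
  proof (rule wkb_chartI [OF \<epsilon>, where C = C and K = "6 / \<epsilon>"])
    have oS: "open {z. \<bar>Im z\<bar> < \<epsilon>}" by (intro open_Collect_less continuous_intros)
    have sd: "((\<lambda>z. - \<sigma> (- z)) has_field_derivative deriv \<sigma> (- z)) (at z)" if "\<bar>Im z\<bar> < \<epsilon>" for z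
    proof -
      have "(\<sigma> has_field_derivative deriv \<sigma> (- z)) (at (- z))"
        by (rule holomorphic_derivI [OF sh oS]) (use that in simp)
      then have "((\<lambda>z. \<sigma> (- z)) has_field_derivative deriv \<sigma> (- z) * (- 1)) (at z)"
        by (rule DERIV_chain2) (rule DERIV_minus [OF DERIV_ident])
      from DERIV_minus [OF this] show ?thesis by simp
    qed
    show "(\<lambda>z. - \<sigma> (- z)) holomorphic_on {z. \<bar>Im z\<bar> < \<epsilon>}"
      using sd by (auto simp: holomorphic_on_open [OF oS])
    fix z
    show "norm (deriv (\<lambda>z. - \<sigma> (- z)) z) \<le> 6 / \<epsilon> * norm (- \<sigma> (- z))" if "\<bar>Im z\<bar> < \<epsilon> / 2"
      using d\<sigma> [of "- z"] that DERIV_imp_deriv [OF sd [of z]] \<epsilon> by simp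
    show "- \<sigma> (- z) \<noteq> 0 \<and> (- \<sigma> (- z))\<^sup>2 = rat_eval (coeff q 0) (X (- z)) \<and>
       ((\<lambda>z. X (- z)) has_field_derivative 1 / - \<sigma> (- z)) (at z) \<and>
       (\<forall>k. norm (rat_eval (coeff q k) (X (- z))) \<le> C * norm (rat_eval (coeff q 0) (X (- z))))"
      if z: "\<bar>Im z\<bar> < \<epsilon>"
    proof -
      have S: "\<sigma> (- z) \<noteq> 0 \<and> (\<sigma> (- z))\<^sup>2 = rat_eval (coeff q 0) (X (- z)) \<and>
         (X has_field_derivative 1 / \<sigma> (- z)) (at (- z)) \<and>
         (\<forall>k. norm (rat_eval (coeff q k) (X (- z))) \<le> C * norm (rat_eval (coeff q 0) (X (- z))))"
        by (rule st) (use z in simp)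
      then have "((\<lambda>z. X (- z)) has_field_derivative 1 / \<sigma> (- z) * (- 1)) (at z)"
        by (intro DERIV_chain2 [of X] DERIV_minus [OF DERIV_ident]) blast
      then show ?thesis using S by simp
    qed
  qed (use X0 poles in simp_all)
  ultimately show ?thesis by blast
qed

section \<open>The level curve\<close>

lemma limitin_riemann_sphere_Some:
  assumes "limitin riemann_sphere (\<lambda>t. Some (f t)) (Some a) F"
  shows "(f \<longlongrightarrow> a) F"
proof (rule topological_tendstoI)
  fix S assume S: "open S" "a \<in> S"
  have "openin riemann_sphere (Some ` S)"
    using S by (simp add: riemann_sphere_def)
  then have "\<forall>\<^sub>F t in F. Some (f t) \<in> Some ` S"
    using assms S unfolding limitin_def by blast
  then show "\<forall>\<^sub>F t in F. f t \<in> S" by (rule eventually_mono) auto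
qed

lemma limitin_riemann_sphere_None:
  assumes "limitin riemann_sphere (\<lambda>t. Some (f t)) None F"
  shows "\<forall>\<^sub>F t in F. R < norm (f t)"
proof -
  have "openin riemann_sphere (insert None (Some ` (topspace euclidean - cball 0 R)))"
    unfolding riemann_sphere_def openin_Alexandroff_compactification
    by (intro disjI2 exI [of _ "cball 0 R"]) simp
  then have "\<forall>\<^sub>F t in F. Some (f t) \<in> insert None (Some ` (topspace euclidean - cball 0 R))"
    using assms unfolding limitin_def by blast
  then show ?thesis by (rule eventually_mono) auto
qed

text \<open>The derivative of \<open>ln (\<bar>\<gamma> - a\<bar>\<^sup>2)\<close> is at most a multiple of that of \<open>L\<close>, so \<open>L\<close> cannot stay bounded
  while this logarithm becomes infinite. Both kinds of poles are covered: \<open>\<gamma>\<close> may tend to \<open>a\<close> or to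
  infinity.\<close>

lemma curve_length_unbounded:
  fixes \<gamma> D :: "real \<Rightarrow> complex" and L rr :: "real \<Rightarrow> real"
  assumes gd: "\<And>t. (\<gamma> has_vector_derivative D t) (at t)"
    and Ld: "\<And>t. (L has_real_derivative rr t) (at t)"
    and K: "0 < K" and bd: "\<forall>\<^sub>F t in at_top. \<gamma> t \<noteq> a \<and> norm (D t) \<le> K * rr t * norm (\<gamma> t - a)"
    and lim: "filterlim (\<lambda>t. \<bar>ln ((norm (\<gamma> t - a))\<^sup>2)\<bar>) at_top at_top"
  shows "filterlim L at_top at_top"
proof -
  obtain T where T: "\<And>t. T \<le> t \<Longrightarrow> \<gamma> t \<noteq> a \<and> norm (D t) \<le> K * rr t * norm (\<gamma> t - a)"
    using bd unfolding eventually_at_top_linorder by blast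
  define w where "w = (\<lambda>t. ln ((\<gamma> t - a) \<bullet> (\<gamma> t - a)))"
  define w' where "w' = (\<lambda>t. 2 * ((\<gamma> t - a) \<bullet> D t) / ((\<gamma> t - a) \<bullet> (\<gamma> t - a)))"
  have wd: "(w has_real_derivative w' t) (at t)" if "T \<le> t" for t
  proof -
    have "((\<lambda>t. \<gamma> t - a) has_derivative (\<lambda>h. h *\<^sub>R D t)) (at t)"
      using has_vector_derivative_diff [OF gd [of t] has_vector_derivative_const [of a]]
      unfolding has_vector_derivative_def by simp
    then have "((\<lambda>t. (\<gamma> t - a) \<bullet> (\<gamma> t - a)) has_derivative
        (\<lambda>h. (\<gamma> t - a) \<bullet> (h *\<^sub>R D t) + (h *\<^sub>R D t) \<bullet> (\<gamma> t - a))) (at t)"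
      by (intro has_derivative_inner)
    then have "((\<lambda>t. (\<gamma> t - a) \<bullet> (\<gamma> t - a)) has_real_derivative 2 * ((\<gamma> t - a) \<bullet> D t)) (at t)"
      unfolding has_field_derivative_def
      by (rule has_derivative_eq_rhs) (auto simp: fun_eq_iff inner_commute)
    from DERIV_chain2 [OF DERIV_ln_divide this] show ?thesis
      using T [OF that] by (simp add: w_def [abs_def] w'_def)
  qed
  have wb: "norm (w' t) \<le> 2 * K * rr t" if "T \<le> t" for t
  proof -
    have n: "0 < norm (\<gamma> t - a)" using T [OF that] by simp
    have "\<bar>(\<gamma> t - a) \<bullet> D t\<bar> \<le> norm (\<gamma> t - a) * norm (D t)" by (rule Cauchy_Schwarz_ineq2)
    also have "\<dots> \<le> norm (\<gamma> t - a) * (K * rr t * norm (\<gamma> t - a))"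
      using T [OF that] by (intro mult_left_mono) auto
    finally have "2 * \<bar>(\<gamma> t - a) \<bullet> D t\<bar> \<le> (2 * K * rr t) * ((\<gamma> t - a) \<bullet> (\<gamma> t - a))"
      by (simp add: dot_square_norm power2_eq_square mult_ac)
    moreover have "0 < (\<gamma> t - a) \<bullet> (\<gamma> t - a)" using n by simp
    ultimately show ?thesis
      unfolding w'_def real_norm_def abs_divide abs_mult by (simp add: pos_divide_le_eq)
  qed
  have le: "L T + (\<bar>w t\<bar> - \<bar>w T\<bar>) / (2 * K) \<le> L t" if "T < t" for t
  proof -
    have "norm (w t - w T) \<le> 2 * K * L t - 2 * K * L T"
    proof (rule differentiable_bound_general [OF that, where \<phi> = "\<lambda>t. 2 * K * L t" and \<phi>' = "\<lambda>t. 2 * K * rr t" and f' = w'])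
      show "continuous_on {T..t} w"
        by (intro continuous_at_imp_continuous_on ballI DERIV_isCont [OF wd]) simp
      show "continuous_on {T..t} (\<lambda>t. 2 * K * L t)"
        by (intro continuous_at_imp_continuous_on ballI DERIV_isCont [OF DERIV_cmult [OF Ld]])
      show "(w has_vector_derivative w' x) (at x)" if "T < x" for x
        using wd [of x] that by (simp add: has_real_derivative_iff_has_vector_derivative)
      show "((\<lambda>t. 2 * K * L t) has_vector_derivative 2 * K * rr x) (at x)" for x
        using DERIV_cmult [OF Ld [of x], of "2 * K"] by (simp add: has_real_derivative_iff_has_vector_derivative)
      show "norm (w' x) \<le> 2 * K * rr x" if "T < x" for x using wb [of x] that by simp
    qed
    then have "\<bar>w t\<bar> - \<bar>w T\<bar> \<le> (L t - L T) * (2 * K)"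
      using abs_triangle_ineq2 [of "w t" "w T"] by (simp add: algebra_simps)
    then have "(\<bar>w t\<bar> - \<bar>w T\<bar>) / (2 * K) \<le> L t - L T" using K by (simp add: pos_divide_le_eq)
    then show ?thesis by simp
  qed
  have "filterlim (\<lambda>t. \<bar>w t\<bar>) at_top at_top"
    using lim by (simp add: w_def dot_square_norm)
  then have "filterlim (\<lambda>t. (L T - \<bar>w T\<bar> / (2 * K)) + (1 / (2 * K)) * \<bar>w t\<bar>) at_top at_top"
    by (intro filterlim_tendsto_add_at_top [OF tendsto_const] filterlim_tendsto_pos_mult_at_top [OF tendsto_const])
      (use K in simp_all)
  then show ?thesis
  proof (rule filterlim_at_top_mono)
    show "\<forall>\<^sub>F t in at_top. (L T - \<bar>w T\<bar> / (2 * K)) + (1 / (2 * K)) * \<bar>w t\<bar> \<le> L t"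
      using eventually_gt_at_top [of T]
    proof eventually_elim
      case (elim t)
      then show ?case using le [OF elim] by (simp add: diff_divide_distrib)
    qed
  qed
qed

lemma curve_end_at_pole:
  fixes \<gamma> D s :: "real \<Rightarrow> complex" and L rr :: "real \<Rightarrow> real"
  assumes p: "p \<in> rat_poles (coeff q 0)"
    and ord0: "2 \<le> pole_order (coeff q 0) p"
    and ordk: "\<And>k. pole_order (coeff q k) p \<le> pole_order (coeff q 0) p"
    and lim: "limitin riemann_sphere (\<lambda>t. Some (\<gamma> t)) p at_top"
    and gd: "\<And>t. (\<gamma> has_vector_derivative D t) (at t)"
    and Ld: "\<And>t. (L has_real_derivative rr t) (at t)"
    and sD: "\<And>t. norm (s t) * norm (D t) = rr t"
    and s2: "\<And>t. (s t)\<^sup>2 = rat_eval (coeff q 0) (\<gamma> t)"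
    and ne: "\<And>t. rat_eval (coeff q 0) (\<gamma> t) \<noteq> 0"
  shows "(\<exists>\<delta>>0. \<exists>C. \<forall>\<^sub>F t in at_top. good_disc q \<delta> C (\<gamma> t)) \<and> filterlim L at_top at_top"
proof -
  have rr0: "0 \<le> rr t" for t using sD [of t] by (metis mult_nonneg_nonneg norm_ge_zero)
  have ns: "(norm (s t))\<^sup>2 = norm (rat_eval (coeff q 0) (\<gamma> t))" for t
    using s2 [of t] by (metis norm_power)
  show ?thesis
  proof (cases p)
    case (Some a)
    have lim': "(\<gamma> \<longlongrightarrow> a) at_top" by (rule limitin_riemann_sphere_Some) (use lim Some in simp)
    have ga: "\<gamma> t \<noteq> a" for t
      using rat_eval_nonzero_regular [OF ne [of t]] p Some by auto
    obtain \<eta> \<delta> C c where \<eta>: "0 < \<eta>" "0 < \<delta>" "0 < c"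
      and G: "\<And>x. x \<noteq> a \<Longrightarrow> norm (x - a) < \<eta> \<Longrightarrow>
        good_disc q \<delta> C x \<and> c \<le> norm (rat_eval (coeff q 0) x) * (norm (x - a))\<^sup>2"
      by (rule good_disc_near_finite_pole [OF p [unfolded Some] ord0 [unfolded Some] ordk [unfolded Some]]) blast
    have near: "\<forall>\<^sub>F t in at_top. norm (\<gamma> t - a) < \<eta>"
      using tendstoD [OF lim' \<eta>(1)] by (simp add: dist_norm)
    have good: "\<forall>\<^sub>F t in at_top. good_disc q \<delta> C (\<gamma> t)"
      using near by eventually_elim (use G ga in blast)
    have "filterlim L at_top at_top"
    proof (rule curve_length_unbounded [OF gd Ld, where a = a and K = "1 / sqrt c"])
      show "0 < 1 / sqrt c" using \<eta> by simp
      show "\<forall>\<^sub>F t in at_top. \<gamma> t \<noteq> a \<and> norm (D t) \<le> 1 / sqrt c * rr t * norm (\<gamma> t - a)"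
        using near
      proof eventually_elim
        case (elim t)
        have "c \<le> (norm (s t) * norm (\<gamma> t - a))\<^sup>2"
          using G [OF ga elim] ns [of t] by (simp add: power_mult_distrib)
        then have "sqrt c \<le> norm (s t) * norm (\<gamma> t - a)" by (rule real_le_lsqrt [rotated 1]) auto
        then have "sqrt c * norm (D t) \<le> (norm (s t) * norm (\<gamma> t - a)) * norm (D t)"
          by (rule mult_right_mono) simp
        also have "\<dots> = rr t * norm (\<gamma> t - a)" using sD [of t] by (simp add: mult_ac)
        finally show ?case using ga \<eta>(3) by (simp add: pos_le_divide_eq mult.commute)
      qed
      have "((\<lambda>t. (norm (\<gamma> t - a))\<^sup>2) \<longlongrightarrow> (norm (a - a))\<^sup>2) at_top"
        by (intro tendsto_intros lim')
      then have "filterlim (\<lambda>t. (norm (\<gamma> t - a))\<^sup>2) (at_right 0) at_top"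
        using ga by (simp add: filterlim_at)
      then have "filterlim (\<lambda>t. ln ((norm (\<gamma> t - a))\<^sup>2)) at_bot at_top"
        by (rule filterlim_compose [OF ln_at_0])
      then have "filterlim (\<lambda>t. ln ((norm (\<gamma> t - a))\<^sup>2)) at_infinity at_top"
        by (rule filterlim_mono [OF _ at_bot_le_at_infinity order_refl])
      from filterlim_at_infinity_imp_norm_at_top [OF this]
      show "filterlim (\<lambda>t. \<bar>ln ((norm (\<gamma> t - a))\<^sup>2)\<bar>) at_top at_top" by simp
    qed
    then show ?thesis using good \<eta>(2) by blast
  next
    case None
    have lim': "\<forall>\<^sub>F t in at_top. R < norm (\<gamma> t)" for R
      by (rule limitin_riemann_sphere_None) (use lim None in simp)
    obtain R \<delta> C c where R: "0 < R" "0 < \<delta>" "0 < c"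
      and G: "\<And>x. R < norm x \<Longrightarrow> good_disc q \<delta> C x \<and> c * (norm x)\<^sup>2 \<le> norm (rat_eval (coeff q 0) x)"
      by (rule good_disc_near_infinity [OF p [unfolded None] ord0 [unfolded None] ordk [unfolded None]]) blast
    have near: "\<forall>\<^sub>F t in at_top. max R 1 < norm (\<gamma> t)" by (rule lim')
    have good: "\<forall>\<^sub>F t in at_top. good_disc q \<delta> C (\<gamma> t)"
      using near by eventually_elim (use G in auto)
    have "filterlim L at_top at_top"
    proof (rule curve_length_unbounded [OF gd Ld, where a = 0 and K = "1 / sqrt c"])
      show "0 < 1 / sqrt c" using R by simp
      show "\<forall>\<^sub>F t in at_top. \<gamma> t \<noteq> 0 \<and> norm (D t) \<le> 1 / sqrt c * rr t * norm (\<gamma> t - 0)"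
        using near
      proof eventually_elim
        case (elim t)
        have n: "R < norm (\<gamma> t)" "1 < norm (\<gamma> t)" using elim by auto
        have "c * 1 \<le> c * (norm (\<gamma> t))\<^sup>2" using R n by (intro mult_left_mono) (auto simp: one_le_power)
        then have "c \<le> (norm (s t))\<^sup>2" using G [OF n(1)] ns [of t] by simp
        then have "sqrt c \<le> norm (s t)" by (rule real_le_lsqrt [rotated 1]) auto
        then have "sqrt c * norm (D t) \<le> norm (s t) * norm (D t)" by (rule mult_right_mono) simp
        also have "\<dots> = rr t * 1" using sD [of t] by simp
        also have "\<dots> \<le> rr t * norm (\<gamma> t)" using rr0 n by (intro mult_left_mono) auto
        finally show ?case using n R(3) by (auto simp: pos_le_divide_eq mult.commute)
      qed
      have "filterlim (\<lambda>t. norm (\<gamma> t)) at_top at_top"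
        unfolding filterlim_at_top_dense using lim' by blast
      then have "filterlim (\<lambda>t. (norm (\<gamma> t))\<^sup>2) at_top at_top"
        by (intro filterlim_pow_at_top) auto
      then have "filterlim (\<lambda>t. ln ((norm (\<gamma> t))\<^sup>2)) at_top at_top"
        by (rule filterlim_compose [OF ln_at_top])
      then have "filterlim (\<lambda>t. ln ((norm (\<gamma> t))\<^sup>2)) at_infinity at_top"
        by (rule filterlim_mono [OF _ at_top_le_at_infinity order_refl])
      from filterlim_at_infinity_imp_norm_at_top [OF this]
      show "filterlim (\<lambda>t. \<bar>ln ((norm (\<gamma> t - 0))\<^sup>2)\<bar>) at_top at_top" by simp
    qed
    then show ?thesis using good R(2) by blast
  qed
qed

text \<open>The existence of common constants is a property of sets that passes to finite unions, as needed for a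
  compactness argument.\<close>

definition uniformly_good :: "complex poly fract poly \<Rightarrow> complex set \<Rightarrow> bool" where
  "uniformly_good q S \<longleftrightarrow> (\<exists>\<delta>>0. \<exists>C. \<forall>x\<in>S. good_disc q \<delta> C x)"

lemma uniformly_good_Un:
  assumes "uniformly_good q S" "uniformly_good q T"
  shows "uniformly_good q (S \<union> T)"
proof -
  obtain \<delta> C where 1: "0 < \<delta>" "\<And>x. x \<in> S \<Longrightarrow> good_disc q \<delta> C x" using assms(1) by (auto simp: uniformly_good_def)
  obtain \<delta>' C' where 2: "0 < \<delta>'" "\<And>x. x \<in> T \<Longrightarrow> good_disc q \<delta>' C' x" using assms(2) by (auto simp: uniformly_good_def)
  have "good_disc q (min \<delta> \<delta>') (max C C') x" if "x \<in> S \<union> T" for x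
  proof (cases "x \<in> S")
    case True
    show ?thesis by (rule good_disc_mono [OF 1(2) [OF True]]) (use 1 2 in auto)
  next
    case False
    then have "x \<in> T" using that by simp
    show ?thesis by (rule good_disc_mono [OF 2(2) [OF \<open>x \<in> T\<close>]]) (use 1 2 in auto)
  qed
  then show ?thesis unfolding uniformly_good_def using 1(1) 2(1)
    by (intro exI [of _ "min \<delta> \<delta>'"] conjI exI [of _ "max C C'"]) auto
qed

lemma uniformly_good_compact:
  assumes K: "compact K" and ne: "\<And>x. x \<in> K \<Longrightarrow> rat_eval (coeff q 0) x \<noteq> 0"
    and poles: "\<And>k. rat_poles (coeff q k) \<subseteq> rat_poles (coeff q 0)"
  shows "uniformly_good q K"
proof -
  define \<T> where "\<T> = {N. open N \<and> uniformly_good q N}"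
  have "K \<subseteq> \<Union>\<T>"
  proof
    fix x assume "x \<in> K"
    obtain \<epsilon> \<delta> C where "0 < \<epsilon>" "0 < \<delta>" "\<And>y. y \<in> ball x \<epsilon> \<Longrightarrow> good_disc q \<delta> C y"
      by (rule good_disc_near_regular [OF ne [OF \<open>x \<in> K\<close>] poles]) blast
    then have "uniformly_good q (ball x \<epsilon>)" unfolding uniformly_good_def by blast
    moreover have "x \<in> ball x \<epsilon>" using \<open>0 < \<epsilon>\<close> by simp
    ultimately have "ball x \<epsilon> \<in> \<T>" "x \<in> ball x \<epsilon>" by (auto simp: \<T>_def)
    then show "x \<in> \<Union>\<T>" by blast
  qed
  then obtain \<T>' where T': "\<T>' \<subseteq> \<T>" "finite \<T>'" "K \<subseteq> \<Union>\<T>'"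
    by (rule compactE [OF K]) (auto simp: \<T>_def)
  have "uniformly_good q (\<Union>\<T>')"
    using T'(2,1)
  proof (induction \<T>' rule: finite_induct)
    case empty
    then show ?case by (auto simp: uniformly_good_def intro!: exI [of _ 1])
  next
    case (insert N \<T>'')
    then have "uniformly_good q (N \<union> \<Union>\<T>'')"
      by (intro uniformly_good_Un) (auto simp: \<T>_def)
    then show ?case by simp
  qed
  then show ?thesis using T'(3) unfolding uniformly_good_def by blast
qed

text \<open>The function \<open>L\<close> is the coordinate \<open>z\<close> along the curve. Since it is a bijection of the real line, its
  inverse parametrises the curve by \<open>z\<close>.\<close>

lemma wkb_charts_of_increasing_curve:
  fixes \<gamma> D s :: "real \<Rightarrow> complex" and L rr :: "real \<Rightarrow> real"
  assumes order_q0: "\<forall>p \<in> rat_poles (coeff q 0). pole_order (coeff q 0) p \<ge> 2"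
    and poles: "\<And>k. rat_poles (coeff q k) \<subseteq> rat_poles (coeff q 0)"
    and order_qk: "\<forall>p \<in> rat_poles (coeff q 0). \<forall>k. pole_order (coeff q k) p \<le> pole_order (coeff q 0) p"
    and lim1: "\<exists>p \<in> rat_poles (coeff q 0). limitin riemann_sphere (\<lambda>t. Some (\<gamma> t)) p at_top"
    and lim2: "\<exists>p \<in> rat_poles (coeff q 0). limitin riemann_sphere (\<lambda>t. Some (\<gamma> t)) p at_bot"
    and gd: "\<And>t. (\<gamma> has_vector_derivative D t) (at t)"
    and Ld: "\<And>t. (L has_real_derivative rr t) (at t)"
    and L0: "L 0 = 0"
    and sD: "\<And>t. s t * D t = of_real (rr t)" and rr: "\<And>t. 0 < rr t"
    and s: "continuous_on UNIV s" "\<And>t. (s t)\<^sup>2 = rat_eval (coeff q 0) (\<gamma> t)"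
    and ne: "\<And>t. rat_eval (coeff q 0) (\<gamma> t) \<noteq> 0"
  shows "\<exists>d X \<sigma>. wkb_chart q (\<gamma> 0) (s 0) d X \<sigma> \<and> wkb_chart q (\<gamma> 0) (- s 0) d (\<lambda>z. X (- z)) (\<lambda>z. - \<sigma> (- z))"
proof -
  have nsD: "norm (s t) * norm (D t) = rr t" for t
    using sD [of t] rr [of t] by (metis abs_of_pos norm_mult norm_of_real)
  obtain \<delta>1 C1 where g1: "0 < \<delta>1" "\<forall>\<^sub>F t in at_top. good_disc q \<delta>1 C1 (\<gamma> t)" and Ltop: "filterlim L at_top at_top"
  proof -
    obtain p where p: "p \<in> rat_poles (coeff q 0)" "limitin riemann_sphere (\<lambda>t. Some (\<gamma> t)) p at_top"
      using lim1 by blast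
    have "(\<exists>\<delta>>0. \<exists>C. \<forall>\<^sub>F t in at_top. good_disc q \<delta> C (\<gamma> t)) \<and> filterlim L at_top at_top"
      by (rule curve_end_at_pole [OF p(1) _ _ p(2) gd Ld nsD s(2) ne]) (use p(1) order_q0 order_qk in auto)
    then show thesis using that by blast
  qed
  obtain \<delta>2 C2 where g2: "0 < \<delta>2" "\<forall>\<^sub>F t in at_top. good_disc q \<delta>2 C2 (\<gamma> (- t))"
    and Lbot: "filterlim (\<lambda>t. - L (- t)) at_top at_top"
  proof -
    obtain p where p: "p \<in> rat_poles (coeff q 0)" "limitin riemann_sphere (\<lambda>t. Some (\<gamma> t)) p at_bot"
      using lim2 by blast
    have lim: "limitin riemann_sphere (\<lambda>t. Some (\<gamma> (- t))) p at_top"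
      using p(2) by (simp add: limitin_def at_bot_mirror eventually_filtermap)
    have gd': "((\<lambda>t. \<gamma> (- t)) has_vector_derivative - D (- t)) (at t)" for t
    proof -
      have "((\<gamma> \<circ> uminus) has_vector_derivative (- 1) *\<^sub>R D (- t)) (at t)"
        by (rule vector_diff_chain_at [OF _ gd]) (auto intro!: derivative_eq_intros)
      then show ?thesis by (simp add: o_def)
    qed
    have Ld': "((\<lambda>t. - L (- t)) has_real_derivative rr (- t)) (at t)" for t
      using DERIV_minus [OF DERIV_chain2 [OF Ld [of "- t"] DERIV_minus [OF DERIV_ident]]] by simp
    have "(\<exists>\<delta>>0. \<exists>C. \<forall>\<^sub>F t in at_top. good_disc q \<delta> C (\<gamma> (- t))) \<and> filterlim (\<lambda>t. - L (- t)) at_top at_top"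
      by (rule curve_end_at_pole [OF p(1) _ _ lim gd' Ld', where s = "\<lambda>t. s (- t)"])
        (use p(1) order_q0 order_qk nsD s(2) ne in auto)
    then show thesis using that by blast
  qed
  obtain T1 where T1: "\<And>t. T1 \<le> t \<Longrightarrow> good_disc q \<delta>1 C1 (\<gamma> t)"
    using g1(2) unfolding eventually_at_top_linorder by blast
  obtain T2 where T2: "\<And>t. T2 \<le> t \<Longrightarrow> good_disc q \<delta>2 C2 (\<gamma> (- t))"
    using g2(2) unfolding eventually_at_top_linorder by blast
  have gcont: "continuous_on S \<gamma>" for S
    by (intro continuous_at_imp_continuous_on ballI has_vector_derivative_continuous [OF gd])
  have "uniformly_good q (\<gamma> ` {T1..})" using T1 g1(1) by (auto simp: uniformly_good_def)
  moreover have "uniformly_good q (\<gamma> ` {..- T2})"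
  proof -
    have "good_disc q \<delta>2 C2 (\<gamma> t)" if "t \<le> - T2" for t using T2 [of "- t"] that by simp
    then show ?thesis using g2(1) by (auto simp: uniformly_good_def)
  qed
  moreover have "uniformly_good q (\<gamma> ` {- T2..T1})"
    by (rule uniformly_good_compact [OF compact_continuous_image [OF gcont] _ poles]) (use ne in auto)
  ultimately have "uniformly_good q (\<gamma> ` {T1..} \<union> \<gamma> ` {..- T2} \<union> \<gamma> ` {- T2..T1})"
    by (intro uniformly_good_Un)
  moreover have "\<gamma> t \<in> \<gamma> ` {T1..} \<union> \<gamma> ` {..- T2} \<union> \<gamma> ` {- T2..T1}" for t
    by (cases "T1 \<le> t"; cases "t \<le> - T2") auto
  ultimately obtain \<delta> C where \<delta>: "0 < \<delta>" and good: "\<And>t. good_disc q \<delta> C (\<gamma> t)"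
    unfolding uniformly_good_def by blast
  have mono: "strict_mono L"
    by (rule strict_monoI, rule DERIV_pos_imp_increasing) (use Ld rr in blast)+
  have Lcont: "isCont L t" for t using Ld by (rule DERIV_isCont)
  have surj: "\<exists>t. L t = y" for y
  proof -
    obtain b where b: "y \<le> L b" using Ltop unfolding filterlim_at_top eventually_at_top_linorder by blast
    obtain a where a: "- y \<le> - L (- a)" using Lbot unfolding filterlim_at_top eventually_at_top_linorder by blast
    have "L (- a) \<le> y" using a by simp
    then have "L (- a) \<le> L b" using b by linarith
    then have "- a \<le> b" using mono by (simp add: strict_mono_less_eq)
    then show ?thesis using IVT [of L "- a" y b] \<open>L (- a) \<le> y\<close> b Lcont by blast
  qed
  define T where "T = inv L"
  have LT: "L (T y) = y" for y unfolding T_def using surj by (metis f_inv_into_f rangeI)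
  have TL: "T (L t) = t" for t unfolding T_def by (rule inv_f_f [OF strict_mono_imp_inj_on [OF mono]])
  have Tcont: "isCont T y" for y
    using isCont_inverse_function [of 1 "T y" T L] TL Lcont LT by simp
  have Td: "(T has_real_derivative inverse (rr (T y))) (at y)" for y
    by (rule DERIV_inverse_function [where f = L and a = "y - 1" and b = "y + 1"])
      (use Ld rr [of "T y"] LT Tcont in auto)
  have T0: "T 0 = 0" using TL [of 0] L0 by simp
  have "\<exists>d X \<sigma>. wkb_chart q (\<gamma> (T 0)) (s (T 0)) d X \<sigma> \<and> wkb_chart q (\<gamma> (T 0)) (- s (T 0)) d (\<lambda>z. X (- z)) (\<lambda>z. - \<sigma> (- z))"
  proof (rule wkb_charts_of_curve [OF \<delta>, where c = "\<lambda>t. \<gamma> (T t)" and v = "\<lambda>t. s (T t)"])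
    show "continuous_on UNIV (\<lambda>t. s (T t))"
      by (rule continuous_on_compose2 [OF s(1)]) (use Tcont in \<open>auto simp: continuous_on_eq_continuous_at\<close>)
    show "((\<lambda>t. \<gamma> (T t)) has_vector_derivative 1 / s (T t)) (at t)" for t
    proof -
      have "((\<gamma> \<circ> T) has_vector_derivative inverse (rr (T t)) *\<^sub>R D (T t)) (at t)"
        by (rule vector_diff_chain_at [OF _ gd]) (use Td in \<open>simp add: has_real_derivative_iff_has_vector_derivative\<close>)
      moreover have "inverse (rr (T t)) *\<^sub>R D (T t) = 1 / s (T t)"
      proof -
        have "s (T t) \<noteq> 0" using sD [of "T t"] rr [of "T t"] by auto
        moreover have "inverse (rr (T t)) *\<^sub>R (s (T t) * D (T t)) = 1"
          using rr [of "T t"] by (simp add: sD scaleR_conv_of_real)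
        ultimately show ?thesis by (simp add: field_simps)
      qed
      ultimately show ?thesis by (simp add: o_def)
    qed
  qed (use good s poles in auto)
  then show ?thesis by (simp add: T0)
qed

text \<open>Differentiating the defining condition of the level curve shows that \<open>s \<gamma>'\<close> is real, and it has
  constant sign because it has no zero. If it is negative, the curve is traversed backwards.\<close>

theorem wkb_charts_of_level_curve:
  assumes order_q0: "\<forall>p \<in> rat_poles (coeff q 0). pole_order (coeff q 0) p \<ge> 2"
    and poles: "\<And>k. rat_poles (coeff q k) \<subseteq> rat_poles (coeff q 0)"
    and order_qk: "\<forall>p \<in> rat_poles (coeff q 0). \<forall>k. pole_order (coeff q k) p \<le> pole_order (coeff q 0) p"
    and curve: "level_curve (coeff q 0) x0 s0 \<gamma>"
    and lim1: "\<exists>p \<in> rat_poles (coeff q 0). limitin riemann_sphere (\<lambda>t. Some (\<gamma> t)) p at_top"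
    and lim2: "\<exists>p \<in> rat_poles (coeff q 0). limitin riemann_sphere (\<lambda>t. Some (\<gamma> t)) p at_bot"
  shows "\<exists>d X \<sigma>. wkb_chart q x0 s0 d X \<sigma> \<and> wkb_chart q x0 (- s0) d (\<lambda>z. X (- z)) (\<lambda>z. - \<sigma> (- z))"
proof -
  define D where "D = (\<lambda>t. vector_derivative \<gamma> (at t))"
  have g0: "\<gamma> 0 = x0" and Dn: "\<And>t. D t \<noteq> 0" and ne: "\<And>t. rat_eval (coeff q 0) (\<gamma> t) \<noteq> 0"
    and C1: "\<gamma> C1_differentiable_on UNIV"
    using curve by (auto simp: level_curve_def D_def)
  obtain s where s: "continuous_on UNIV s" "s 0 = s0" "\<And>t. (s t)\<^sup>2 = rat_eval (coeff q 0) (\<gamma> t)"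
    and Im: "\<And>t::real. Im (LBINT \<tau>=0..t. s \<tau> * D \<tau>) = 0"
    using curve unfolding level_curve_def D_def by blast
  have gd: "(\<gamma> has_vector_derivative D t) (at t)" for t
    using C1 unfolding C1_differentiable_on_eq D_def by (simp add: vector_derivative_works)
  have Dc: "continuous_on UNIV D" using C1 unfolding C1_differentiable_on_eq D_def by simp
  define J where "J = (\<lambda>t::real. LBINT \<tau>=0..t. s \<tau> * D \<tau>)"
  have Jd: "(J has_vector_derivative s t * D t) (at t)" for t
  proof -
    define b where "b = \<bar>t\<bar> + 1"
    have "((\<lambda>u. LBINT y=ereal 0..ereal u. s y * D y) has_vector_derivative s t * D t) (at t within {- b..b})"
      by (rule interval_integral_FTC2)
        (auto simp: b_def intro!: continuous_intros continuous_on_subset [OF s(1)] continuous_on_subset [OF Dc])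
    moreover have "at t within {- b..b} = at t" by (rule at_within_interior) (auto simp: b_def)
    ultimately show ?thesis by (simp add: J_def zero_ereal_def)
  qed
  have J0: "J 0 = 0" by (simp add: J_def zero_ereal_def [symmetric])
  define rr where "rr = (\<lambda>t. Re (s t * D t))"
  define L where "L = (\<lambda>t. Re (J t))"
  have L0: "L 0 = 0" by (simp add: L_def J0)
  have Ld: "(L has_real_derivative rr t) (at t)" for t
    using bounded_linear.has_vector_derivative [OF bounded_linear_Re Jd [of t]]
    by (simp add: L_def rr_def has_real_derivative_iff_has_vector_derivative)
  have "Im (s t * D t) = 0" for t
  proof -
    have "((\<lambda>t. Im (J t)) has_vector_derivative Im (s t * D t)) (at t)"
      by (rule bounded_linear.has_vector_derivative [OF bounded_linear_Im Jd])
    moreover have "(\<lambda>t. Im (J t)) = (\<lambda>t. 0)" using Im by (simp add: J_def)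
    ultimately have "((\<lambda>t. 0 :: real) has_vector_derivative Im (s t * D t)) (at t)" by simp
    then show ?thesis using vector_derivative_unique_at [OF _ has_vector_derivative_const] by blast
  qed
  then have sD: "s t * D t = of_real (rr t)" for t by (simp add: rr_def complex_eq_iff)
  have sn: "s t \<noteq> 0" for t using s(3) [of t] ne [of t] by auto
  have rr0: "rr t \<noteq> 0" for t using sD [of t] sn [of t] Dn [of t] by (metis mult_eq_0_iff of_real_0)
  have rrc: "continuous_on UNIV rr" unfolding rr_def by (intro continuous_intros s(1) Dc)
  have int: "is_interval (range rr)"
    using connected_continuous_image [OF rrc] by (simp add: is_interval_connected_1)
  consider "\<And>t. 0 < rr t" | "\<And>t. rr t < 0"
  proof (cases "0 < rr 0")
    case True
    have "0 < rr t" for t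
    proof (rule ccontr)
      assume "\<not> 0 < rr t"
      then have "0 \<in> range rr" using int True unfolding is_interval_1 by (meson less_imp_le not_less rangeI)
      then show False using rr0 by auto
    qed
    then show ?thesis by (rule that(1))
  next
    case False
    have "rr t < 0" for t
    proof (rule ccontr)
      assume "\<not> rr t < 0"
      then have "0 \<in> range rr" using int False unfolding is_interval_1 by (meson less_imp_le not_less rangeI)
      then show False using rr0 by auto
    qed
    then show ?thesis by (rule that(2))
  qed
  then show ?thesis
  proof cases
    case 1
    show ?thesis
      using wkb_charts_of_increasing_curve [OF order_q0 poles order_qk lim1 lim2 gd Ld L0 sD 1 s(1,3) ne]
      by (simp add: g0 s(2))
  next
    case 2
    have "\<exists>d X \<sigma>. wkb_chart q (\<gamma> (- 0)) (s (- 0)) d X \<sigma> \<and> wkb_chart q (\<gamma> (- 0)) (- s (- 0)) d (\<lambda>z. X (- z)) (\<lambda>z. - \<sigma> (- z))"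
    proof (rule wkb_charts_of_increasing_curve [OF order_q0 poles order_qk, where \<gamma> = "\<lambda>t. \<gamma> (- t)"
          and D = "\<lambda>t. - D (- t)" and L = "\<lambda>t. L (- t)" and rr = "\<lambda>t. - rr (- t)" and s = "\<lambda>t. s (- t)"])
      show "\<exists>p\<in>rat_poles (coeff q 0). limitin riemann_sphere (\<lambda>t. Some (\<gamma> (- t))) p at_top"
        using lim2 by (simp add: limitin_def at_bot_mirror eventually_filtermap)
      show "\<exists>p\<in>rat_poles (coeff q 0). limitin riemann_sphere (\<lambda>t. Some (\<gamma> (- t))) p at_bot"
        using lim1 by (simp add: limitin_def at_bot_mirror eventually_filtermap)
      show "((\<lambda>t. \<gamma> (- t)) has_vector_derivative - D (- t)) (at t)" for t
      proof -
        have "((\<gamma> \<circ> uminus) has_vector_derivative (- 1) *\<^sub>R D (- t)) (at t)"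
          by (rule vector_diff_chain_at [OF _ gd]) (auto intro!: derivative_eq_intros)
        then show ?thesis by (simp add: o_def)
      qed
      show "((\<lambda>t. L (- t)) has_real_derivative - rr (- t)) (at t)" for t
        using DERIV_chain2 [OF Ld [of "- t"] DERIV_minus [OF DERIV_ident]] by simp
      show "continuous_on UNIV (\<lambda>t. s (- t))"
        by (rule continuous_on_compose2 [OF s(1)]) (auto intro!: continuous_intros)
    qed (use L0 sD 2 s ne in auto)
    then show ?thesis by (simp add: g0 s(2))
  qed
qed

section \<open>Exact WKB solutions\<close>

text \<open>The disc contains \<open>rcis \<rho> \<theta>\<close> for \<open>0 < \<rho> < 2 r cos \<theta>\<close>. Every direction of the open right half-plane is
  therefore attained arbitrarily close to \<open>0\<close>, and the two vertical directions are limits of such.\<close>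

lemma sectorial_domain_disc:
  assumes r: "0 < r"
  shows "sectorial_domain (- pi / 2) (pi / 2) (ball (of_real r) r)"
proof -
  define F where "F = (\<lambda>h :: complex. (norm h, sgn h))"
  define B where "B = ball (complex_of_real r) r"
  have "{u. (0, u) \<in> closure (F ` B)} = cis ` {- pi / 2..pi / 2}"
  proof
    show "{u. (0, u) \<in> closure (F ` B)} \<subseteq> cis ` {- pi / 2..pi / 2}"
    proof clarify
      fix u assume u: "(0, u) \<in> closure (F ` B)"
      define S where "S = {p :: real \<times> complex. norm (snd p) = 1} \<inter> {p. 0 \<le> Re (snd p)}"
      have "closed S"
        unfolding S_def by (intro closed_Int closed_Collect_eq closed_Collect_le continuous_intros)
      moreover have "F ` B \<subseteq> S"
      proof
        fix p assume "p \<in> F ` B"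
        then obtain h where h: "h \<in> B" "p = F h" by blast
        then have "h \<noteq> 0" "0 < Re h" using tangent_disc(1,2) unfolding B_def by blast+
        then show "p \<in> S" by (simp add: S_def h(2) F_def norm_sgn Re_sgn)
      qed
      ultimately have "(0, u) \<in> S" using u closure_minimal by blast
      then have un: "norm u = 1" and uR: "0 \<le> Re u" by (auto simp: S_def)
      have sq: "(Re u)\<^sup>2 + (Im u)\<^sup>2 = 1" using un cmod_power2 [of u] by simp
      have I: "- 1 \<le> Im u" "Im u \<le> 1" using abs_Im_le_cmod [of u] un by auto
      have "cos (arcsin (Im u)) = sqrt ((Re u)\<^sup>2)"
      proof -
        have "1 - (Im u)\<^sup>2 = (Re u)\<^sup>2" using sq by simp
        then show ?thesis by (simp only: cos_arcsin [OF I])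
      qed
      then have "cis (arcsin (Im u)) = u" using I uR by (simp add: complex_eq_iff sin_arcsin)
      moreover have "arcsin (Im u) \<in> {- pi / 2..pi / 2}"
        using arcsin_lbound [OF I] arcsin_ubound [OF I] by simp
      ultimately show "u \<in> cis ` {- pi / 2..pi / 2}" by (metis imageI)
    qed
    show "cis ` {- pi / 2..pi / 2} \<subseteq> {u. (0, u) \<in> closure (F ` B)}"
    proof clarify
      fix \<theta> assume \<theta>: "\<theta> \<in> {- pi / 2..pi / 2}"
      \<comment> \<open>The directions \<open>t n\<close> avoid the vertical ones, where the disc contains no points.\<close>
      define t where "t = (\<lambda>n. \<theta> * (1 - 1 / (real n + 2)))"
      define \<rho> where "\<rho> = (\<lambda>n. r * cos (t n) * (1 / (real n + 1)))"
      have tb: "- pi / 2 < t n \<and> t n < pi / 2" for n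
      proof -
        have "\<bar>\<theta>\<bar> \<le> pi / 2" using \<theta> by auto
        moreover have c: "0 \<le> 1 - 1 / (real n + 2)" "1 - 1 / (real n + 2) < 1" by (auto simp: field_simps)
        ultimately have "\<bar>t n\<bar> \<le> pi / 2 * (1 - 1 / (real n + 2))"
          unfolding t_def abs_mult by (intro mult_mono) auto
        also have "\<dots> < pi / 2 * 1" using c pi_gt_zero by (intro mult_strict_left_mono) auto
        finally show ?thesis by auto
      qed
      have ct: "0 < cos (t n)" for n using tb [of n] by (intro cos_gt_zero_pi) auto
      have \<rho>0: "0 < \<rho> n" for n using ct [of n] r by (simp add: \<rho>_def)
      have mem: "rcis (\<rho> n) (t n) \<in> B" for n
      proof -
        have "\<rho> n \<le> r * cos (t n) * 1" unfolding \<rho>_def using r ct [of n] by (intro mult_left_mono) auto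
        then have lt: "\<rho> n < 2 * (r * cos (t n))" using \<rho>0 [of n] by linarith
        have "(norm (of_real r - rcis (\<rho> n) (t n)))\<^sup>2 = (r - \<rho> n * cos (t n))\<^sup>2 + (\<rho> n * sin (t n))\<^sup>2"
          by (simp add: cmod_power2)
        also have "\<dots> = r\<^sup>2 - 2 * (r * cos (t n)) * \<rho> n + (\<rho> n)\<^sup>2 * ((cos (t n))\<^sup>2 + (sin (t n))\<^sup>2)"
          by algebra
        also have "\<dots> = r\<^sup>2 + \<rho> n * (\<rho> n - 2 * (r * cos (t n)))"
          by (simp add: power2_eq_square algebra_simps)
        also have "\<dots> < r\<^sup>2" using \<rho>0 [of n] lt by (simp add: mult_less_0_iff)
        finally have "norm (of_real r - rcis (\<rho> n) (t n)) < r" by (rule power2_less_imp_less) (use r in simp)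
        then show ?thesis by (simp add: B_def dist_norm)
      qed
      have Fr: "F (rcis (\<rho> n) (t n)) = (\<rho> n, cis (t n))" for n
        using \<rho>0 [of n] by (simp add: F_def rcis_def sgn_mult sgn_of_real norm_mult sgn_cis) 
      have "t \<longlonglongrightarrow> \<theta>" unfolding t_def by real_asymp
      then have "(\<lambda>n. cis (t n)) \<longlonglongrightarrow> cis \<theta>" by (intro tendsto_cis)
      moreover have "\<rho> \<longlonglongrightarrow> 0"
      proof -
        have "\<rho> \<longlonglongrightarrow> r * cos \<theta> * 0"
          unfolding \<rho>_def by (intro tendsto_intros \<open>t \<longlonglongrightarrow> \<theta>\<close>) real_asymp
        then show ?thesis by simp
      qed
      ultimately have "(\<lambda>n. (\<rho> n, cis (t n))) \<longlonglongrightarrow> (0, cis \<theta>)" by (intro tendsto_Pair)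
      moreover have "(\<rho> n, cis (t n)) \<in> F ` B" for n using mem [of n] Fr [of n] by (metis imageI)
      ultimately show "(0, cis \<theta>) \<in> closure (F ` B)"
        unfolding closure_sequential by (intro exI [of _ "\<lambda>n. (\<rho> n, cis (t n))"] conjI allI)
    qed
  qed
  then show ?thesis
    unfolding sectorial_domain_def using r by (simp add: B_def F_def convex_imp_simply_connected)
qed

text \<open>The equation has no first order term, so Wronskians are constant, and Cramer's rule expresses an arbitrary
  solution.\<close>

lemma solution_basisI:
  assumes U: "open U" "convex U" "x0 \<in> U" and h: "h \<noteq> 0"
    and s1: "\<psi>1 \<in> schroedinger_solutions q U h" and s2: "\<psi>2 \<in> schroedinger_solutions q U h"
    and W0: "\<psi>1 x0 * deriv \<psi>2 x0 - deriv \<psi>1 x0 * \<psi>2 x0 \<noteq> 0"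
  shows "is_solution_basis q U h \<psi>1 \<psi>2"
proof -
  define V where "V = (\<lambda>x. poly (potential_at q x) h / h\<^sup>2)"
  define W where "W = (\<lambda>(\<phi> :: complex \<Rightarrow> complex) \<eta> x. \<phi> x * deriv \<eta> x - deriv \<phi> x * \<eta> x)"
  have d: "(\<phi> has_field_derivative deriv \<phi> x) (at x)" "(deriv \<phi> has_field_derivative V x * \<phi> x) (at x)"
    if \<phi>: "\<phi> \<in> schroedinger_solutions q U h" and x: "x \<in> U" for \<phi> x
  proof -
    have hol: "\<phi> holomorphic_on U" using \<phi> by (simp add: schroedinger_solutions_def)
    show "(\<phi> has_field_derivative deriv \<phi> x) (at x)" by (rule holomorphic_derivI [OF hol U(1) x])
    have "h\<^sup>2 * deriv (deriv \<phi>) x = poly (potential_at q x) h * \<phi> x"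
      using \<phi> x by (simp add: schroedinger_solutions_def numeral_2_eq_2)
    then have "deriv (deriv \<phi>) x = V x * \<phi> x" using h by (simp add: V_def field_simps)
    then show "(deriv \<phi> has_field_derivative V x * \<phi> x) (at x)"
      using holomorphic_derivI [OF holomorphic_deriv [OF hol U(1)] U(1) x] by simp
  qed
  have Wc: "\<exists>c. \<forall>x\<in>U. W \<phi> \<eta> x = c"
    if "\<phi> \<in> schroedinger_solutions q U h" "\<eta> \<in> schroedinger_solutions q U h" for \<phi> \<eta>
  proof (rule has_field_derivative_zero_constant [OF U(2)])
    fix x assume x: "x \<in> U"
    have "(W \<phi> \<eta> has_field_derivative 0) (at x)"
      unfolding W_def using d [OF that(1) x] d [OF that(2) x]
      by (auto intro!: derivative_eq_intros)
    then show "(W \<phi> \<eta> has_field_derivative 0) (at x within U)" by (rule has_field_derivative_at_within)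
  qed
  obtain w where w: "\<And>x. x \<in> U \<Longrightarrow> W \<psi>1 \<psi>2 x = w" using Wc [OF s1 s2] by blast
  have w0: "w \<noteq> 0" using w [OF U(3)] W0 by (simp add: W_def)
  have "\<exists>!(c1, c2). \<forall>x\<in>U. \<phi> x = c1 * \<psi>1 x + c2 * \<psi>2 x"
    if \<phi>: "\<phi> \<in> schroedinger_solutions q U h" for \<phi>
  proof -
    obtain a where a: "\<And>x. x \<in> U \<Longrightarrow> W \<phi> \<psi>2 x = a" using Wc [OF \<phi> s2] by blast
    obtain b where b: "\<And>x. x \<in> U \<Longrightarrow> W \<psi>1 \<phi> x = b" using Wc [OF s1 \<phi>] by blast
    show ?thesis
    proof (rule ex1I [of _ "(a / w, b / w)"])
      show "case (a / w, b / w) of (c1, c2) \<Rightarrow> \<forall>x\<in>U. \<phi> x = c1 * \<psi>1 x + c2 * \<psi>2 x"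
      proof (simp, intro ballI)
        fix x assume x: "x \<in> U"
        have "\<phi> x * w = a * \<psi>1 x + b * \<psi>2 x"
          unfolding w [OF x, symmetric] a [OF x, symmetric] b [OF x, symmetric] W_def
          by (simp add: algebra_simps)
        then show "\<phi> x = a * \<psi>1 x / w + b * \<psi>2 x / w"
          using w0 by (simp add: add_divide_distrib [symmetric] eq_divide_eq)
      qed
      fix y assume y: "case y of (c1, c2) \<Rightarrow> \<forall>x\<in>U. \<phi> x = c1 * \<psi>1 x + c2 * \<psi>2 x"
      obtain c1 c2 where yc: "y = (c1, c2)" by (cases y)
      have eq: "\<phi> x = c1 * \<psi>1 x + c2 * \<psi>2 x" if "x \<in> U" for x using y yc that by simp
      have "((\<lambda>x. c1 * \<psi>1 x + c2 * \<psi>2 x) has_field_derivative c1 * deriv \<psi>1 x0 + c2 * deriv \<psi>2 x0) (at x0)"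
        by (intro DERIV_add DERIV_cmult d(1) s1 s2 U(3))
      then have "(\<phi> has_field_derivative c1 * deriv \<psi>1 x0 + c2 * deriv \<psi>2 x0) (at x0)"
        by (rule has_field_derivative_transform_within_open [OF _ U(1,3)]) (simp add: eq)
      then have d\<phi>: "deriv \<phi> x0 = c1 * deriv \<psi>1 x0 + c2 * deriv \<psi>2 x0" by (rule DERIV_imp_deriv)
      have "a = c1 * w" "b = c2 * w"
        unfolding w [OF U(3), symmetric] a [OF U(3), symmetric] b [OF U(3), symmetric] W_def d\<phi> eq [OF U(3)]
        by (simp_all add: algebra_simps)
      then show "y = (a / w, b / w)" using w0 yc by simp
    qed
  qed
  then show ?thesis using s1 s2 by (simp add: is_solution_basis_def)
qed

lemma tangent_disc_mono:
  assumes "0 < r" "r \<le> r'"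
  shows "ball (complex_of_real r) r \<subseteq> ball (complex_of_real r') r'"
proof
  fix h assume "h \<in> ball (complex_of_real r) r"
  then have "dist (complex_of_real r) h < r" by simp
  moreover have "dist (complex_of_real r') (of_real r) = r' - r" using assms by (simp add: dist_of_real dist_real_def)
  ultimately show "h \<in> ball (complex_of_real r') r'"
    using dist_triangle [of "complex_of_real r'" h "of_real r"] by simp
qed

lemma asymptotic_to_formal_wkb_mono:
  assumes "asymptotic_to_formal_wkb x0 f U S \<psi>" "U' \<subseteq> U" "S' \<subseteq> S"
  shows "asymptotic_to_formal_wkb x0 f U' S' \<psi>"
proof -
  have le: "at 0 within S' \<inter> C \<le> at 0 within S \<inter> C" for C :: "complex set"
    using assms(3) by (intro at_le) auto
  show ?thesis
    unfolding asymptotic_to_formal_wkb_def poincare_expansion_def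
  proof (intro ballI allI impI)
    fix x \<alpha> \<beta> N assume x: "x \<in> U'" and ab: "- pi / 2 < \<alpha> \<and> \<alpha> \<le> \<beta> \<and> \<beta> < pi / 2"
    have "x \<in> U" using x assms(2) by blast
    show "(\<lambda>h. \<psi> x h * exp (1 / h * contour_integral (linepath x0 x) (f 0))
        - (\<Sum>k<N. fps_nth (formal_wkb_series x0 f x) k * h ^ k))
        \<in> O[at 0 within S' \<inter> closed_sector \<alpha> \<beta>](\<lambda>h. h ^ N)"
      by (rule landau_o.big.filter_mono [OF le])
        (rule assms(1) [unfolded asymptotic_to_formal_wkb_def poincare_expansion_def, rule_format, OF \<open>x \<in> U\<close> ab])
  qed
qed

lemma formal_riccati_solution_mono:
  "formal_riccati_solution q U x0 s f \<Longrightarrow> U' \<subseteq> U \<Longrightarrow> formal_riccati_solution q U' x0 s f"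
  unfolding formal_riccati_solution_def by (meson holomorphic_on_subset subsetD)

lemma schroedinger_solutions_mono:
  "\<phi> \<in> schroedinger_solutions q U h \<Longrightarrow> U' \<subseteq> U \<Longrightarrow> \<phi> \<in> schroedinger_solutions q U' h"
  unfolding schroedinger_solutions_def by (auto intro: holomorphic_on_subset)

lemma holomorphic2_on_mono: "holomorphic2_on f W \<Longrightarrow> W' \<subseteq> W \<Longrightarrow> holomorphic2_on f W'"
  unfolding holomorphic2_on_def by blast

theorem theorem200309160221:
  fixes q :: "complex poly fract poly"
    and x0 s0 :: complex
    and \<gamma> :: "real \<Rightarrow> complex"
  assumes order_q0: "\<forall>p \<in> rat_poles (coeff q 0). pole_order (coeff q 0) p \<ge> 2"
    and poles_qk: "\<forall>k. rat_poles (coeff q k) \<subseteq> rat_poles (coeff q 0)"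
    and order_qk: "\<forall>p \<in> rat_poles (coeff q 0). \<forall>k. pole_order (coeff q k) p \<le> pole_order (coeff q 0) p"
    and x0_no_pole: "Some x0 \<notin> rat_poles (coeff q 0)"
    and x0_no_zero: "rat_eval (coeff q 0) x0 \<noteq> 0"
    and branch: "s0\<^sup>2 = rat_eval (coeff q 0) x0"
    and curve: "maximal_level_curve (coeff q 0) x0 s0 \<gamma>"
    and limit_forward:
      "\<exists>p \<in> rat_poles (coeff q 0). limitin riemann_sphere (\<lambda>t. Some (\<gamma> t)) p at_top"
    and limit_backward:
      "\<exists>p \<in> rat_poles (coeff q 0). limitin riemann_sphere (\<lambda>t. Some (\<gamma> t)) p at_bot"
  shows "\<exists>U0 S0 f\<^sub>p f\<^sub>m \<psi>\<^sub>p \<psi>\<^sub>m.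
      open U0 \<and> convex U0 \<and> x0 \<in> U0 \<and>
      sectorial_domain (- pi / 2) (pi / 2) S0 \<and>
      formal_riccati_solution q U0 x0 s0 f\<^sub>p \<and>
      formal_riccati_solution q U0 x0 (- s0) f\<^sub>m \<and>
      holomorphic2_on \<psi>\<^sub>p (U0 \<times> S0) \<and> holomorphic2_on \<psi>\<^sub>m (U0 \<times> S0) \<and>
      (\<forall>h\<in>S0. is_solution_basis q U0 h (\<lambda>x. \<psi>\<^sub>p x h) (\<lambda>x. \<psi>\<^sub>m x h)) \<and>
      (\<forall>h\<in>S0. \<psi>\<^sub>p x0 h = 1 \<and> \<psi>\<^sub>m x0 h = 1) \<and>
      asymptotic_to_formal_wkb x0 f\<^sub>p U0 S0 \<psi>\<^sub>p \<and>
      asymptotic_to_formal_wkb x0 f\<^sub>m U0 S0 \<psi>\<^sub>m"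
proof -
  have poles: "\<And>k. rat_poles (coeff q k) \<subseteq> rat_poles (coeff q 0)" using poles_qk by blast
  have lc: "level_curve (coeff q 0) x0 s0 \<gamma>" using curve by (simp add: maximal_level_curve_def)
  obtain d X \<sigma> where ch1: "wkb_chart q x0 s0 d X \<sigma>"
    and ch2: "wkb_chart q x0 (- s0) d (\<lambda>z. X (- z)) (\<lambda>z. - \<sigma> (- z))"
    using wkb_charts_of_level_curve [OF order_q0 poles order_qk lc limit_forward limit_backward] by blast
  have s0: "s0 \<noteq> 0" using branch x0_no_zero by auto
  obtain e1 r1 fp \<psi>p where 1: "0 < e1" "0 < r1"
    "formal_riccati_solution q (ball x0 e1) x0 s0 fp"
    "holomorphic2_on \<psi>p (ball x0 e1 \<times> ball (of_real r1) r1)"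
    "\<And>h. h \<in> ball (of_real r1) r1 \<Longrightarrow> (\<lambda>x. \<psi>p x h) \<in> schroedinger_solutions q (ball x0 e1) h"
    "\<And>h. \<psi>p x0 h = 1"
    "\<And>h. h \<in> ball (of_real r1) r1 \<Longrightarrow> \<exists>c. deriv (\<lambda>x. \<psi>p x h) x0 = - (s0 * c / h) \<and> 0 < Re c"
    "asymptotic_to_formal_wkb x0 fp (ball x0 e1) (ball (of_real r1) r1) \<psi>p"
    by (rule exact_WKB_from_chart [OF ch1 s0]) blast
  have s0': "- s0 \<noteq> 0" using s0 by simp
  obtain e2 r2 fm \<psi>m where 2: "0 < e2" "0 < r2"
    "formal_riccati_solution q (ball x0 e2) x0 (- s0) fm"
    "holomorphic2_on \<psi>m (ball x0 e2 \<times> ball (of_real r2) r2)"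
    "\<And>h. h \<in> ball (of_real r2) r2 \<Longrightarrow> (\<lambda>x. \<psi>m x h) \<in> schroedinger_solutions q (ball x0 e2) h"
    "\<And>h. \<psi>m x0 h = 1"
    "\<And>h. h \<in> ball (of_real r2) r2 \<Longrightarrow> \<exists>c. deriv (\<lambda>x. \<psi>m x h) x0 = - (- s0 * c / h) \<and> 0 < Re c"
    "asymptotic_to_formal_wkb x0 fm (ball x0 e2) (ball (of_real r2) r2) \<psi>m"
    by (rule exact_WKB_from_chart [OF ch2 s0']) blast
  define e where "e = min e1 e2"
  define r where "r = min r1 r2"
  define U where "U = ball x0 e"
  define S where "S = ball (complex_of_real r) r"
  have er: "0 < e" "0 < r" using 1 2 by (auto simp: e_def r_def)
  have U: "open U" "convex U" "x0 \<in> U" using er by (auto simp: U_def)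
  have sub: "U \<subseteq> ball x0 e1" "U \<subseteq> ball x0 e2" by (auto simp: U_def e_def)
  have subS: "S \<subseteq> ball (of_real r1) r1" "S \<subseteq> ball (of_real r2) r2"
    unfolding S_def by (rule tangent_disc_mono; use er in \<open>simp add: r_def\<close>)+
  have basis: "is_solution_basis q U h (\<lambda>x. \<psi>p x h) (\<lambda>x. \<psi>m x h)" if h: "h \<in> S" for h
  proof (rule solution_basisI [OF U])
    have h12: "h \<in> ball (of_real r1) r1" "h \<in> ball (of_real r2) r2" using subS h by auto
    show h0: "h \<noteq> 0" using tangent_disc(1) h unfolding S_def by blast
    show "(\<lambda>x. \<psi>p x h) \<in> schroedinger_solutions q U h"
      by (rule schroedinger_solutions_mono [OF 1(5) [OF h12(1)] sub(1)])
    show "(\<lambda>x. \<psi>m x h) \<in> schroedinger_solutions q U h"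
      by (rule schroedinger_solutions_mono [OF 2(5) [OF h12(2)] sub(2)])
    obtain cp where cp: "deriv (\<lambda>x. \<psi>p x h) x0 = - (s0 * cp / h)" "0 < Re cp" using 1(7) [OF h12(1)] by blast
    obtain cm where cm: "deriv (\<lambda>x. \<psi>m x h) x0 = - (- s0 * cm / h)" "0 < Re cm" using 2(7) [OF h12(2)] by blast
    have "\<psi>p x0 h * deriv (\<lambda>x. \<psi>m x h) x0 - deriv (\<lambda>x. \<psi>p x h) x0 * \<psi>m x0 h = s0 * (cm + cp) / h"
      unfolding cp(1) cm(1) 1(6) 2(6) by (simp add: distrib_left add_divide_distrib)
    moreover have "cm + cp \<noteq> 0"
    proof
      assume "cm + cp = 0"
      then have "Re cm + Re cp = 0" by (metis plus_complex.sel(1) zero_complex.sel(1))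
      then show False using cp(2) cm(2) by simp
    qed
    ultimately show "\<psi>p x0 h * deriv (\<lambda>x. \<psi>m x h) x0 - deriv (\<lambda>x. \<psi>p x h) x0 * \<psi>m x0 h \<noteq> 0"
      using s0 h0 by simp
  qed
  show ?thesis
  proof (intro exI conjI ballI)
    show "open U" "convex U" "x0 \<in> U" by (fact U)+
    show "sectorial_domain (- pi / 2) (pi / 2) S" unfolding S_def by (rule sectorial_domain_disc [OF er(2)])
    show "formal_riccati_solution q U x0 s0 fp" by (rule formal_riccati_solution_mono [OF 1(3) sub(1)])
    show "formal_riccati_solution q U x0 (- s0) fm" by (rule formal_riccati_solution_mono [OF 2(3) sub(2)])
    show "holomorphic2_on \<psi>p (U \<times> S)" by (rule holomorphic2_on_mono [OF 1(4)]) (use sub subS in blast)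
    show "holomorphic2_on \<psi>m (U \<times> S)" by (rule holomorphic2_on_mono [OF 2(4)]) (use sub subS in blast)
    show "is_solution_basis q U h (\<lambda>x. \<psi>p x h) (\<lambda>x. \<psi>m x h)" if "h \<in> S" for h by (rule basis [OF that])
    show "\<psi>p x0 h = 1" for h by (rule 1(6))
    show "\<psi>m x0 h = 1" for h by (rule 2(6))
    show "asymptotic_to_formal_wkb x0 fp U S \<psi>p" by (rule asymptotic_to_formal_wkb_mono [OF 1(8) sub(1) subS(1)])
    show "asymptotic_to_formal_wkb x0 fm U S \<psi>m" by (rule asymptotic_to_formal_wkb_mono [OF 2(8) sub(2) subS(2)])
  qed
qed

end
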